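(* Let $G$ be a connected simple unichord-free graph. Then $G$ is a complete graph, or $G$ is sparse, or $G$ is a 2-extension of the Petersen graph or of the Heawood graph, or $G$ has a 1-cutset, or $G$ has a proper 2-cutset, or $G$ has a proper 1-join.
   Context: A unichord is an edge that is the unique chord of some cycle; a graph is unichord-free if it has no unichord. A branch vertex is a vertex of degree at least $3$; a graph is sparse if its branch vertices form a stable set. The Petersen graph is the graph on $\{a_1,\dots,a_5,b_1,\dots,b_5\}$ in which $a_1a_2a_3a_4a_5a_1$ and $b_1b_2b_3b_4b_5b_1$ are chordless cycles and the only other edges are $a_1b_1,a_2b_4,a_3b_2,a_4b_5,a_5b_3$. The Heawood graph is the graph on $\{a_1,\dots,a_{14}\}$ in which $a_1a_2\dots a_{14}a_1$ is a cycle and the only other edges are $a_1a_{10},a_2a_7,a_3a_{12},a_4a_9,a_5a_{14},a_6a_{11},a_8a_{13}$. A 2-extension of a graph $H$ is any graph obtained by first deleting vertices from $H$ and then subdividing (possibly several times) edges incident to at least one vertex of degree $2$. A 1-cutset of a connected graph $G=(V,E)$ is a vertex $v$ such that $V\setminus\{v\}$ can be partitioned into nonempty sets $X,Y$ with no edge between $X$ and $Y$. A proper 2-cutset of $G=(V,E)$ is a pair of non-adjacent vertices $a,b$ such that $V$ can be partitioned into $X$, $Y$, $\{a,b\}$ with $|X|\ge 2$, $|Y|\ge 2$, no edge between $X$ and $Y$, and such that both $G[X\cup\{a,b\}]$ and $G[Y\cup\{a,b\}]$ contain an $ab$-path but neither of them is (induces) an $ab$-path. A proper 1-join of $G=(V,E)$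 is a partition of $V$ into $X,Y$ such that there are stable sets $A\subseteq X$, $B\subseteq Y$ with $|A|\ge2$, $|B|\ge2$, all edges between $A$ and $B$ present, and no other edges between $X$ and $Y$. *)

theory Defs
  imports Main
begin

definition simple_graph :: "'a set \<Rightarrow> ('a \<Rightarrow> 'a \<Rightarrow> bool) \<Rightarrow> bool" where
  "simple_graph V adj \<longleftrightarrow> finite V \<and> (\<forall>x y. adj x y \<longrightarrow> x \<in> V \<and> y \<in> V)
     \<and> (\<forall>x y. adj x y \<longrightarrow> adj y x) \<and> (\<forall>x. \<not> adj x x)"

definition connected_graph :: "'a set \<Rightarrow> ('a \<Rightarrow> 'a \<Rightarrow> bool) \<Rightarrow> bool" where
  "connected_graph V adj \<longleftrightarrow> V \<noteq> {} \<and> (\<forall>x\<in>V. \<forall>y\<in>V. adj\<^sup>*\<^sup>* x y)"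

definition degree :: "'a set \<Rightarrow> ('a \<Rightarrow> 'a \<Rightarrow> bool) \<Rightarrow> 'a \<Rightarrow> nat" where
  "degree V adj x = card {y \<in> V. adj x y}"

definition cyc_adj :: "'a list \<Rightarrow> 'a \<Rightarrow> 'a \<Rightarrow> bool" where
  "cyc_adj c x y \<longleftrightarrow> (\<exists>i < length c.
      (c ! i = x \<and> c ! ((i + 1) mod length c) = y) \<or> (c ! i = y \<and> c ! ((i + 1) mod length c) = x))"

definition is_cycle :: "'a set \<Rightarrow> ('a \<Rightarrow> 'a \<Rightarrow> bool) \<Rightarrow> 'a list \<Rightarrow> bool" where
  "is_cycle V adj c \<longleftrightarrow> distinct c \<and> length c \<ge> 3 \<and> set c \<subseteq> V
     \<and> (\<forall>i < length c. adj (c ! i) (c ! ((i + 1) mod length c)))"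

definition chords :: "('a \<Rightarrow> 'a \<Rightarrow> bool) \<Rightarrow> 'a list \<Rightarrow> 'a set set" where
  "chords adj c = {{x, y} | x y. x \<in> set c \<and> y \<in> set c \<and> adj x y \<and> \<not> cyc_adj c x y}"

definition unichord :: "'a set \<Rightarrow> ('a \<Rightarrow> 'a \<Rightarrow> bool) \<Rightarrow> 'a set \<Rightarrow> bool" where
  "unichord V adj e \<longleftrightarrow> (\<exists>c. is_cycle V adj c \<and> chords adj c = {e})"

definition unichord_free :: "'a set \<Rightarrow> ('a \<Rightarrow> 'a \<Rightarrow> bool) \<Rightarrow> bool" where
  "unichord_free V adj \<longleftrightarrow> \<not> (\<exists>e. unichord V adj e)"

definition complete_graph :: "'a set \<Rightarrow> ('a \<Rightarrow> 'a \<Rightarrow> bool) \<Rightarrow> bool" where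
  "complete_graph V adj \<longleftrightarrow> (\<forall>x\<in>V. \<forall>y\<in>V. x \<noteq> y \<longrightarrow> adj x y)"

definition sparse :: "'a set \<Rightarrow> ('a \<Rightarrow> 'a \<Rightarrow> bool) \<Rightarrow> bool" where
  "sparse V adj \<longleftrightarrow> (\<forall>x\<in>V. \<forall>y\<in>V. degree V adj x \<ge> 3 \<and> degree V adj y \<ge> 3 \<longrightarrow> \<not> adj x y)"

definition stable :: "('a \<Rightarrow> 'a \<Rightarrow> bool) \<Rightarrow> 'a set \<Rightarrow> bool" where
  "stable adj A \<longleftrightarrow> (\<forall>x\<in>A. \<forall>y\<in>A. \<not> adj x y)"

definition is_path_in :: "('a \<Rightarrow> 'a \<Rightarrow> bool) \<Rightarrow> 'a set \<Rightarrow> 'a \<Rightarrow> 'a \<Rightarrow> 'a list \<Rightarrow> bool" where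
  "is_path_in adj W a b p \<longleftrightarrow> p \<noteq> [] \<and> distinct p \<and> hd p = a \<and> last p = b \<and> set p \<subseteq> W
     \<and> (\<forall>i. Suc i < length p \<longrightarrow> adj (p ! i) (p ! Suc i))"

definition contains_path :: "('a \<Rightarrow> 'a \<Rightarrow> bool) \<Rightarrow> 'a set \<Rightarrow> 'a \<Rightarrow> 'a \<Rightarrow> bool" where
  "contains_path adj W a b \<longleftrightarrow> (\<exists>p. is_path_in adj W a b p)"

definition induces_path :: "('a \<Rightarrow> 'a \<Rightarrow> bool) \<Rightarrow> 'a set \<Rightarrow> 'a \<Rightarrow> 'a \<Rightarrow> bool" where
  "induces_path adj W a b \<longleftrightarrow> (\<exists>p. is_path_in adj W a b p \<and> set p = W
     \<and> (\<forall>i j. i < length p \<and> j < length p \<and> adj (p ! i) (p ! j) \<longrightarrow> j = Suc i \<or> i = Suc j))"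

definition has_1_cutset :: "'a set \<Rightarrow> ('a \<Rightarrow> 'a \<Rightarrow> bool) \<Rightarrow> bool" where
  "has_1_cutset V adj \<longleftrightarrow> (\<exists>v X Y. v \<in> V \<and> X \<union> Y = V - {v} \<and> X \<inter> Y = {}
     \<and> X \<noteq> {} \<and> Y \<noteq> {} \<and> (\<forall>x\<in>X. \<forall>y\<in>Y. \<not> adj x y))"

definition has_proper_2_cutset :: "'a set \<Rightarrow> ('a \<Rightarrow> 'a \<Rightarrow> bool) \<Rightarrow> bool" where
  "has_proper_2_cutset V adj \<longleftrightarrow> (\<exists>a b X Y. a \<in> V \<and> b \<in> V \<and> a \<noteq> b \<and> \<not> adj a b
     \<and> X \<union> Y \<union> {a, b} = V \<and> X \<inter> Y = {} \<and> a \<notin> X \<union> Y \<and> b \<notin> X \<union> Y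
     \<and> card X \<ge> 2 \<and> card Y \<ge> 2 \<and> (\<forall>x\<in>X. \<forall>y\<in>Y. \<not> adj x y)
     \<and> contains_path adj (X \<union> {a, b}) a b \<and> contains_path adj (Y \<union> {a, b}) a b
     \<and> \<not> induces_path adj (X \<union> {a, b}) a b \<and> \<not> induces_path adj (Y \<union> {a, b}) a b)"

definition has_proper_1_join :: "'a set \<Rightarrow> ('a \<Rightarrow> 'a \<Rightarrow> bool) \<Rightarrow> bool" where
  "has_proper_1_join V adj \<longleftrightarrow> (\<exists>X Y A B. X \<union> Y = V \<and> X \<inter> Y = {}
     \<and> A \<subseteq> X \<and> B \<subseteq> Y \<and> stable adj A \<and> stable adj B \<and> card A \<ge> 2 \<and> card B \<ge> 2
     \<and> (\<forall>x\<in>X. \<forall>y\<in>Y. adj x y \<longleftrightarrow> x \<in> A \<and> y \<in> B))"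

definition adj_of :: "(nat \<times> nat) list \<Rightarrow> nat \<Rightarrow> nat \<Rightarrow> bool" where
  "adj_of es x y \<longleftrightarrow> (x, y) \<in> set es \<or> (y, x) \<in> set es"

text \<open>Petersen graph: a_i = i, b_i = i + 5 (i = 1..5).\<close>
definition petersen_V :: "nat set" where "petersen_V = {1..10}"
definition petersen_adj :: "nat \<Rightarrow> nat \<Rightarrow> bool" where
  "petersen_adj = adj_of [(1,2),(2,3),(3,4),(4,5),(5,1),
                          (6,7),(7,8),(8,9),(9,10),(10,6),
                          (1,6),(2,9),(3,7),(4,10),(5,8)]"

definition heawood_V :: "nat set" where "heawood_V = {1..14}"
definition heawood_adj :: "nat \<Rightarrow> nat \<Rightarrow> bool" where
  "heawood_adj = adj_of [(1,2),(2,3),(3,4),(4,5),(5,6),(6,7),(7,8),(8,9),(9,10),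
                         (10,11),(11,12),(12,13),(13,14),(14,1),
                         (1,10),(2,7),(3,12),(4,9),(5,14),(6,11),(8,13)]"

text \<open>2-extension: G = (V, adj) is (isomorphic to) a graph obtained from H by deleting
  vertices (keeping the induced subgraph H[S]) and then replacing each edge uv of H[S]
  by a path P u v; P u v has length at least 2 only if u or v has degree 2 in H[S].
  Here f embeds S into V and the paths are internally disjoint, their interiors avoid
  f ` S, and they cover all vertices and all edges of G.\<close>

definition interior :: "'a list \<Rightarrow> 'a set" where
  "interior p = set (butlast (tl p))"

definition consec :: "'a list \<Rightarrow> 'a \<Rightarrow> 'a \<Rightarrow> bool" where
  "consec p x y \<longleftrightarrow> (\<exists>i. Suc i < length p \<and> ((p ! i = x \<and> p ! Suc i = y) \<or> (p ! i = y \<and> p ! Suc i = x)))"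

definition two_extension ::
  "'a set \<Rightarrow> ('a \<Rightarrow> 'a \<Rightarrow> bool) \<Rightarrow> 'b set \<Rightarrow> ('b \<Rightarrow> 'b \<Rightarrow> bool) \<Rightarrow> bool" where
  "two_extension V adj VH adjH \<longleftrightarrow> (\<exists>S f P.
     S \<subseteq> VH \<and> inj_on f S \<and> f ` S \<subseteq> V
     \<and> (\<forall>u\<in>S. \<forall>v\<in>S. adjH u v \<longrightarrow>
          is_path_in adj V (f u) (f v) (P u v) \<and> length (P u v) \<ge> 2
          \<and> P v u = rev (P u v)
          \<and> interior (P u v) \<inter> f ` S = {}
          \<and> (length (P u v) > 2 \<longrightarrow> degree S adjH u = 2 \<or> degree S adjH v = 2))
     \<and> (\<forall>u\<in>S. \<forall>v\<in>S. \<forall>u'\<in>S. \<forall>v'\<in>S. adjH u v \<and> adjH u' v' \<and> {u, v} \<noteq> {u', v'} \<longrightarrow>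
          interior (P u v) \<inter> interior (P u' v') = {})
     \<and> V = f ` S \<union> (\<Union>{interior (P u v) | u v. u \<in> S \<and> v \<in> S \<and> adjH u v})
     \<and> (\<forall>x y. adj x y \<longrightarrow> (\<exists>u\<in>S. \<exists>v\<in>S. adjH u v \<and> consec (P u v) x y)))"

end

theory Submission
  imports Defs
begin

text \<open>Triangles give a complete graph or a cutvertex, and a maximal complete bipartite subgraph that contains
  a square gives a proper 1-join. Otherwise let uv be an edge between branch vertices. Unless there is a
  cutset, uv is a chord of a cycle by Menger's theorem, and a shortest chorded cycle has exactly two
  chords, which cross: this is the Petersen graph without two adjacent vertices, with edges subdivided.

  Starting from there, take an induced 2-extension H of a subgraph of the Petersen or Heawood graph and a
  connected set outside H. If its attachments do not lie on one subdivided edge of H, then after rerouting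
  H there is an ear or a single vertex with this property, and each position of its ends produces a cycle
  with a unique chord or a larger 2-extension. There are finitely many positions up to subdivision, and each
  is settled by a certificate. If the attachments of every component lie on one subdivided edge, the ends
  of that edge form a proper 2-cutset.\<close>

subsection \<open>Walks, induced paths and cycles\<close>

text \<open>The obstacle is the unknown length of the subdivided edges: finitely many checks must
  cover infinitely many graphs. Embeddings are therefore kept induced, and a path is classified only
  by whether it has an inner vertex. A cycle of the skeleton then stands for a cycle of the graph,
  and its chords are the skeleton edges off the cycle that join two of its vertices and have no
  inner vertex. Cutting a path at an attachment loses this information for its halves, so a
  certificate keeps such halves from being possible chords or distinguishes the cases.

  Triangles and squares go first because their absence limits how a single outside vertex can
  attach. Growth follows a fixed acyclic order: K4 leads to P1 or H3, P1 to P0 or H1, H3 to H2, H2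
  to H1 and H1 to H0, while P0 and H0 have no extension. The Heawood graph can be reached through P1
  as well, because a subdivided part of the Petersen graph does not yet decide between the two
  graphs.\<close>

lemma consec_Nil [simp]: "\<not> consec [] x y"
  and consec_single [simp]: "\<not> consec [a] x y"
  by (auto simp: consec_def)

lemma consec_Cons: "consec (a # xs) x y \<longleftrightarrow> xs \<noteq> [] \<and> {x, y} = {a, hd xs} \<or> consec xs x y"
proof -
  have *: "(\<exists>i. P i) \<longleftrightarrow> P 0 \<or> (\<exists>i. P (Suc i))" for P :: "nat \<Rightarrow> bool"
    by (metis not0_implies_Suc)
  show ?thesis
    unfolding consec_def
    by (subst *, cases "xs = []") (simp_all add: doubleton_eq_iff hd_conv_nth, blast)
qed

lemma consec_append:
  "consec (xs @ ys) x y \<longleftrightarrow>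
     consec xs x y \<or> consec ys x y \<or> xs \<noteq> [] \<and> ys \<noteq> [] \<and> {x, y} = {last xs, hd ys}"
  by (induction xs) (auto simp: consec_Cons)

lemma consec_in_set: "consec p x y \<Longrightarrow> x \<in> set p \<and> y \<in> set p"
  by (auto simp: consec_def)

lemma consec_commute: "consec p x y \<longleftrightarrow> consec p y x"
  by (auto simp: consec_def)

lemma consec_rev [simp]: "consec (rev p) x y \<longleftrightarrow> consec p x y"
  by (induction p) (auto simp: consec_append consec_Cons last_rev insert_commute)

text \<open>The cut vertex \<open>b\<close> belongs to both lists on the right, so the edges of a
  composite path or cycle split into those of its segments.\<close>

lemma consec_glue: "consec (a # p @ b # q) x y \<longleftrightarrow> consec (a # p @ [b]) x y \<or> consec (b # q) x y"
  using consec_append[of "a # p" "b # q" x y] consec_append[of "a # p" "[b]" x y] by simp blast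

lemma consec_capped:
  "p \<noteq> [] \<Longrightarrow> consec (x # p @ [y]) s t \<longleftrightarrow> consec p s t \<or> {s, t} = {x, hd p} \<or> {s, t} = {last p, y}"
  by (auto simp: consec_Cons[of x] consec_append)

text \<open>A nonempty interior separates the two ends. Hence a path with an inner vertex
  contributes no edge between vertices outside its interior.\<close>

lemma consec_inner: "consec (a # J @ [b]) x y \<Longrightarrow> J \<noteq> [] \<Longrightarrow> x \<in> set J \<or> y \<in> set J"
proof -
  assume J: "consec (a # J @ [b]) x y" "J \<noteq> []"
  then have "consec J x y \<or> {x, y} = {a, hd J} \<or> {x, y} = {last J, b}"
    unfolding consec_Cons[of a] consec_append by auto
  moreover have "hd J \<in> set J" "last J \<in> set J" using J by auto
  ultimately show ?thesis using consec_in_set[of J x y] by (metis doubleton_eq_iff)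
qed

lemma consec_split: "consec p x y \<longleftrightarrow> (\<exists>A B. p = A @ x # y # B \<or> p = A @ y # x # B)"
proof
  assume "consec p x y"
  then show "\<exists>A B. p = A @ x # y # B \<or> p = A @ y # x # B"
  proof (induction p)
    case (Cons a p)
    show ?case
    proof (cases "consec p x y")
      case True
      then show ?thesis using Cons.IH by (metis append_Cons)
    next
      case False
      then have "p \<noteq> []" "{x, y} = {a, hd p}" using Cons.prems by (auto simp: consec_Cons)
      then obtain b q where "p = b # q" "{x, y} = {a, b}" by (cases p) auto
      then show ?thesis by (metis append_Nil doubleton_eq_iff)
    qed
  qed auto
qed (auto simp: consec_append consec_Cons)

lemma ends_butlast_tl:
  assumes "3 \<le> length p"
  shows "p = hd p # butlast (tl p) @ [last p]" "butlast (tl p) \<noteq> []"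
proof -
  obtain a q where p: "p = a # q" using assms by (cases p) auto
  then have q: "2 \<le> length q" using assms by simp
  then have "q \<noteq> []" by auto
  then show "p = hd p # butlast (tl p) @ [last p]" by (simp add: p)
  show "butlast (tl p) \<noteq> []" using q by (auto simp: p butlast_conv_take)
qed

lemma nth_append_hd:
  assumes "i < length c"
  shows "(c @ [hd c]) ! i = c ! i" "(c @ [hd c]) ! Suc i = c ! (Suc i mod length c)"
proof -
  show "(c @ [hd c]) ! i = c ! i" using assms by (simp add: nth_append)
  show "(c @ [hd c]) ! Suc i = c ! (Suc i mod length c)"
  proof (cases "Suc i = length c")
    case True
    then have "c \<noteq> []" by auto
    then show ?thesis using True by (simp add: nth_append hd_conv_nth[symmetric])
  next
    case False
    then have "Suc i < length c" using assms by simp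
    then show ?thesis by (simp add: nth_append)
  qed
qed

text \<open>Repeating the head at the end reduces cyclic adjacency to adjacency along a list and
  removes the arithmetic modulo the length.\<close>

lemma cyc_adj_eq_consec: "cyc_adj c x y \<longleftrightarrow> consec (c @ [hd c]) x y"
  unfolding cyc_adj_def consec_def by (auto simp: nth_append_hd)

lemma is_cycle_eq:
  "is_cycle V adj c \<longleftrightarrow>
     distinct c \<and> 3 \<le> length c \<and> set c \<subseteq> V \<and> successively adj (c @ [hd c])"
  unfolding is_cycle_def by (auto simp: successively_conv_nth nth_append_hd)

lemma successively_consec: "successively R p \<Longrightarrow> symp R \<Longrightarrow> consec p x y \<Longrightarrow> R x y"
  by (auto simp: successively_conv_nth consec_def dest: sympD)

locale graph =
  fixes V :: "'a set" and adj :: "'a \<Rightarrow> 'a \<Rightarrow> bool"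
  assumes simple: "simple_graph V adj"
begin

lemma finV: "finite V" and adjV: "adj x y \<Longrightarrow> x \<in> V \<and> y \<in> V"
  and adj_sym: "adj x y \<Longrightarrow> adj y x" and adj_irrefl [simp]: "\<not> adj x x"
  using simple by (auto simp: simple_graph_def)

lemma adj_commute: "adj x y \<longleftrightarrow> adj y x"
  using adj_sym by blast

lemma symp_adj: "symp adj"
  using adj_sym by (auto intro: sympI)

lemma successively_adj_rev [simp]: "successively adj (rev p) \<longleftrightarrow> successively adj p"
proof -
  have "(\<lambda>x y. adj y x) = adj" by (intro ext) (rule adj_commute)
  then show ?thesis by (simp only: successively_rev)
qed

definition walk :: "'a set \<Rightarrow> 'a list \<Rightarrow> bool" where
  "walk C p \<longleftrightarrow> p \<noteq> [] \<and> set p \<subseteq> C \<and> successively adj p"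

definition ipath :: "'a list \<Rightarrow> bool" where
  "ipath p \<longleftrightarrow> p \<noteq> [] \<and> distinct p \<and> successively adj p
     \<and> (\<forall>x\<in>set p. \<forall>y\<in>set p. adj x y \<longrightarrow> consec p x y)"

lemma walk_single [simp]: "walk C [x] \<longleftrightarrow> x \<in> C"
  by (auto simp: walk_def)

lemma walk_rev [simp]: "walk C (rev p) \<longleftrightarrow> walk C p"
  unfolding walk_def successively_adj_rev set_rev rev_is_Nil_conv ..

lemma walk_mono: "walk C p \<Longrightarrow> C \<subseteq> D \<Longrightarrow> walk D p"
  by (auto simp: walk_def)

lemma walk_append:
  "walk C p \<Longrightarrow> walk C q \<Longrightarrow> adj (last p) (hd q) \<Longrightarrow> walk C (p @ q)"
  by (auto simp: walk_def successively_append_iff)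

lemma walk_appendD1: "walk C (p @ q) \<Longrightarrow> p \<noteq> [] \<Longrightarrow> walk C p"
  and walk_appendD2: "walk C (p @ q) \<Longrightarrow> q \<noteq> [] \<Longrightarrow> walk C q"
  by (auto simp: walk_def successively_append_iff)

text \<open>A walk that is shortest for a condition on its two ends is an induced path, as any repetition
  or chord would allow a shortcut.\<close>

lemma minimal_walk:
  assumes "walk C q" "R (hd q) (last q)"
  obtains p where "walk C p" "R (hd p) (last p)" "ipath p"
    "\<And>p'. walk C p' \<Longrightarrow> R (hd p') (last p') \<Longrightarrow> length p \<le> length p'"
proof -
  define p where "p = arg_min length (\<lambda>p. walk C p \<and> R (hd p) (last p))"
  have p: "walk C p" "R (hd p) (last p)"
    and min: "\<And>p'. walk C p' \<Longrightarrow> R (hd p') (last p') \<Longrightarrow> length p \<le> length p'"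
    using arg_min_nat_lemma[of "\<lambda>p. walk C p \<and> R (hd p) (last p)" q length] assms
    unfolding p_def by auto
  \<comment> \<open>One shortcut argument serves for both distinctness and the absence of
    chords.\<close>
  have cut: "k \<le> Suc i"
    if "i < k" "k < length p" "p ! i = p ! k \<or> adj (p ! i) (p ! k)" for i k
  proof -
    \<comment> \<open>For equal vertices one copy must go, hence \<open>take i\<close>; the new walk
      is then strictly shorter. For adjacent vertices both stay, hence \<open>take (Suc i)\<close>,
      and the lengths agree exactly when \<open>k = Suc i\<close>.\<close>
    define p' where "p' = (if p ! i = p ! k then take i p @ drop k p else take (Suc i) p @ drop k p)"
    have suc: "successively adj p" and sub: "set p \<subseteq> C"
      using p by (auto simp: walk_def)
    have tk: "successively adj (take j p)" and dr: "successively adj (drop j p)" for j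
      using suc append_take_drop_id[of j p] by (metis successively_append_iff)+
    have "set p' \<subseteq> C"
      using sub unfolding p'_def by (auto dest: in_set_takeD in_set_dropD)
    moreover have "p' \<noteq> []" "last p' = last p"
      using that unfolding p'_def by auto
    moreover have "hd p' = hd p"
      using that unfolding p'_def
      by (cases p; cases i) (auto simp: hd_append hd_drop_conv_nth)
    moreover have "successively adj p'"
    proof (cases "p ! i = p ! k")
      case True
      have "adj (last (take i p)) (p ! k)" if "i \<noteq> 0"
      proof -
        have "last (take i p) = p ! (i - 1)"
          using that \<open>i < k\<close> \<open>k < length p\<close> by (subst last_conv_nth) auto
        moreover have "adj (p ! (i - 1)) (p ! i)"
          using suc that \<open>i < k\<close> \<open>k < length p\<close>
          by (metis Suc_diff_1 bot_nat_0.not_eq_extremum order_less_trans successively_nth)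
        ultimately show ?thesis using True by simp
      qed
      then show ?thesis
        using True that tk dr unfolding p'_def by (auto simp: successively_append_iff hd_drop_conv_nth)
    next
      case False
      have "last (take (Suc i) p) = p ! i"
        using that by (simp add: take_Suc_conv_app_nth)
      then show ?thesis
        using False that tk dr unfolding p'_def by (auto simp: successively_append_iff hd_drop_conv_nth)
    qed
    ultimately have "length p \<le> length p'"
      using p min by (simp add: walk_def)
    then show ?thesis
      using that unfolding p'_def by (auto split: if_splits)
  qed
  have "distinct p"
  proof (unfold distinct_conv_nth, intro allI impI)
    fix i j assume ij: "i < length p" "j < length p" "i \<noteq> j"
    show "p ! i \<noteq> p ! j"
    proof
      assume eq: "p ! i = p ! j"
      have *: False if "a < b" "b < length p" "p ! a = p ! b" for a b
      proof -
        have "b = Suc a" using cut[of a b] that by auto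
        then show False
          using p(1) that successively_nth[of adj p a] by (auto simp: walk_def)
      qed
      show False using *[of i j] *[of j i] ij eq by (metis nat_neq_iff)
    qed
  qed
  moreover have "consec p x y" if xy: "x \<in> set p" "y \<in> set p" "adj x y" for x y
  proof -
    obtain i j where ij: "i < length p" "j < length p" "x = p ! i" "y = p ! j"
      using xy by (metis in_set_conv_nth)
    then have "i \<noteq> j" using xy by auto
    then have "j = Suc i \<or> i = Suc j"
      using cut[of i j] cut[of j i] ij xy adj_sym
      by (metis Suc_leI le_antisym nat_neq_iff)
    then show ?thesis using ij by (auto simp: consec_def)
  qed
  ultimately have "ipath p"
    using p(1) by (auto simp: ipath_def walk_def)
  then show ?thesis using that p min by blast
qed

definition conn_set :: "'a set \<Rightarrow> bool" where
  "conn_set C \<longleftrightarrow> (\<forall>a\<in>C. \<forall>b\<in>C. \<exists>p. walk C p \<and> hd p = a \<and> last p = b)"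

definition comp :: "'a set \<Rightarrow> 'a \<Rightarrow> 'a set" where
  "comp U v = {z. \<exists>p. walk U p \<and> hd p = v \<and> last p = z}"

lemma comp_subset: "comp U v \<subseteq> U"
  unfolding comp_def walk_def by auto

lemma comp_self: "v \<in> U \<Longrightarrow> v \<in> comp U v"
  unfolding comp_def by (auto intro!: exI[of _ "[v]"])

lemma comp_closed: "z \<in> comp U v \<Longrightarrow> adj z y \<Longrightarrow> y \<in> U \<Longrightarrow> y \<in> comp U v"
  unfolding comp_def
proof clarify
  fix p assume "walk U p" "adj (last p) y" "y \<in> U" "v = hd p"
  then show "\<exists>pa. walk U pa \<and> hd pa = hd p \<and> last pa = y"
    by (intro exI[of _ "p @ [y]"]) (auto simp: walk_append walk_def successively_append_iff)
qed

lemma walk_in_comp: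
  assumes "walk U p" "hd p = v"
  shows "walk (comp U v) p"
proof -
  have "x \<in> comp U v" if "x \<in> set p" for x
  proof -
    obtain a b where ab: "p = a @ x # b" using split_list[OF \<open>x \<in> set p\<close>] by blast
    then have "walk U (a @ [x])" using assms walk_appendD1[of U "a @ [x]" b] by simp
    moreover have "hd (a @ [x]) = v" using ab assms by (cases a) auto
    ultimately show ?thesis unfolding comp_def by (auto intro!: exI[of _ "a @ [x]"])
  qed
  then show ?thesis using assms by (auto simp: walk_def)
qed

lemma walk_join:
  assumes "walk C p" "walk C q" "last p = hd q"
  shows "walk C (p @ tl q)" "hd (p @ tl q) = hd p" "last (p @ tl q) = last q"
proof -
  obtain a r where q: "q = a # r" using assms(2) by (cases q) (auto simp: walk_def)
  have p: "p \<noteq> []" using assms(1) by (simp add: walk_def)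
  show "walk C (p @ tl q)"
    using assms p by (cases "r = []") (auto simp: q walk_def successively_append_iff successively_Cons)
  show "hd (p @ tl q) = hd p" "last (p @ tl q) = last q"
    using assms p by (auto simp: q)
qed

lemma conn_set_comp: "conn_set (comp U v)"
  unfolding conn_set_def
proof (intro ballI)
  fix a b assume ab: "a \<in> comp U v" "b \<in> comp U v"
  obtain p q where p: "walk U p" "hd p = v" "last p = a" and q: "walk U q" "hd q = v" "last q = b"
    using ab unfolding comp_def by auto
  have pq: "walk (comp U v) (rev p)" "walk (comp U v) q"
    using p q walk_in_comp by simp_all
  have ne: "p \<noteq> []" using p by (auto simp: walk_def)
  have "last (rev p) = hd q" using p q ne by (simp add: last_rev)
  from walk_join[OF pq this] show "\<exists>p. walk (comp U v) p \<and> hd p = a \<and> last p = b"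
    using p q ne by (metis hd_rev)
qed

definition att :: "'a set \<Rightarrow> 'a set \<Rightarrow> 'a set" where
  "att W C = {x \<in> W. \<exists>c\<in>C. adj c x}"

end

subsection \<open>Skeletons and their embeddings\<close>

text \<open>A skeleton on the vertices 0, ..., n - 1 is a list of labelled edges. In the graph an edge becomes
  a path, which is a single edge for Unit, has an inner vertex for Long, and is arbitrary for Any.\<close>

datatype lab = Unit | Long | Any

type_synonym lab_edges = "(nat \<times> nat \<times> lab) list"

definition edge :: "lab_edges \<Rightarrow> nat \<Rightarrow> nat \<Rightarrow> bool" where
  "edge E u v \<longleftrightarrow> (\<exists>(a, b, l)\<in>set E. a = u \<and> b = v \<or> a = v \<and> b = u)"

lemma edge_iff: "edge E u v \<longleftrightarrow> (\<exists>l. (u, v, l) \<in> set E \<or> (v, u, l) \<in> set E)"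
  unfolding edge_def by fastforce

lemma edge_commute: "edge E u v \<longleftrightarrow> edge E v u"
  unfolding edge_iff by blast

lemma edgeI: "(u, v, l) \<in> set E \<Longrightarrow> edge E u v"
  unfolding edge_iff by blast

definition cpairs :: "'b list \<Rightarrow> ('b \<times> 'b) list" where
  "cpairs c = zip c (tl c @ [hd c])"

definition check_cyc :: "lab_edges \<Rightarrow> nat list \<Rightarrow> bool" where
  "check_cyc E c \<longleftrightarrow> distinct c \<and> 3 \<le> length c \<and> (\<forall>(u, v)\<in>set (cpairs c). edge E u v)"

text \<open>The potential chords of the real cycle that a cycle c of the skeleton stands for: an edge of label
  Any may or may not be a chord, so a certificate has to avoid it.\<close>

definition free_edges :: "lab_edges \<Rightarrow> nat list \<Rightarrow> lab_edges" where
  "free_edges E c = filter (\<lambda>(u, v, l). l \<noteq> Long \<and> u \<in> set c \<and> v \<in> set c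
     \<and> \<not> (\<exists>(a, b)\<in>set (cpairs c). a = u \<and> b = v \<or> a = v \<and> b = u)) E"

definition check_uni :: "lab_edges \<Rightarrow> nat list \<Rightarrow> bool" where
  "check_uni E c \<longleftrightarrow> check_cyc E c \<and> map (snd \<circ> snd) (free_edges E c) = [Unit]"

definition check_hole :: "lab_edges \<Rightarrow> nat list \<Rightarrow> bool" where
  "check_hole E c \<longleftrightarrow> check_cyc E c \<and> free_edges E c = []"

lemma cpairs_eq: "c \<noteq> [] \<Longrightarrow> cpairs c = zip (c @ [hd c]) (tl (c @ [hd c]))"
  unfolding cpairs_def by (cases c) (simp_all add: zip_append1 flip: append_Cons)

text \<open>The bound 3 is sharp, as a list of length 2 passes its one edge twice. In general two
  positions with the same unordered pair would be cyclic successors of each other, which forces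
  length at most 2.\<close>

lemma distinct_cpairs:
  assumes "distinct c" "3 \<le> length c"
  shows "distinct (map (\<lambda>(u, v). {u, v}) (cpairs c))"
proof -
  have len: "length (cpairs c) = length c" using assms by (auto simp: cpairs_def)
  have nth: "cpairs c ! i = (c ! i, c ! (Suc i mod length c))" if "i < length c" for i
  proof -
    have "(tl c @ [hd c]) ! i = (c @ [hd c]) ! Suc i"
      using that by (cases c) auto
    then show ?thesis
      using that nth_append_hd(2)[OF that] by (auto simp: cpairs_def)
  qed
  show ?thesis
  proof (unfold distinct_conv_nth, intro allI impI)
    fix i j assume "i < length (map (\<lambda>(u, v). {u, v}) (cpairs c))"
      "j < length (map (\<lambda>(u, v). {u, v}) (cpairs c))" "i \<noteq> j"
    then have ij: "i < length c" "j < length c" "i \<noteq> j" by (simp_all add: len)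
    have lt: "Suc i mod length c < length c" "Suc j mod length c < length c"
      using assms by (auto intro!: mod_less_divisor)
    have no: False if "i = Suc j mod length c" "j = Suc i mod length c"
    proof (cases "Suc i < length c")
      case True
      have j: "j = Suc i" using that(2) True by (metis mod_less)
      have "Suc (Suc i) < length c \<or> Suc (Suc i) = length c" using True by linarith
      then show False
      proof
        assume "Suc (Suc i) < length c"
        with that(1) have "i = Suc (Suc i)" unfolding j by (metis mod_less)
        then show False by simp
      next
        assume eq: "Suc (Suc i) = length c"
        with that(1) have "i = 0" unfolding j by (metis mod_self)
        with eq assms(2) show False by simp
      qed
    next
      case False
      then have i: "Suc i = length c" using ij by simp
      have j: "j = 0" using that(2) unfolding i by (metis mod_self)
      have "i = Suc 0" using that(1) assms(2) unfolding j by (metis One_nat_def Suc_le_lessD mod_less numeral_3_eq_3 Suc_lessD)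
      then show False using i assms by simp
    qed
    show "map (\<lambda>(u, v). {u, v}) (cpairs c) ! i \<noteq> map (\<lambda>(u, v). {u, v}) (cpairs c) ! j"
      using ij len lt no assms(1) by (auto simp: nth doubleton_eq_iff nth_eq_iff_index_eq)
  qed
qed

definition spath :: "(nat \<Rightarrow> 'a) \<Rightarrow> (nat \<Rightarrow> nat \<Rightarrow> 'a list) \<Rightarrow> nat \<Rightarrow> nat \<Rightarrow> 'a list" where
  "spath f I u v = f u # I u v @ [f v]"

definition img :: "nat \<Rightarrow> lab_edges \<Rightarrow> (nat \<Rightarrow> 'a) \<Rightarrow> (nat \<Rightarrow> nat \<Rightarrow> 'a list) \<Rightarrow> 'a set" where
  "img n E f I = f ` {..<n} \<union> {x. \<exists>u v. edge E u v \<and> x \<in> set (I u v)}"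

text \<open>The last vertex of the walk is left out. A closed walk \<open>c @ [hd c]\<close> thus
  expands to a cycle list without repetition, and appending \<open>f (last ws)\<close> completes an
  open walk.\<close>

fun expand :: "(nat \<Rightarrow> 'a) \<Rightarrow> (nat \<Rightarrow> nat \<Rightarrow> 'a list) \<Rightarrow> nat list \<Rightarrow> 'a list" where
  "expand f I (u # v # r) = f u # I u v @ expand f I (v # r)"
| "expand f I _ = []"

lemma set_expand: "set (expand f I ws) = f ` set (butlast ws) \<union> (\<Union>(u, v)\<in>set (zip ws (tl ws)). set (I u v))"
  by (induction f I ws rule: expand.induct) auto

lemma consec_expand:
  "consec (expand f I ws @ [f (last ws)]) x y \<longleftrightarrow> (\<exists>(u, v)\<in>set (zip ws (tl ws)). consec (spath f I u v) x y)"
proof (induction f I ws rule: expand.induct)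
  case (1 f I u v r)
  obtain q where q: "expand f I (v # r) @ [f (last (v # r))] = f v # q" by (cases r) auto
  have "consec (f u # I u v @ f v # q) x y \<longleftrightarrow> consec (spath f I u v) x y \<or> consec (f v # q) x y"
    unfolding spath_def by (rule consec_glue)
  then show ?case using 1 unfolding q[symmetric] by simp
qed auto

lemma successively_glue:
  "successively R (a # p @ [b]) \<Longrightarrow> successively R (b # q) \<Longrightarrow> successively R (a # p @ b # q)"
  by (cases "p = []") (auto simp: successively_Cons successively_append_iff)

lemma successively_expand:
  assumes "\<And>u v. (u, v) \<in> set (zip ws (tl ws)) \<Longrightarrow> successively R (spath f I u v)"
  shows "successively R (expand f I ws @ [f (last ws)])"
  using assms
proof (induction f I ws rule: expand.induct)
  case (1 f I u v r)
  obtain q where q: "expand f I (v # r) @ [f (last (v # r))] = f v # q" by (cases r) auto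
  have "successively R (f u # I u v @ [f v])"
    using 1(2)[of u v] by (simp add: spath_def)
  moreover have "successively R (expand f I (v # r) @ [f (last (v # r))])"
    using 1 by auto
  ultimately have "successively R (f u # I u v @ (expand f I (v # r) @ [f (last (v # r))]))"
    unfolding q by (rule successively_glue)
  then show ?case by simp
qed auto

text \<open>Only \<open>butlast ws\<close> has to be distinct, since \<open>ws\<close> may be
  closed. The unordered pairs are a separate condition: an edge passed twice would repeat its
  interior.\<close>

lemma distinct_expand:
  assumes "distinct (map (\<lambda>(u, v). {u, v}) (zip ws (tl ws)))" "distinct (butlast ws)"
    "inj_on f (set ws)"
    "\<And>u v. (u, v) \<in> set (zip ws (tl ws)) \<Longrightarrow> distinct (I u v) \<and> set (I u v) \<inter> f ` set ws = {}"
    "\<And>u v u' v'. (u, v) \<in> set (zip ws (tl ws)) \<Longrightarrow> (u', v') \<in> set (zip ws (tl ws))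
        \<Longrightarrow> {u, v} \<noteq> {u', v'} \<Longrightarrow> set (I u v) \<inter> set (I u' v') = {}"
  shows "distinct (expand f I ws)"
  using assms
proof (induction f I ws rule: expand.induct)
  case (1 f I u v r)
  have "distinct (expand f I (v # r))"
  proof (rule 1(1))
    show "distinct (map (\<lambda>(u, v). {u, v}) (zip (v # r) (tl (v # r))))" using 1(2) by simp
    show "distinct (butlast (v # r))" using 1(3) by simp
    show "inj_on f (set (v # r))" using 1(4) by (simp add: inj_on_def)
    show "distinct (I a b) \<and> set (I a b) \<inter> f ` set (v # r) = {}"
      if "(a, b) \<in> set (zip (v # r) (tl (v # r)))" for a b using 1(5)[of a b] that by auto
    show "set (I a b) \<inter> set (I a' b') = {}"
      if "(a, b) \<in> set (zip (v # r) (tl (v # r)))" "(a', b') \<in> set (zip (v # r) (tl (v # r)))"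
         "{a, b} \<noteq> {a', b'}" for a b a' b' using 1(6)[of a b a' b'] that by auto
  qed
  moreover have "distinct (I u v)" "f u \<notin> set (I u v)" using 1(5)[of u v] by auto
  moreover have "f u \<notin> set (expand f I (v # r))"
  proof -
    have "f u \<notin> f ` set (butlast (v # r))"
    proof -
      have "u \<notin> set (butlast (v # r))" using 1(3) by simp
      moreover have "set (butlast (v # r)) \<subseteq> set (u # v # r)" by (meson in_set_butlastD list.set_intros(2) subsetI)
      ultimately show ?thesis using inj_on_image_mem_iff[OF 1(4)] by auto
    qed
    moreover have "f u \<notin> set (I a b)" if "(a, b) \<in> set (zip (v # r) (tl (v # r)))" for a b
      using 1(5)[of a b] that by auto
    ultimately show ?thesis unfolding set_expand by auto
  qed
  moreover have "set (I u v) \<inter> set (expand f I (v # r)) = {}"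
  proof -
    have "set (I u v) \<inter> f ` set (butlast (v # r)) = {}"
    proof -
      have "set (butlast (v # r)) \<subseteq> set (u # v # r)" by (meson in_set_butlastD list.set_intros(2) subsetI)
      moreover have "set (I u v) \<inter> f ` set (u # v # r) = {}" using 1(5)[of u v] by simp
      ultimately show ?thesis by (meson disjoint_iff image_mono subsetD)
    qed
    moreover have "set (I u v) \<inter> set (I a b) = {}" if ab: "(a, b) \<in> set (zip (v # r) (tl (v # r)))" for a b
    proof -
      have "{u, v} \<noteq> {a, b}" using 1(2) ab by force
      then show ?thesis using 1(6)[of u v a b] ab by auto
    qed
    ultimately show ?thesis unfolding set_expand by blast
  qed
  ultimately show ?case by auto
qed auto

context graph
begin

text \<open>The skeleton vertex i is placed at f i, and I u v lists the inner vertices of the path for the edge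
  uv from u to v. The subgraph induced by the image consists of exactly these paths.\<close>

definition emb :: "nat \<Rightarrow> lab_edges \<Rightarrow> (nat \<Rightarrow> 'a) \<Rightarrow> (nat \<Rightarrow> nat \<Rightarrow> 'a list) \<Rightarrow> bool" where
  "emb n E f I \<longleftrightarrow> inj_on f {..<n} \<and> img n E f I \<subseteq> V
    \<and> (\<forall>u v. edge E u v \<longrightarrow> u < n \<and> v < n \<and> u \<noteq> v \<and> I v u = rev (I u v)
         \<and> distinct (I u v) \<and> set (I u v) \<inter> f ` {..<n} = {})
    \<and> (\<forall>u v u' v'. edge E u v \<and> edge E u' v' \<and> {u, v} \<noteq> {u', v'} \<longrightarrow> set (I u v) \<inter> set (I u' v') = {})
    \<and> (\<forall>u v. (u, v, Unit) \<in> set E \<longrightarrow> I u v = [])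
    \<and> (\<forall>u v. (u, v, Long) \<in> set E \<longrightarrow> I u v \<noteq> [])
    \<and> (\<forall>x\<in>img n E f I. \<forall>y\<in>img n E f I. adj x y \<longleftrightarrow> (\<exists>u v. edge E u v \<and> consec (spath f I u v) x y))"

lemma
  assumes "emb n E f I"
  shows emb_inj: "inj_on f {..<n}" and emb_V: "img n E f I \<subseteq> V"
    and emb_edge: "edge E u v \<Longrightarrow> u < n \<and> v < n \<and> u \<noteq> v \<and> I v u = rev (I u v)
         \<and> distinct (I u v) \<and> set (I u v) \<inter> f ` {..<n} = {}"
    and emb_disj: "edge E u v \<Longrightarrow> edge E u' v' \<Longrightarrow> {u, v} \<noteq> {u', v'} \<Longrightarrow> set (I u v) \<inter> set (I u' v') = {}"
    and emb_Unit: "(u, v, Unit) \<in> set E \<Longrightarrow> I u v = []"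
    and emb_Long: "(u, v, Long) \<in> set E \<Longrightarrow> I u v \<noteq> []"
    and emb_adj: "x \<in> img n E f I \<Longrightarrow> y \<in> img n E f I \<Longrightarrow>
        adj x y \<longleftrightarrow> (\<exists>u v. edge E u v \<and> consec (spath f I u v) x y)"
  using assms unfolding emb_def by blast+

lemma set_spath: "set (spath f I u v) = {f u, f v} \<union> set (I u v)"
  by (auto simp: spath_def)

lemma spath_img: "emb n E f I \<Longrightarrow> edge E u v \<Longrightarrow> set (spath f I u v) \<subseteq> img n E f I"
  using emb_edge by (auto simp: set_spath img_def)

lemma spath_rev: "emb n E f I \<Longrightarrow> edge E u v \<Longrightarrow> spath f I v u = rev (spath f I u v)"
  using emb_edge[of n E f I u v] by (auto simp: spath_def)

lemma emb_path:
  assumes "emb n E f I" "edge E u v"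
  shows "successively adj (spath f I u v)" "distinct (spath f I u v)"
proof -
  show "successively adj (spath f I u v)"
    unfolding successively_conv_nth
  proof (intro allI impI)
    fix i assume i: "Suc i < length (spath f I u v)"
    have "consec (spath f I u v) (spath f I u v ! i) (spath f I u v ! Suc i)"
      unfolding consec_def using i by blast
    moreover have "spath f I u v ! i \<in> img n E f I" "spath f I u v ! Suc i \<in> img n E f I"
      using spath_img[OF assms] i by (meson Suc_lessD nth_mem subsetD)+
    ultimately show "adj (spath f I u v ! i) (spath f I u v ! Suc i)"
      using emb_adj[OF assms(1)] assms(2) by blast
  qed
  show "distinct (spath f I u v)"
    using emb_edge[OF assms] emb_inj[OF assms(1)] by (auto simp: spath_def inj_on_def)
qed

text \<open>The interior avoids all images of skeleton vertices. So an edge of the graph between two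
  such images comes from a skeleton edge without inner vertices.\<close>

lemma consec_spath_ends:
  assumes "emb n E f I" "edge E u v" "a < n" "b < n" "consec (spath f I u v) (f a) (f b)"
  shows "I u v = [] \<and> {a, b} = {u, v}"
proof -
  note e = emb_edge[OF assms(1,2)]
  have "f a \<notin> set (I u v)" "f b \<notin> set (I u v)" using e assms by auto
  then have *: "I u v = [] \<and> {f a, f b} = {f u, f v}"
  proof (cases "I u v")
    case Nil
    then show ?thesis using assms(5) by (simp add: spath_def consec_Cons)
  next
    case (Cons z q)
    have no: "\<not> consec (I u v) (f a) (f b)"
      using \<open>f a \<notin> set (I u v)\<close> consec_in_set by metis
    have "hd (I u v) \<in> set (I u v)" "last (I u v) \<in> set (I u v)" using Cons by (auto simp: last_in_set)
    moreover have "{f a, f b} = {f u, hd (I u v)} \<or> {f a, f b} = {last (I u v), f v}"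
      using assms(5) no unfolding spath_def consec_Cons[of "f u"] consec_append by (simp add: Cons)
    ultimately show ?thesis
      using \<open>f a \<notin> set (I u v)\<close> \<open>f b \<notin> set (I u v)\<close> by (metis doubleton_eq_iff)
  qed
  then show ?thesis
    using e emb_inj[OF assms(1)] assms(3,4) by (auto simp: doubleton_eq_iff inj_on_def)
qed

definition real_cycle :: "(nat \<Rightarrow> 'a) \<Rightarrow> (nat \<Rightarrow> nat \<Rightarrow> 'a list) \<Rightarrow> nat list \<Rightarrow> 'a list" where
  "real_cycle f I c = expand f I (c @ [hd c])"

text \<open>For the chords: an edge of the graph off the real cycle lies on the path of a skeleton
  edge off \<open>c\<close>. The interior of that path is disjoint from the cycle, so both ends of
  the chord are ends of the path, the path has no inner vertex, and its label is not
  \<open>Long\<close>.\<close>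

lemma
  assumes emb: "emb n E f I" and chk: "check_cyc E c"
  shows real_cycle_is_cycle: "is_cycle V adj (real_cycle f I c)"
    and set_real_cycle: "set (real_cycle f I c) = f ` set c \<union> (\<Union>(u, v)\<in>set (cpairs c). set (I u v))"
    and consec_real_cycle: "consec (real_cycle f I c @ [hd (real_cycle f I c)]) x y \<longleftrightarrow>
        (\<exists>(u, v)\<in>set (cpairs c). consec (spath f I u v) x y)"
    and real_cycle_chord: "x \<in> set (real_cycle f I c) \<Longrightarrow> y \<in> set (real_cycle f I c) \<Longrightarrow> adj x y \<Longrightarrow>
        \<not> consec (real_cycle f I c @ [hd (real_cycle f I c)]) x y \<Longrightarrow>
        \<exists>(u, v, l)\<in>set (free_edges E c). {x, y} = {f u, f v}"
proof -
  have c: "distinct c" "3 \<le> length c" "\<And>u v. (u, v) \<in> set (cpairs c) \<Longrightarrow> edge E u v"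
    using chk by (auto simp: check_cyc_def)
  have ne: "c \<noteq> []" using c by auto
  obtain u0 v0 r where c0: "c = u0 # v0 # r" using c(2) by (cases c; cases "tl c") auto
  define ws where "ws = c @ [hd c]"
  have zw: "zip ws (tl ws) = cpairs c" unfolding ws_def using cpairs_eq[OF ne] by simp
  have bl: "butlast ws = c" "last ws = hd c" "set ws = set c" unfolding ws_def using ne by auto
  have rc: "real_cycle f I c = expand f I ws" by (simp add: real_cycle_def ws_def)
  have hdrc: "hd (real_cycle f I c) = f (last ws)" unfolding real_cycle_def bl by (simp add: c0)
  show st: "set (real_cycle f I c) = f ` set c \<union> (\<Union>(u, v)\<in>set (cpairs c). set (I u v))"
    unfolding rc set_expand bl zw ..
  show con: "consec (real_cycle f I c @ [hd (real_cycle f I c)]) x y \<longleftrightarrow>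
        (\<exists>(u, v)\<in>set (cpairs c). consec (spath f I u v) x y)" for x y
    unfolding hdrc unfolding rc consec_expand zw ..
  have cn: "u < n" if "u \<in> set c" for u
  proof -
    obtain i where i: "i < length c" "c ! i = u" using \<open>u \<in> set c\<close> by (meson in_set_conv_nth)
    then have "(u, (tl c @ [hd c]) ! i) \<in> set (cpairs c)"
      using ne unfolding cpairs_def in_set_zip by (intro exI[of _ i]) auto
    then show ?thesis using c(3) emb_edge[OF emb] by blast
  qed
  have "distinct (real_cycle f I c)"
    unfolding rc
  proof (rule distinct_expand, unfold zw bl)
    show "distinct (map (\<lambda>(u, v). {u, v}) (cpairs c))" using distinct_cpairs c by blast
    show "inj_on f (set c)" using emb_inj[OF emb] cn by (auto simp: inj_on_def)
    show "distinct (I u v) \<and> set (I u v) \<inter> f ` set c = {}" if "(u, v) \<in> set (cpairs c)" for u v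
      using emb_edge[OF emb c(3)[OF that]] cn by auto
    show "set (I u v) \<inter> set (I u' v') = {}"
      if "(u, v) \<in> set (cpairs c)" "(u', v') \<in> set (cpairs c)" "{u, v} \<noteq> {u', v'}" for u v u' v'
      using emb_disj[OF emb c(3) c(3)] that by blast
  qed (fact c(1))
  moreover have "3 \<le> length (real_cycle f I c)"
  proof -
    have "length ws \<le> Suc (length (expand f I ws))" for ws
      by (induction f I ws rule: expand.induct) auto
    from this[of ws] show ?thesis using c(2) by (simp add: ws_def real_cycle_def)
  qed
  moreover have sub: "set (real_cycle f I c) \<subseteq> img n E f I"
    unfolding st using cn c(3) by (auto simp: img_def)
  moreover have "successively adj (real_cycle f I c @ [hd (real_cycle f I c)])"
    unfolding hdrc unfolding rc by (rule successively_expand) (use emb_path[OF emb] c(3) zw in auto)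
  ultimately show "is_cycle V adj (real_cycle f I c)"
    unfolding is_cycle_eq using emb_V[OF emb] by blast
  assume xy: "x \<in> set (real_cycle f I c)" "y \<in> set (real_cycle f I c)" "adj x y"
    "\<not> consec (real_cycle f I c @ [hd (real_cycle f I c)]) x y"
  obtain u v where uv: "edge E u v" "consec (spath f I u v) x y"
    using emb_adj[OF emb, of x y] sub xy by blast
  note euv = emb_edge[OF emb uv(1)]
  have notp: "(u, v) \<notin> set (cpairs c)" "(v, u) \<notin> set (cpairs c)"
    using xy(4) uv spath_rev[OF emb uv(1)] unfolding con by fastforce+
  have notI: "z \<notin> set (I u v)" if z: "z \<in> set (real_cycle f I c)" for z
  proof
    assume zI: "z \<in> set (I u v)"
    have "z \<notin> f ` set c" using euv zI cn by auto
    then obtain a b where ab: "(a, b) \<in> set (cpairs c)" "z \<in> set (I a b)" using z st by auto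
    then have "{a, b} \<noteq> {u, v}" using notp by (auto simp: doubleton_eq_iff)
    then show False using emb_disj[OF emb c(3)[OF ab(1)] uv(1)] ab zI by blast
  qed
  have inc: "w \<in> set c" if "f w \<in> set (real_cycle f I c)" "w < n" for w
  proof -
    have "f w \<notin> set (I a b)" if "(a, b) \<in> set (cpairs c)" for a b
      using emb_edge[OF emb c(3)[OF that]] \<open>w < n\<close> by auto
    then have "f w \<in> f ` set c" using that st by auto
    then show ?thesis using emb_inj[OF emb] cn \<open>w < n\<close> by (auto simp: inj_on_def)
  qed
  have "x \<in> {f u, f v}" "y \<in> {f u, f v}"
    using consec_in_set[OF uv(2)] notI xy by (auto simp: set_spath)
  then have xyuv: "{x, y} = {f u, f v}" using xy(3) by auto
  then have uvc: "u \<in> set c" "v \<in> set c" using inc xy euv by (auto simp: doubleton_eq_iff)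
  have "I u v = []" using consec_spath_ends[OF emb uv(1), of u v] xyuv uv(2) euv
    by (metis consec_commute doubleton_eq_iff)
  then have "I v u = []" using euv by simp
  obtain a b l where abl: "(a, b, l) \<in> set E" "a = u \<and> b = v \<or> a = v \<and> b = u"
    using uv(1) unfolding edge_iff by blast
  have "l \<noteq> Long" using emb_Long[OF emb] abl \<open>I u v = []\<close> \<open>I v u = []\<close> by metis
  then have "(a, b, l) \<in> set (free_edges E c)"
    using abl uvc notp unfolding free_edges_def by auto
  moreover have "{x, y} = {f a, f b}" using xyuv abl by auto
  ultimately show "\<exists>(u, v, l)\<in>set (free_edges E c). {x, y} = {f u, f v}" by blast
qed

end

section \<open>Operations on skeletons and the corresponding changes of an embedding\<close>

definition drop_edge :: "nat \<Rightarrow> nat \<Rightarrow> lab_edges \<Rightarrow> lab_edges" where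
  "drop_edge u v E = filter (\<lambda>(a, b, l). \<not> (a = u \<and> b = v \<or> a = v \<and> b = u)) E"

text \<open>Both halves get \<open>Any\<close>, because the new vertex may or may not be next to an
  end of the path.\<close>

definition split_edge :: "nat \<Rightarrow> nat \<Rightarrow> nat \<Rightarrow> lab_edges \<Rightarrow> lab_edges" where
  "split_edge n u v E = (u, n, Any) # (n, v, Any) # drop_edge u v E"

definition set_lab :: "nat \<Rightarrow> nat \<Rightarrow> lab \<Rightarrow> lab_edges \<Rightarrow> lab_edges" where
  "set_lab u v l E = map (\<lambda>(a, b, k). (a, b, if a = u \<and> b = v then l else k)) E"

definition star_edges :: "nat \<Rightarrow> nat list \<Rightarrow> lab_edges \<Rightarrow> lab_edges" where
  "star_edges n ps E = map (\<lambda>p. (p, n, Unit)) ps @ E"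

text \<open>The list \<open>g\<close> sends vertices of the target \<open>K\<close> to vertices of
  the skeleton at hand. Each target edge must occur with its exact label, so an \<open>Any\<close>
  has to be resolved by branching first; the converse only excludes additional edges.\<close>

definition check_iso ::
  "nat \<Rightarrow> lab_edges \<Rightarrow> nat list \<Rightarrow> nat \<times> lab_edges \<Rightarrow> bool" where
  "check_iso n E g K \<longleftrightarrow> fst K = n \<and> length g = n \<and> distinct g \<and> (\<forall>x\<in>set g. x < n)
     \<and> (\<forall>(a, b, l)\<in>set (snd K). a < n \<and> b < n
          \<and> (\<exists>(x, y, k)\<in>set E. k = l \<and> (x = g ! a \<and> y = g ! b \<or> x = g ! b \<and> y = g ! a)))
     \<and> (\<forall>(x, y, k)\<in>set E. \<exists>(a, b, l)\<in>set (snd K). x = g ! a \<and> y = g ! b \<or> x = g ! b \<and> y = g ! a)"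

lemma drop_edge_iff: "(a, b, l) \<in> set (drop_edge u v E) \<longleftrightarrow> (a, b, l) \<in> set E \<and> {a, b} \<noteq> {u, v}"
  by (auto simp: drop_edge_def doubleton_eq_iff)

lemma edge_drop_edge: "edge (drop_edge u v E) a b \<longleftrightarrow> edge E a b \<and> {a, b} \<noteq> {u, v}"
  unfolding edge_iff drop_edge_iff by (auto simp: insert_commute)

lemma edge_set_lab: "edge (set_lab u v l E) a b \<longleftrightarrow> edge E a b"
proof -
  have "(\<exists>k. (a, b, k) \<in> set (set_lab u v l E)) \<longleftrightarrow> (\<exists>k. (a, b, k) \<in> set E)" for a b
    unfolding set_lab_def by force
  then show ?thesis unfolding edge_iff by blast
qed

lemma bex_triple: "(\<exists>(a, b, l)\<in>S. P a b l) \<longleftrightarrow> (\<exists>a b l. (a, b, l) \<in> S \<and> P a b l)"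
  by auto

context graph
begin

lemma img_list:
  assumes "\<And>u v l. (u, v, l) \<in> set E \<Longrightarrow> I v u = rev (I u v)"
  shows "img n E f I = f ` {..<n} \<union> (\<Union>(u, v, l)\<in>set E. set (I u v))"
proof -
  have "(\<exists>u v. edge E u v \<and> x \<in> set (I u v)) \<longleftrightarrow> (\<exists>(u, v, l)\<in>set E. x \<in> set (I u v))" for x
    unfolding edge_iff using assms by fastforce
  then show ?thesis unfolding img_def by blast
qed

text \<open>The definition of \<open>emb\<close> speaks about both orientations of an edge. Since
  \<open>I v u\<close> reverses \<open>I u v\<close>, it suffices to check the orientation that is
  listed.\<close>

lemma embI:
  assumes inj: "inj_on f {..<n}" and V: "img n E f I \<subseteq> V"
    and e: "\<And>u v l. (u, v, l) \<in> set E \<Longrightarrow> u < n \<and> v < n \<and> u \<noteq> v \<and> I v u = rev (I u v)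
         \<and> distinct (I u v) \<and> set (I u v) \<inter> f ` {..<n} = {}
         \<and> (l = Unit \<longrightarrow> I u v = []) \<and> (l = Long \<longrightarrow> I u v \<noteq> [])"
    and d: "\<And>u v l u' v' l'. (u, v, l) \<in> set E \<Longrightarrow> (u', v', l') \<in> set E \<Longrightarrow>
         {u, v} \<noteq> {u', v'} \<Longrightarrow> set (I u v) \<inter> set (I u' v') = {}"
    and a: "\<And>x y. x \<in> img n E f I \<Longrightarrow> y \<in> img n E f I \<Longrightarrow>
         adj x y \<longleftrightarrow> (\<exists>(u, v, l)\<in>set E. consec (spath f I u v) x y)"
  shows "emb n E f I"
proof -
  have sw: "I u v = rev (I v u)" if "(u, v, l) \<in> set E" for u v l
    using e[OF that] by simp
  have e': "u < n \<and> v < n \<and> u \<noteq> v \<and> I v u = rev (I u v)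
         \<and> distinct (I u v) \<and> set (I u v) \<inter> f ` {..<n} = {}" if "edge E u v" for u v
    using that[unfolded edge_iff]
  proof (elim exE disjE)
    fix l assume l: "(v, u, l) \<in> set E"
    have "set (I u v) = set (I v u)" using sw[OF l] by simp
    then show ?thesis using e[OF l] by simp
  qed (use e in blast)
  have d': "set (I u v) \<inter> set (I u' v') = {}" if uv: "edge E u v" "edge E u' v'" "{u, v} \<noteq> {u', v'}" for u v u' v'
  proof -
    obtain a b l where 1: "(a, b, l) \<in> set E" "{a, b} = {u, v}" "set (I a b) = set (I u v)"
      using uv(1) e'[OF uv(1)] unfolding edge_iff by (metis insert_commute set_rev)
    obtain a' b' l' where 2: "(a', b', l') \<in> set E" "{a', b'} = {u', v'}" "set (I a' b') = set (I u' v')"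
      using uv(2) e'[OF uv(2)] unfolding edge_iff by (metis insert_commute set_rev)
    show ?thesis using d[OF 1(1) 2(1)] 1 2 uv(3) by simp
  qed
  have "(\<exists>u v. edge E u v \<and> consec (spath f I u v) x y) \<longleftrightarrow> (\<exists>(u, v, l)\<in>set E. consec (spath f I u v) x y)" for x y
  proof -
    have "consec (spath f I v u) x y \<longleftrightarrow> consec (spath f I u v) x y" if "(u, v, l) \<in> set E" for u v l
    proof -
      have "spath f I v u = rev (spath f I u v)" using e[OF that] by (simp add: spath_def)
      then show ?thesis by simp
    qed
    then show ?thesis unfolding edge_iff by fastforce
  qed
  then show ?thesis
    unfolding emb_def using inj V e e' d' a by auto
qed

lemma emb_rev: "emb n E f I \<Longrightarrow> (u, v, l) \<in> set E \<Longrightarrow> I v u = rev (I u v)"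
  using emb_edge edgeI by blast

lemma img_emb: "emb n E f I \<Longrightarrow> img n E f I = f ` {..<n} \<union> (\<Union>(u, v, l)\<in>set E. set (I u v))"
  using img_list emb_rev by metis

lemma emb_adj_list:
  assumes "emb n E f I" "x \<in> img n E f I" "y \<in> img n E f I"
  shows "adj x y \<longleftrightarrow> (\<exists>(u, v, l)\<in>set E. consec (spath f I u v) x y)"
  unfolding emb_adj[OF assms] edge_iff using spath_rev[OF assms(1)] edgeI consec_rev by fastforce

lemma emb_relabel:
  assumes emb: "emb n E f I" and eq: "\<And>u v. edge E' u v \<longleftrightarrow> edge E u v"
    and lab: "\<And>u v. (u, v, Unit) \<in> set E' \<Longrightarrow> I u v = []" "\<And>u v. (u, v, Long) \<in> set E' \<Longrightarrow> I u v \<noteq> []"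
  shows "emb n E' f I"
proof -
  have img: "img n E' f I = img n E f I" unfolding img_def eq ..
  show ?thesis using emb lab unfolding emb_def img eq by simp
qed

lemma emb_set_lab:
  assumes emb: "emb n E f I" and l: "l = Unit \<and> I u v = [] \<or> l = Long \<and> I u v \<noteq> []"
  shows "emb n (set_lab u v l E) f I"
proof (rule emb_relabel[OF emb])
  show "edge (set_lab u v l E) a b \<longleftrightarrow> edge E a b" for a b by (rule edge_set_lab)
  show "(a, b, Unit) \<in> set (set_lab u v l E) \<Longrightarrow> I a b = []" for a b
    using emb_Unit[OF emb] l by (auto simp: set_lab_def split: if_splits)
  show "(a, b, Long) \<in> set (set_lab u v l E) \<Longrightarrow> I a b \<noteq> []" for a b
    using emb_Long[OF emb] l by (auto simp: set_lab_def split: if_splits)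
qed

text \<open>With an empty interior the ends would stay in the image and remain adjacent, so dropping
  the edge would destroy inducedness.\<close>

lemma emb_drop:
  assumes emb: "emb n E f I" and e: "edge E u v" and ne: "I u v \<noteq> []"
  shows "emb n (drop_edge u v E) f I"
    and "img n (drop_edge u v E) f I = img n E f I - set (I u v)"
proof -
  have uv: "set (I v u) = set (I u v)" "I v u \<noteq> []" using emb_edge[OF emb e] ne by auto
  show img: "img n (drop_edge u v E) f I = img n E f I - set (I u v)"
  proof -
    have dj: "set (I a b) \<inter> set (I u v) = {}" if "edge E a b" "{a, b} \<noteq> {u, v}" for a b
      using emb_disj[OF emb that(1) e that(2)] .
    have same: "set (I a b) = set (I u v)" if "{a, b} = {u, v}" for a b
      using that uv by (auto simp: doubleton_eq_iff)
    have "f ` {..<n} \<inter> set (I u v) = {}" using emb_edge[OF emb e] by auto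
    have "{x. \<exists>a b. (edge E a b \<and> {a, b} \<noteq> {u, v}) \<and> x \<in> set (I a b)}
        = {x. \<exists>a b. edge E a b \<and> x \<in> set (I a b)} - set (I u v)"
      (is "?A = ?B - _")
    proof (intro set_eqI iffI)
      fix x assume "x \<in> ?B - set (I u v)"
      then obtain a b where ab: "edge E a b" "x \<in> set (I a b)" "x \<notin> set (I u v)" by blast
      then have "{a, b} \<noteq> {u, v}" using same by blast
      then show "x \<in> ?A" using ab by blast
    next
      fix x assume "x \<in> ?A"
      then show "x \<in> ?B - set (I u v)" using dj by blast
    qed
    then show ?thesis
      using \<open>f ` {..<n} \<inter> set (I u v) = {}\<close> unfolding img_def edge_drop_edge by (simp only: Un_Diff Diff_triv)
  qed
  have nin: "\<not> consec (spath f I a b) x y"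
    if "{a, b} = {u, v}" "x \<notin> set (I u v)" "y \<notin> set (I u v)" for a b x y
    using that uv ne consec_inner[of "f a" "I a b" "f b" x y]
    by (auto simp: spath_def doubleton_eq_iff)
  show "emb n (drop_edge u v E) f I"
    unfolding emb_def
  proof (intro conjI allI impI ballI)
    show "img n (drop_edge u v E) f I \<subseteq> V" using emb_V[OF emb] img by auto
  next
    fix x y assume xy: "x \<in> img n (drop_edge u v E) f I" "y \<in> img n (drop_edge u v E) f I"
    show "adj x y \<longleftrightarrow> (\<exists>a b. edge (drop_edge u v E) a b \<and> consec (spath f I a b) x y)"
    proof -
      have "x \<in> img n E f I" "y \<in> img n E f I" "x \<notin> set (I u v)" "y \<notin> set (I u v)"
        using xy unfolding img by auto
      then show ?thesis
        using emb_adj[OF emb, of x y] nin[of _ _ x y] unfolding edge_drop_edge by metis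
    qed
  qed (use emb_inj[OF emb] emb_edge[OF emb] emb_disj[OF emb] emb_Unit[OF emb] emb_Long[OF emb]
        in \<open>auto simp: edge_drop_edge drop_edge_iff\<close>)
qed

definition upd :: "(nat \<Rightarrow> nat \<Rightarrow> 'b list) \<Rightarrow> nat \<Rightarrow> nat \<Rightarrow> 'b list \<Rightarrow> nat \<Rightarrow> nat \<Rightarrow> 'b list" where
  "upd I u v J a b = (if a = u \<and> b = v then J else if a = v \<and> b = u then rev J else I a b)"

lemma upd_other: "{a, b} \<noteq> {u, v} \<Longrightarrow> upd I u v J a b = I a b"
proof -
  assume ne: "{a, b} \<noteq> {u, v}"
  have "\<not> (a = u \<and> b = v)" "\<not> (a = v \<and> b = u)" using ne doubleton_eq_iff by metis+
  then show ?thesis unfolding upd_def by (simp only: if_False)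
qed

lemma upd_same: "upd I u v J u v = J" by (simp add: upd_def)

text \<open>This attaches an ear. All adjacencies that involve \<open>J\<close> are those along the
  new path, so the enlarged subgraph is again induced.\<close>

lemma emb_place:
  assumes emb: "emb n E f I" and uv: "u < n" "v < n" "u \<noteq> v" "\<not> edge E u v"
    and J: "J \<noteq> []" "distinct J" "set J \<subseteq> V" "set J \<inter> img n E f I = {}"
    and adj: "\<And>x y. x \<in> set J \<Longrightarrow> y \<in> img n E f I \<union> set J \<Longrightarrow> adj x y \<longleftrightarrow> consec (f u # J @ [f v]) x y"
  shows "emb n ((u, v, Long) # E) f (upd I u v J)" (is "emb n ?E f ?I")
    and "img n ((u, v, Long) # E) f (upd I u v J) = img n E f I \<union> set J"
proof -
  have no: "{a, b} \<noteq> {u, v}" if "(a, b, l) \<in> set E" for a b l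
    using uv(4) edgeI[OF that] edge_commute by (auto simp: doubleton_eq_iff)
  have old: "?I a b = I a b" "?I b a = I b a" if "(a, b, l) \<in> set E" for a b l
    using no[OF that] by (simp_all add: upd_other insert_commute)
  have vu: "?I v u = rev J" using uv by (simp add: upd_def)
  have revs: "?I b a = rev (?I a b)" if "(a, b, l) \<in> set ?E" for a b l
  proof (cases "(a, b, l) \<in> set E")
    case True
    then show ?thesis using old[OF True] emb_rev[OF emb True] by simp
  next
    case False
    then have "a = u" "b = v" using that by auto
    then show ?thesis using vu upd_same by metis
  qed
  have imgE: "img n E f I = f ` {..<n} \<union> (\<Union>(u, v, l)\<in>set E. set (I u v))"
    by (rule img_emb[OF emb])
  show img: "img n ?E f ?I = img n E f I \<union> set J"
  proof -
    have "(\<Union>(a, b, l)\<in>set E. set (?I a b)) = (\<Union>(a, b, l)\<in>set E. set (I a b))"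
      by (rule SUP_cong) (use old in auto)
    then show ?thesis
      unfolding imgE by (subst img_list) (use revs in \<open>auto simp: upd_same\<close>)
  qed
  have fuv: "f u \<in> img n E f I" "f v \<in> img n E f I" using uv by (auto simp: img_def)
  show "emb n ?E f ?I"
  proof (rule embI)
    show "inj_on f {..<n}" by (rule emb_inj[OF emb])
    show "img n ?E f ?I \<subseteq> V" unfolding img using J emb_V[OF emb] by auto
  next
    fix a b l assume ab: "(a, b, l) \<in> set ?E"
    show "a < n \<and> b < n \<and> a \<noteq> b \<and> ?I b a = rev (?I a b)
         \<and> distinct (?I a b) \<and> set (?I a b) \<inter> f ` {..<n} = {}
         \<and> (l = Unit \<longrightarrow> ?I a b = []) \<and> (l = Long \<longrightarrow> ?I a b \<noteq> [])"
    proof (cases "(a, b, l) \<in> set E")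
      case True
      then show ?thesis
        using old[OF True] emb_edge[OF emb edgeI[OF True]] emb_Unit[OF emb] emb_Long[OF emb] by auto
    next
      case False
      then have "a = u" "b = v" "l = Long" using ab by auto
      then show ?thesis using uv J vu by (auto simp: upd_same img_def)
    qed
  next
    fix a b l a' b' l' assume 1: "(a, b, l) \<in> set ?E" "(a', b', l') \<in> set ?E" "{a, b} \<noteq> {a', b'}"
    have dj: "set (I x y) \<inter> set J = {}" if "(x, y, k) \<in> set E" for x y k
      using J(4) that unfolding imgE by auto
    show "set (?I a b) \<inter> set (?I a' b') = {}"
    proof (cases "(a, b, l) \<in> set E"; cases "(a', b', l') \<in> set E")
      assume 2: "(a, b, l) \<in> set E" "(a', b', l') \<in> set E"
      show ?thesis using old[OF 2(1)] old[OF 2(2)] emb_disj[OF emb edgeI edgeI, OF 2 1(3)] by simp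
    next
      assume 2: "(a, b, l) \<in> set E" "(a', b', l') \<notin> set E"
      then show ?thesis using old[OF 2(1)] dj[OF 2(1)] 1(2) by (auto simp: upd_same)
    next
      assume 2: "(a, b, l) \<notin> set E" "(a', b', l') \<in> set E"
      then show ?thesis using old[OF 2(2)] dj[OF 2(2)] 1(1) by (auto simp: upd_same)
    next
      assume "(a, b, l) \<notin> set E" "(a', b', l') \<notin> set E"
      then show ?thesis using 1 by auto
    qed
  next
    fix x y assume xy: "x \<in> img n ?E f ?I" "y \<in> img n ?E f ?I"
    have sp: "spath f ?I a b = spath f I a b" if "(a, b, l) \<in> set E" for a b l
      using old[OF that] by (simp add: spath_def)
    have spJ: "spath f ?I u v = f u # J @ [f v]" by (simp add: spath_def upd_same)
    have rhs: "(\<exists>(a, b, l)\<in>set ?E. consec (spath f ?I a b) x y) \<longleftrightarrow>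
        consec (f u # J @ [f v]) x y \<or> (\<exists>(a, b, l)\<in>set E. consec (spath f I a b) x y)"
      using sp spJ by fastforce
    have oldimg: "x \<in> img n E f I \<and> y \<in> img n E f I"
      if "(a, b, l) \<in> set E" "consec (spath f I a b) x y" for a b l
      using consec_in_set[OF that(2)] spath_img[OF emb edgeI[OF that(1)]] by auto
    show "adj x y \<longleftrightarrow> (\<exists>(a, b, l)\<in>set ?E. consec (spath f ?I a b) x y)"
    proof (cases "x \<in> set J \<or> y \<in> set J")
      case True
      then have "adj x y \<longleftrightarrow> consec (f u # J @ [f v]) x y"
        using adj[of x y] adj[of y x] xy unfolding img
        by (metis Un_iff adj_commute consec_commute)
      moreover have "\<not> (\<exists>(a, b, l)\<in>set E. consec (spath f I a b) x y)"
        using oldimg True J(4) by blast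
      ultimately show ?thesis unfolding rhs by simp
    next
      case False
      then have "x \<in> img n E f I" "y \<in> img n E f I" using xy unfolding img by auto
      then show ?thesis
        unfolding rhs using emb_adj_list[OF emb, of x y] consec_inner[OF _ J(1), of "f u" "f v" x y] False by blast
    qed
  qed
qed

text \<open>The neighbours of \<open>w\<close> in the image have to be skeleton vertices already;
  those inside a path are promoted by \<open>emb_split\<close> beforehand.\<close>

lemma emb_star:
  assumes emb: "emb n E f I" and w: "w \<in> V" "w \<notin> img n E f I" and ps: "\<And>p. p \<in> set ps \<Longrightarrow> p < n"
    and adj: "\<And>x. x \<in> img n E f I \<Longrightarrow> adj w x \<longleftrightarrow> x \<in> f ` set ps"
  shows "emb (Suc n) (star_edges n ps E) (f(n := w)) (\<lambda>a b. if a = n \<or> b = n then [] else I a b)"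
    (is "emb _ ?E ?f ?I")
proof -
  have oldv: "a < n \<and> b < n" if "(a, b, l) \<in> set E" for a b l
    using emb_edge[OF emb edgeI[OF that]] by auto
  have old: "?I a b = I a b" "?I b a = I b a" "?f a = f a" "?f b = f b" if "(a, b, l) \<in> set E" for a b l
    using oldv[OF that] by auto
  have mem: "(a, b, l) \<in> set ?E \<longleftrightarrow> (a \<in> set ps \<and> b = n \<and> l = Unit) \<or> (a, b, l) \<in> set E" for a b l
    unfolding star_edges_def by auto
  have revs: "?I b a = rev (?I a b)" if "(a, b, l) \<in> set ?E" for a b l
    using that old emb_rev[OF emb] unfolding mem by fastforce
  have imgE: "img n E f I = f ` {..<n} \<union> (\<Union>(u, v, l)\<in>set E. set (I u v))"
    by (rule img_emb[OF emb])
  have fim: "?f ` {..<Suc n} = insert w (f ` {..<n})" by (auto simp: lessThan_Suc)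
  have img: "img (Suc n) ?E ?f ?I = insert w (img n E f I)"
  proof -
    have "(\<Union>(u, v, l)\<in>set ?E. set (?I u v)) = (\<Union>(u, v, l)\<in>set E. set (I u v))"
    proof -
      have "(\<Union>(u, v, l)\<in>set E. set (?I u v)) = (\<Union>(u, v, l)\<in>set E. set (I u v))"
        by (rule SUP_cong) (use old in auto)
      moreover have "(\<Union>(u, v, l)\<in>set ?E. set (?I u v)) = (\<Union>(u, v, l)\<in>set E. set (?I u v))"
        unfolding star_edges_def by auto
      ultimately show ?thesis by simp
    qed
    then show ?thesis unfolding imgE fim[symmetric] by (subst img_list) (use revs fim in auto)
  qed
  have sp: "spath ?f ?I a b = spath f I a b" if "(a, b, l) \<in> set E" for a b l
    using old[OF that] by (simp add: spath_def)
  show ?thesis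
  proof (rule embI)
    show "inj_on ?f {..<Suc n}"
      using emb_inj[OF emb] w(2) by (auto simp: lessThan_Suc inj_on_def img_def)
    show "img (Suc n) ?E ?f ?I \<subseteq> V" unfolding img using w emb_V[OF emb] by auto
  next
    fix a b l assume ab: "(a, b, l) \<in> set ?E"
    show "a < Suc n \<and> b < Suc n \<and> a \<noteq> b \<and> ?I b a = rev (?I a b)
         \<and> distinct (?I a b) \<and> set (?I a b) \<inter> ?f ` {..<Suc n} = {}
         \<and> (l = Unit \<longrightarrow> ?I a b = []) \<and> (l = Long \<longrightarrow> ?I a b \<noteq> [])"
    proof (cases "(a, b, l) \<in> set E")
      case True
      have "w \<notin> set (I a b)" using w(2) True unfolding imgE by auto
      then show ?thesis
        using old[OF True] emb_edge[OF emb edgeI[OF True]] emb_Unit[OF emb] emb_Long[OF emb] True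
        unfolding fim by auto
    next
      case False
      then show ?thesis using ab ps[of a] unfolding mem by auto
    qed
  next
    fix a b l a' b' l' assume 1: "(a, b, l) \<in> set ?E" "(a', b', l') \<in> set ?E" "{a, b} \<noteq> {a', b'}"
    show "set (?I a b) \<inter> set (?I a' b') = {}"
      using 1 emb_disj[OF emb edgeI edgeI, of a b l a' b' l'] unfolding mem by auto
  next
    fix x y assume xy: "x \<in> img (Suc n) ?E ?f ?I" "y \<in> img (Suc n) ?E ?f ?I"
    have spw: "spath ?f ?I p n = [f p, w]" if "p \<in> set ps" for p
      using ps[OF that] by (simp add: spath_def)
    have rhs: "(\<exists>(a, b, l)\<in>set ?E. consec (spath ?f ?I a b) x y) \<longleftrightarrow>
        (\<exists>p\<in>set ps. {x, y} = {f p, w}) \<or> (\<exists>(a, b, l)\<in>set E. consec (spath f I a b) x y)"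
      (is "?L \<longleftrightarrow> ?M")
    proof
      assume ?L
      then obtain a b l where abl: "(a, b, l) \<in> set ?E" "consec (spath ?f ?I a b) x y" by blast
      show ?M
      proof (cases "(a, b, l) \<in> set E")
        case True then show ?thesis using abl sp[OF True] by auto
      next
        case False
        then have "a \<in> set ps" "b = n" using abl unfolding mem by auto
        then show ?thesis using abl(2) spw by (auto simp: consec_Cons simp del: fun_upd_apply)
      qed
    next
      assume ?M
      then show ?L
      proof
        assume "\<exists>p\<in>set ps. {x, y} = {f p, w}"
        then obtain p where p: "p \<in> set ps" "{x, y} = {f p, w}" by blast
        then have "consec (spath ?f ?I p n) x y" unfolding spw[OF p(1)] by (simp add: consec_Cons)
        then show ?L using p unfolding star_edges_def by force
      next
        assume "\<exists>(a, b, l)\<in>set E. consec (spath f I a b) x y"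
        then obtain a b l where abl: "(a, b, l) \<in> set E" "consec (spath f I a b) x y" by blast
        then have "consec (spath ?f ?I a b) x y" using sp by simp
        then show ?L using abl unfolding star_edges_def by force
      qed
    qed
    have oldimg: "x \<in> img n E f I \<and> y \<in> img n E f I"
      if "(a, b, l) \<in> set E" "consec (spath f I a b) x y" for a b l
      using consec_in_set[OF that(2)] spath_img[OF emb edgeI[OF that(1)]] by auto
    have fps: "f p \<in> img n E f I" if "p \<in> set ps" for p using ps[OF that] by (auto simp: img_def)
    show "adj x y \<longleftrightarrow> (\<exists>(a, b, l)\<in>set ?E. consec (spath ?f ?I a b) x y)"
    proof (cases "x = w \<or> y = w")
      case True
      have "\<not> (\<exists>(a, b, l)\<in>set E. consec (spath f I a b) x y)" using oldimg True w by blast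
      moreover have "adj x y \<longleftrightarrow> (\<exists>p\<in>set ps. {x, y} = {f p, w})"
      proof (cases "x = w \<and> y = w")
        case True then show ?thesis using fps w by (auto simp: doubleton_eq_iff)
      next
        case False
        show ?thesis
        proof (cases "x = w")
          case True
          then have "y \<in> img n E f I" using False xy unfolding img by auto
          then show ?thesis using adj[of y] True False by (auto simp: doubleton_eq_iff)
        next
          case F: False
          then have "x \<in> img n E f I" "y = w" using \<open>x = w \<or> y = w\<close> xy unfolding img by auto
          then show ?thesis using adj[of x] F adj_commute[of x y] by (auto simp: doubleton_eq_iff)
        qed
      qed
      ultimately show ?thesis unfolding rhs by blast
    next
      case False
      then have "x \<in> img n E f I" "y \<in> img n E f I" using xy unfolding img by auto
      then show ?thesis
        unfolding rhs using emb_adj_list[OF emb, of x y] False by (auto simp: doubleton_eq_iff)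
    qed
  qed
qed

text \<open>Nothing changes in the graph: the inner vertex \<open>p\<close> merely becomes the
  skeleton vertex number \<open>n\<close>.\<close>

lemma emb_split:
  assumes emb: "emb n E f I" and e: "edge E u v" and I: "I u v = A @ p # B"
  defines "f' \<equiv> f(n := p)" and "I' \<equiv> upd (upd I u n A) n v B"
  shows "emb (Suc n) (split_edge n u v E) f' I'"
    and "img (Suc n) (split_edge n u v E) f' I' = img n E f I"
    and "I' u n = A" "I' n v = B"
proof -
  let ?E = "split_edge n u v E"
  note uv = emb_edge[OF emb e]
  have oldv: "a < n \<and> b < n" if "(a, b, l) \<in> set E" for a b l
    using emb_edge[OF emb edgeI[OF that]] by auto
  have mem: "(a, b, l) \<in> set ?E \<longleftrightarrow> (a, b, l) = (u, n, Any) \<or> (a, b, l) = (n, v, Any)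
      \<or> (a, b, l) \<in> set E \<and> {a, b} \<noteq> {u, v}" for a b l
    unfolding split_edge_def using drop_edge_iff by auto
  have old: "I' a b = I a b" "I' b a = I b a" "f' a = f a" "f' b = f b"
    if "(a, b, l) \<in> set E" for a b l
    using oldv[OF that] unfolding I'_def f'_def by (auto simp: upd_def)
  show I'1: "I' u n = A" and I'3: "I' n v = B"
    using uv unfolding I'_def by (auto simp: upd_def)
  have I'2: "I' n u = rev A" and I'4: "I' v n = rev B"
    using uv unfolding I'_def by (auto simp: upd_def)
  have revs: "I' b a = rev (I' a b)" if "(a, b, l) \<in> set ?E" for a b l
    using that old emb_rev[OF emb] I'1 I'2 I'3 I'4 unfolding mem by (metis prod.inject)
  have imgE: "img n E f I = f ` {..<n} \<union> (\<Union>(u, v, l)\<in>set E. set (I u v))"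
    by (rule img_emb[OF emb])
  have fim: "f' ` {..<Suc n} = insert p (f ` {..<n})" unfolding f'_def by (auto simp: lessThan_Suc)
  have Iuv: "set (I u v) = set A \<union> {p} \<union> set B" "set (I v u) = set (I u v)" "distinct (A @ p # B)"
    using uv I by auto
  have imgs: "img n E f I = (f ` {..<n} \<union> (\<Union>(u, v, l)\<in>set (drop_edge u v E). set (I u v))) \<union> set (I u v)"
  proof -
    have "img n E f I = (img n E f I - set (I u v)) \<union> set (I u v)"
      using spath_img[OF emb e] by (auto simp: set_spath)
    also have "img n E f I - set (I u v) = img n (drop_edge u v E) f I"
      using emb_drop(2)[OF emb e] I by simp
    also have "\<dots> = f ` {..<n} \<union> (\<Union>(u, v, l)\<in>set (drop_edge u v E). set (I u v))"
      using emb_drop(1)[OF emb e] I by (intro img_emb) auto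
    finally show ?thesis .
  qed
  show img: "img (Suc n) ?E f' I' = img n E f I"
  proof -
    have "(\<Union>(a, b, l)\<in>set (drop_edge u v E). set (I' a b)) = (\<Union>(a, b, l)\<in>set (drop_edge u v E). set (I a b))"
      by (rule SUP_cong) (use old in \<open>auto simp: drop_edge_iff\<close>)
    then have "(\<Union>(a, b, l)\<in>set ?E. set (I' a b)) = set A \<union> set B \<union> (\<Union>(a, b, l)\<in>set (drop_edge u v E). set (I a b))"
      unfolding split_edge_def using I'1 I'3 by auto
    then show ?thesis unfolding imgs Iuv(1) by (subst img_list) (use revs fim in auto)
  qed
  have sp: "spath f' I' a b = spath f I a b" if "(a, b, l) \<in> set E" for a b l
    using old[OF that] by (simp add: spath_def)
  have pimg: "p \<notin> f ` {..<n}" "set A \<inter> f ` {..<n} = {}" "set B \<inter> f ` {..<n} = {}" using uv I by auto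
  have dis: "set (I a b) \<inter> (set A \<union> {p} \<union> set B) = {}" if "(a, b, l) \<in> set E" "{a, b} \<noteq> {u, v}" for a b l
    using emb_disj[OF emb edgeI[OF that(1)] e that(2)] unfolding Iuv(1) .
  show "emb (Suc n) ?E f' I'"
  proof (rule embI)
    show "inj_on f' {..<Suc n}"
      using emb_inj[OF emb] pimg unfolding f'_def by (auto simp: lessThan_Suc inj_on_def)
    show "img (Suc n) ?E f' I' \<subseteq> V" unfolding img using emb_V[OF emb] .
  next
    fix a b l assume ab: "(a, b, l) \<in> set ?E"
    show "a < Suc n \<and> b < Suc n \<and> a \<noteq> b \<and> I' b a = rev (I' a b)
         \<and> distinct (I' a b) \<and> set (I' a b) \<inter> f' ` {..<Suc n} = {}
         \<and> (l = Unit \<longrightarrow> I' a b = []) \<and> (l = Long \<longrightarrow> I' a b \<noteq> [])"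
    proof (cases "(a, b, l) \<in> set E \<and> {a, b} \<noteq> {u, v}")
      case True
      then have T: "(a, b, l) \<in> set E" by simp
      have "p \<notin> set (I a b)" using dis True by blast
      then show ?thesis
        using old[OF T] emb_edge[OF emb edgeI[OF T]] emb_Unit[OF emb] emb_Long[OF emb] T
        unfolding fim by auto
    next
      case False
      then have "(a, b, l) = (u, n, Any) \<or> (a, b, l) = (n, v, Any)" using ab unfolding mem by auto
      then show ?thesis using revs[OF ab] uv I'1 I'3 pimg Iuv(3) unfolding fim by auto
    qed
  next
    fix a b l a' b' l' assume 1: "(a, b, l) \<in> set ?E" "(a', b', l') \<in> set ?E" "{a, b} \<noteq> {a', b'}"
    have AB: "set A \<inter> set B = {}" using Iuv(3) by auto
    have o: "set (I' x y) \<inter> (set A \<union> set B) = {}" if "(x, y, k) \<in> set E" "{x, y} \<noteq> {u, v}" for x y k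
      using dis[OF that] old[OF that(1)] by auto
    have oo: "set (I' a b) \<inter> set (I' a' b') = {}" if "(a, b, l) \<in> set E" "(a', b', l') \<in> set E"
      using emb_disj[OF emb edgeI[OF that(1)] edgeI[OF that(2)] 1(3)] old[OF that(1)] old[OF that(2)] by simp
    from 1(1)[unfolded mem] show "set (I' a b) \<inter> set (I' a' b') = {}"
    proof (elim disjE)
      assume A: "(a, b, l) = (u, n, Any)"
      from 1(2)[unfolded mem] show ?thesis
        by (elim disjE) (use A 1(3) AB o[of a' b' l'] I'1 I'3 in auto)
    next
      assume A: "(a, b, l) = (n, v, Any)"
      from 1(2)[unfolded mem] show ?thesis
        by (elim disjE) (use A 1(3) AB o[of a' b' l'] I'1 I'3 in auto)
    next
      assume A: "(a, b, l) \<in> set E \<and> {a, b} \<noteq> {u, v}"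
      from 1(2)[unfolded mem] show ?thesis
        by (elim disjE) (use A 1(3) AB o[of a b l] I'1 I'3 oo in auto)
    qed
  next
    fix x y assume xy: "x \<in> img (Suc n) ?E f' I'" "y \<in> img (Suc n) ?E f' I'"
    have f'n: "f' n = p" "f' u = f u" "f' v = f v" using uv unfolding f'_def by auto
    have two: "consec (spath f I u v) x y \<longleftrightarrow> consec (spath f' I' u n) x y \<or> consec (spath f' I' n v) x y"
      unfolding spath_def f'n I'1 I'3 I using consec_glue[of "f u" A p "B @ [f v]" x y] by simp
    have same: "consec (spath f I a b) x y \<longleftrightarrow> consec (spath f I u v) x y"
      if "edge E a b" "{a, b} = {u, v}" for a b
      using that spath_rev[OF emb e] by (auto simp: doubleton_eq_iff)
    have "(\<exists>a b. edge E a b \<and> consec (spath f I a b) x y) \<longleftrightarrow>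
       consec (spath f' I' u n) x y \<or> consec (spath f' I' n v) x y \<or>
       (\<exists>(a, b, l)\<in>set E. {a, b} \<noteq> {u, v} \<and> consec (spath f I a b) x y)"
    proof -
      have "(\<exists>a b. edge E a b \<and> {a, b} \<noteq> {u, v} \<and> consec (spath f I a b) x y) \<longleftrightarrow>
       (\<exists>(a, b, l)\<in>set E. {a, b} \<noteq> {u, v} \<and> consec (spath f I a b) x y)"
      proof
        assume "\<exists>a b. edge E a b \<and> {a, b} \<noteq> {u, v} \<and> consec (spath f I a b) x y"
        then obtain a b where ab: "edge E a b" "{a, b} \<noteq> {u, v}" "consec (spath f I a b) x y" by blast
        then have ba: "{b, a} \<noteq> {u, v}" "consec (spath f I b a) x y"
          using spath_rev[OF emb ab(1)] by (simp_all add: insert_commute)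
        from ab(1)[unfolded edge_iff]
        show "\<exists>(a, b, l)\<in>set E. {a, b} \<noteq> {u, v} \<and> consec (spath f I a b) x y"
          using ab(2,3) ba by blast
      next
        assume "\<exists>(a, b, l)\<in>set E. {a, b} \<noteq> {u, v} \<and> consec (spath f I a b) x y"
        then show "\<exists>a b. edge E a b \<and> {a, b} \<noteq> {u, v} \<and> consec (spath f I a b) x y"
          using edgeI by fastforce
      qed
      moreover have "(\<exists>a b. edge E a b \<and> consec (spath f I a b) x y) \<longleftrightarrow> consec (spath f I u v) x y
        \<or> (\<exists>a b. edge E a b \<and> {a, b} \<noteq> {u, v} \<and> consec (spath f I a b) x y)"
        using same e by metis
      ultimately show ?thesis unfolding two by simp
    qed
    moreover have "(\<exists>(a, b, l)\<in>set ?E. consec (spath f' I' a b) x y) \<longleftrightarrow>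
       consec (spath f' I' u n) x y \<or> consec (spath f' I' n v) x y \<or>
       (\<exists>(a, b, l)\<in>set E. {a, b} \<noteq> {u, v} \<and> consec (spath f I a b) x y)"
    proof -
      have "(\<exists>(a, b, l)\<in>set (drop_edge u v E). consec (spath f' I' a b) x y) \<longleftrightarrow>
        (\<exists>(a, b, l)\<in>set E. {a, b} \<noteq> {u, v} \<and> consec (spath f I a b) x y)"
      proof -
        show ?thesis
          unfolding bex_triple drop_edge_iff using sp by metis
      qed
      then show ?thesis unfolding split_edge_def by simp
    qed
    ultimately show "adj x y \<longleftrightarrow> (\<exists>(a, b, l)\<in>set ?E. consec (spath f' I' a b) x y)"
      using emb_adj[OF emb, of x y] xy unfolding img by blast
  qed
qed

lemma emb_iso:
  assumes emb: "emb n E f I" and chk: "check_iso n E g K"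
  shows "emb (fst K) (snd K) (\<lambda>i. f (g ! i)) (\<lambda>a b. I (g ! a) (g ! b))"
    and "img (fst K) (snd K) (\<lambda>i. f (g ! i)) (\<lambda>a b. I (g ! a) (g ! b)) = img n E f I"
proof -
  let ?f = "\<lambda>i. f (g ! i)" and ?I = "\<lambda>a b. I (g ! a) (g ! b)"
  have g: "fst K = n" "length g = n" "distinct g" "\<And>x. x \<in> set g \<Longrightarrow> x < n"
    using chk by (auto simp: check_iso_def)
  have gset: "set g = {..<n}"
  proof (rule card_subset_eq)
    show "card (set g) = card {..<n}" using g(2,3) distinct_card by fastforce
  qed (use g(4) in auto)
  have "(!) g ` {..<n} = set g" using g(2) by (auto simp: set_conv_nth)
  then have fim: "?f ` {..<n} = f ` {..<n}" using gset by (metis image_image)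
  have ginj: "inj_on ((!) g) {..<n}" using g by (auto simp: inj_on_def nth_eq_iff_index_eq)
  have lt: "a < n" "b < n" if "(a, b, l) \<in> set (snd K)" for a b l
    using chk that by (fastforce simp: check_iso_def)+
  have fwd: "(g ! a, g ! b, l) \<in> set E \<or> (g ! b, g ! a, l) \<in> set E" if "(a, b, l) \<in> set (snd K)" for a b l
    using chk that by (fastforce simp: check_iso_def)
  have fe: "edge E (g ! a) (g ! b)" if "edge (snd K) a b" for a b
    using that fwd unfolding edge_iff by blast
  have bwd: "\<exists>a b. edge (snd K) a b \<and> x = g ! a \<and> y = g ! b" if "edge E x y" for x y
    using that chk unfolding edge_iff check_iso_def by fastforce
  have elt: "a < n \<and> b < n" if "edge (snd K) a b" for a b
    using that lt unfolding edge_iff by blast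
  have gneq: "g ! a = g ! b \<longleftrightarrow> a = b" if "a < n" "b < n" for a b
    using that g nth_eq_iff_index_eq by metis
  have sp: "spath ?f ?I a b = spath f I (g ! a) (g ! b)" for a b by (simp add: spath_def)
  show img: "img (fst K) (snd K) ?f ?I = img n E f I"
    unfolding img_def g(1) fim using fe bwd by blast
  have u: "I (g ! a) (g ! b) = [] \<longleftrightarrow> I (g ! b) (g ! a) = []" if "edge (snd K) a b" for a b
    using emb_edge[OF emb fe[OF that]] by simp
  have img': "img n (snd K) ?f ?I = img n E f I" using img g(1) by simp
  show "emb (fst K) (snd K) ?f ?I"
    unfolding emb_def g(1) img'
  proof (intro conjI)
    show "inj_on ?f {..<n}"
    proof (rule inj_onI)
      fix x y assume xy: "x \<in> {..<n}" "y \<in> {..<n}" "f (g ! x) = f (g ! y)"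
      then have "g ! x < n" "g ! y < n" using g by auto
      then have "g ! x = g ! y" using emb_inj[OF emb] xy by (auto simp: inj_on_def)
      then show "x = y" using gneq xy by simp
    qed
    show "img n E f I \<subseteq> V" by (rule emb_V[OF emb])
    show "\<forall>u v. edge (snd K) u v \<longrightarrow> u < n \<and> v < n \<and> u \<noteq> v \<and> ?I v u = rev (?I u v) \<and>
          distinct (?I u v) \<and> set (?I u v) \<inter> ?f ` {..<n} = {}"
    proof (intro allI impI)
      fix u v assume "edge (snd K) u v"
      then show "u < n \<and> v < n \<and> u \<noteq> v \<and> ?I v u = rev (?I u v) \<and>
          distinct (?I u v) \<and> set (?I u v) \<inter> ?f ` {..<n} = {}"
        using emb_edge[OF emb fe] elt unfolding fim by blast
    qed
    show "\<forall>u v u' v'. edge (snd K) u v \<and> edge (snd K) u' v' \<and> {u, v} \<noteq> {u', v'} \<longrightarrow>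
        set (?I u v) \<inter> set (?I u' v') = {}"
    proof (intro allI impI)
      fix u v u' v' assume *: "edge (snd K) u v \<and> edge (snd K) u' v' \<and> {u, v} \<noteq> {u', v'}"
      then have "{g ! u, g ! v} \<noteq> {g ! u', g ! v'}"
        using elt gneq by (metis doubleton_eq_iff)
      then show "set (?I u v) \<inter> set (?I u' v') = {}" using emb_disj[OF emb fe fe] * by blast
    qed
    show "\<forall>u v. (u, v, Unit) \<in> set (snd K) \<longrightarrow> ?I u v = []"
      using fwd u edgeI emb_Unit[OF emb] by metis
    show "\<forall>u v. (u, v, Long) \<in> set (snd K) \<longrightarrow> ?I u v \<noteq> []"
      using fwd u edgeI emb_Long[OF emb] by metis
    show "\<forall>x\<in>img n E f I. \<forall>y\<in>img n E f I.
       adj x y \<longleftrightarrow> (\<exists>u v. edge (snd K) u v \<and> consec (spath ?f ?I u v) x y)"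
      unfolding sp using emb_adj[OF emb] fe bwd by blast
  qed
qed

end

subsection \<open>Certificates\<close>

text \<open>A certificate that a skeleton with edges of unknown length cannot be embedded or is
  one of some target skeletons: a cycle with a unique chord, a triangle or square of unit edges, a
  case distinction on the label of an edge, or an isomorphism to the k-th target.\<close>

datatype cert = Cyc "nat list" | Short "nat list" | Branch nat nat cert cert | Iso nat "nat list"

definition unit_edge :: "lab_edges \<Rightarrow> nat \<Rightarrow> nat \<Rightarrow> bool" where
  "unit_edge E u v \<longleftrightarrow> (\<exists>(a, b, l)\<in>set E. l = Unit \<and> (a = u \<and> b = v \<or> a = v \<and> b = u))"

fun check_short :: "lab_edges \<Rightarrow> nat list \<Rightarrow> bool" where
  "check_short E [a, b, c] \<longleftrightarrow> unit_edge E a b \<and> unit_edge E b c \<and> unit_edge E c a"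
| "check_short E [a, b, c, d] \<longleftrightarrow> a \<noteq> c \<and> b \<noteq> d
     \<and> unit_edge E a b \<and> unit_edge E b c \<and> unit_edge E c d \<and> unit_edge E d a"
| "check_short E _ \<longleftrightarrow> False"

fun check :: "(nat \<times> lab_edges) list \<Rightarrow> nat \<Rightarrow> lab_edges \<Rightarrow> cert \<Rightarrow> bool" where
  "check G n E (Cyc c) \<longleftrightarrow> check_uni E c"
| "check G n E (Short c) \<longleftrightarrow> check_short E c"
| "check G n E (Branch u v s t) \<longleftrightarrow> check G n (set_lab u v Unit E) s \<and> check G n (set_lab u v Long E) t"
| "check G n E (Iso k g) \<longleftrightarrow> k < length G \<and> check_iso n E g (G ! k)"

locale unichord_free_graph = graph +
  assumes unichord_free: "unichord_free V adj"
begin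

lemma no_unichord:
  assumes c: "is_cycle V adj c" and xy: "x \<in> set c" "y \<in> set c" "adj x y" "\<not> consec (c @ [hd c]) x y"
    and only: "\<And>a b. a \<in> set c \<Longrightarrow> b \<in> set c \<Longrightarrow> adj a b \<Longrightarrow> consec (c @ [hd c]) a b \<or> {a, b} = {x, y}"
  shows False
proof -
  have "chords adj c = {{x, y}}"
    unfolding chords_def cyc_adj_eq_consec using xy only by blast
  then show False using c unichord_free unfolding unichord_free_def unichord_def by blast
qed

text \<open>By \<open>real_cycle_chord\<close> the single free edge is the only candidate for a
  chord, and its label \<open>Unit\<close> makes it an actual one.\<close>

lemma emb_check_uni:
  assumes emb: "emb n E f I" and chk: "check_uni E c"
  shows False
proof -
  have cyc: "check_cyc E c" using chk by (simp add: check_uni_def)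
  obtain u v where fr: "free_edges E c = [(u, v, Unit)]"
    using chk unfolding check_uni_def by auto
  then have "(u, v, Unit) \<in> set (free_edges E c)" by simp
  then have uv: "(u, v, Unit) \<in> set E" "u \<in> set c" "v \<in> set c" "(u, v) \<notin> set (cpairs c)" "(v, u) \<notin> set (cpairs c)"
    unfolding free_edges_def by auto
  have e: "edge E u v" and I: "I u v = []" using uv(1) edgeI emb_Unit[OF emb] by blast+
  note lt = emb_edge[OF emb e]
  have "adj (f u) (f v)" using emb_path(1)[OF emb e] I by (simp add: spath_def)
  moreover have "f u \<in> set (real_cycle f I c)" "f v \<in> set (real_cycle f I c)"
    using set_real_cycle[OF emb cyc] uv by auto
  moreover have "\<not> consec (real_cycle f I c @ [hd (real_cycle f I c)]) (f u) (f v)"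
  proof
    assume "consec (real_cycle f I c @ [hd (real_cycle f I c)]) (f u) (f v)"
    then obtain a b where ab: "(a, b) \<in> set (cpairs c)" "consec (spath f I a b) (f u) (f v)"
      using consec_real_cycle[OF emb cyc] by auto
    have "edge E a b" using cyc ab(1) by (auto simp: check_cyc_def)
    then have "{u, v} = {a, b}" using consec_spath_ends[OF emb _ _ _ ab(2)] lt by blast
    then show False using ab(1) uv by (auto simp: doubleton_eq_iff)
  qed
  moreover have "consec (real_cycle f I c @ [hd (real_cycle f I c)]) a b \<or> {a, b} = {f u, f v}"
    if "a \<in> set (real_cycle f I c)" "b \<in> set (real_cycle f I c)" "adj a b" for a b
    using real_cycle_chord[OF emb cyc that] fr by auto
  ultimately show False
    using no_unichord[OF real_cycle_is_cycle[OF emb cyc]] by blast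
qed

end

text \<open>The situation that remains after \<open>triangle_case\<close> and
  \<open>square_case\<close>.\<close>

locale tsf_graph = unichord_free_graph +
  assumes no_triangle: "adj a b \<Longrightarrow> adj b c \<Longrightarrow> \<not> adj c a"
    and no_square: "adj a b \<Longrightarrow> adj b c \<Longrightarrow> adj c d \<Longrightarrow> adj d a \<Longrightarrow> a = c \<or> b = d"
begin

lemma emb_unit_edge: "emb n E f I \<Longrightarrow> unit_edge E a b \<Longrightarrow> a < n \<and> b < n \<and> adj (f a) (f b)"
proof -
  assume emb: "emb n E f I" and "unit_edge E a b"
  then obtain u v where uv: "(u, v, Unit) \<in> set E" "u = a \<and> v = b \<or> u = b \<and> v = a"
    unfolding unit_edge_def by blast
  have "adj (f u) (f v)"
    using emb_path(1)[OF emb edgeI[OF uv(1)]] emb_Unit[OF emb uv(1)] by (simp add: spath_def)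
  then show ?thesis using uv adj_sym emb_edge[OF emb edgeI[OF uv(1)]] by blast
qed

lemma emb_check_short:
  assumes emb: "emb n E f I" and chk: "check_short E c"
  shows False
  using chk
proof (cases rule: check_short.elims(2))
  case (1 a b c)
  then show ?thesis using emb_unit_edge[OF emb] no_triangle by metis
next
  case (2 a b c d)
  then have "adj (f a) (f b)" "adj (f b) (f c)" "adj (f c) (f d)" "adj (f d) (f a)"
    and lt: "a < n" "b < n" "c < n" "d < n" "a \<noteq> c" "b \<noteq> d"
    using emb_unit_edge[OF emb] by blast+
  then have "f a = f c \<or> f b = f d" using no_square by blast
  then show ?thesis using emb_inj[OF emb] lt by (auto simp: inj_on_def)
qed

text \<open>An interior is empty or not, so \<open>Branch\<close> loses no case. The leaves
  \<open>Cyc\<close> and \<open>Short\<close> are contradictory, which leaves an \<open>Iso\<close>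
  leaf.\<close>

lemma emb_check:
  assumes "emb n E f I" "check G n E t"
  shows "\<exists>K\<in>set G. \<exists>f I. emb (fst K) (snd K) f I"
  using assms
proof (induction G n E t rule: check.induct)
  case (1 G n E c) then show ?case using emb_check_uni[of n E f I c] by auto
next
  case (2 G n E c) then show ?case using emb_check_short[of n E f I c] by auto
next
  case (3 G n E u v s t)
  show ?case
  proof (cases "I u v = []")
    case True
    then show ?thesis using 3 emb_set_lab[OF 3(3), of Unit u v] by auto
  next
    case False
    then show ?thesis using 3 emb_set_lab[OF 3(3), of Long u v] by auto
  qed
next
  case (4 G n E k g)
  then show ?case using emb_iso(1)[OF 4(1)] nth_mem by (metis check.simps(4))
qed

text \<open>A vertex with three neighbours on a hole would see two consecutive sub-paths of the hole that
  form with it a cycle whose only chord goes to the middle neighbour.\<close>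

lemma hole_nbrs:
  assumes cyc: "is_cycle V adj c"
    and hole: "\<And>x y. x \<in> set c \<Longrightarrow> y \<in> set c \<Longrightarrow> adj x y \<Longrightarrow> consec (c @ [hd c]) x y"
    and w: "w \<notin> set c" and S: "S \<subseteq> set c" "\<And>x. x \<in> S \<Longrightarrow> adj w x"
  shows "card S \<le> 2"
proof (rule ccontr)
  assume "\<not> card S \<le> 2"
  \<comment> \<open>Listing the neighbours of \<open>w\<close> in the order of \<open>c\<close>
    makes the first three of them, \<open>p\<close>, \<open>q\<close> and \<open>r\<close>,
    consecutive attachments.\<close>
  define N where "N = filter (adj w) c"
  have c: "distinct c" "set c \<subseteq> V" "successively adj (c @ [hd c])" using cyc by (auto simp: is_cycle_eq)
  have "S \<subseteq> set N" using S by (auto simp: N_def)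
  then have "card S \<le> length N" by (meson List.finite_set card_length card_mono le_trans)
  then obtain p q r N' where N: "N = p # q # r # N'"
    using \<open>\<not> card S \<le> 2\<close> by (cases N; cases "tl N"; cases "tl (tl N)") auto
  obtain Z c1 where c1: "c = Z @ p # c1" "q # r # N' = filter (adj w) c1" "adj w p"
    using N unfolding N_def by (auto simp: filter_eq_Cons_iff)
  then obtain A c2 where c2: "c1 = A @ q # c2" "\<forall>x\<in>set A. \<not> adj w x" "r # N' = filter (adj w) c2" "adj w q"
    by (auto simp: Cons_eq_filter_iff)
  then obtain B D where c3: "c2 = B @ r # D" "\<forall>x\<in>set B. \<not> adj w x" "adj w r"
    by (auto simp: Cons_eq_filter_iff)
  have ceq: "c = Z @ p # A @ q # B @ r # D" using c1 c2 c3 by simp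
  define h where "h = p # A @ q # B @ [r]"
  have hd: "distinct h" "set h \<subseteq> set c" "w \<notin> set h" using c(1) w ceq by (auto simp: h_def)
  have hsucc: "successively adj h"
    using c(3) unfolding ceq h_def by (auto simp: successively_append_iff successively_Cons hd_append split: if_splits)
  \<comment> \<open>The arc \<open>h\<close> is induced: the only edge of the hole that could join
    two of its vertices without being one of its edges is \<open>r p\<close>, when \<open>h\<close>
    is all of \<open>c\<close>, and that edge would form a triangle with \<open>w\<close>.\<close>
  have hcon: "consec h x y" if "x \<in> set h" "y \<in> set h" "adj x y" for x y
  proof -
    have npr: "{x, y} \<noteq> {p, r}"
      using no_triangle[of p r w] c1(3) c3(3) adj_sym that(3) by (auto simp: doubleton_eq_iff)
    have dist: "distinct (Z @ h @ D)" using c(1) ceq by (simp add: h_def)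
    define t where "t = hd (Z @ h @ D)"
    have "consec (c @ [hd c]) x y" using hole that hd by blast
    then have con: "consec (Z @ h @ (D @ [t])) x y" unfolding ceq h_def t_def by simp
    have x: "x \<notin> set Z" "x \<notin> set D" "y \<notin> set Z" "y \<notin> set D" using that(1,2) dist by auto
    have "\<not> (Z \<noteq> [] \<and> {x, y} = {last Z, hd (h @ D @ [t])})"
      using x last_in_set[of Z] by (metis doubleton_eq_iff)
    with con x have "consec (h @ (D @ [t])) x y"
      unfolding consec_append[of Z] using consec_in_set[of Z x y] by blast
    then have "consec h x y \<or> consec (D @ [t]) x y \<or> {x, y} = {last h, hd (D @ [t])}"
      unfolding consec_append[of h] by blast
    moreover have "\<not> consec (D @ [t]) x y"
      unfolding consec_append[of D] using x consec_in_set[of D x y] last_in_set[of D]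
      by (metis consec_single doubleton_eq_iff)
    moreover have "D = []" if "{x, y} = {last h, hd (D @ [t])}"
      using x hd_in_set[of D] that by (metis doubleton_eq_iff hd_append2)
    ultimately have 1: "consec h x y \<or> {x, y} = {last h, t}" by fastforce
    have "t = hd h" if "{x, y} = {last h, t}"
    proof -
      have "t \<notin> set Z" using that x by (metis doubleton_eq_iff)
      then have "Z = []" unfolding t_def by (cases Z) auto
      then show ?thesis unfolding t_def by (simp add: h_def)
    qed
    then have "consec h x y \<or> {x, y} = {last h, hd h}" using 1 by blast
    then show ?thesis using npr by (auto simp: h_def)
  qed
  have cw: "is_cycle V adj (w # h)"
    unfolding is_cycle_eq
  proof (intro conjI)
    show "set (w # h) \<subseteq> V" using hd(2) c(2) adjV[OF c1(3)] by auto
    show "successively adj ((w # h) @ [hd (w # h)])"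
    proof -
      have "hd h = p" "last h = r" "h \<noteq> []" by (simp_all add: h_def)
      then show ?thesis
        using hsucc c1(3) c3(3) adj_sym by (simp add: successively_append_iff successively_Cons)
    qed
  qed (use hd in \<open>auto simp: h_def\<close>)
  have cc: "consec ((w # h) @ [hd (w # h)]) x y \<longleftrightarrow> consec h x y \<or> {x, y} = {w, p} \<or> {x, y} = {r, w}" for x y
    by (auto simp: h_def consec_Cons[of w] consec_append[of "p # A @ q # B @ [r]" "[w]", simplified])
  show False
  proof (rule no_unichord[OF cw])
    show "w \<in> set (w # h)" "q \<in> set (w # h)" "adj w q" using c2 by (auto simp: h_def)
    have "q \<noteq> p" "q \<noteq> r" using hd(1) by (auto simp: h_def)
    then show "\<not> consec ((w # h) @ [hd (w # h)]) w q"
      unfolding cc using hd(3) consec_in_set[of h w q] by (auto simp: doubleton_eq_iff)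
    fix a b assume ab: "a \<in> set (w # h)" "b \<in> set (w # h)" "adj a b"
    have wN: "x \<in> {p, q, r}" if "x \<in> set h" "adj w x" for x
      using that c2(2) c3(2) by (auto simp: h_def)
    show "consec ((w # h) @ [hd (w # h)]) a b \<or> {a, b} = {w, q}"
      unfolding cc using ab hcon wN[of a] wN[of b] adj_sym[OF ab(3)] by (auto simp: insert_commute)
  qed
qed

end

subsection \<open>Ears and rerouting\<close>

lemma not_consec_last_hd:
  assumes "distinct r" "3 \<le> length r"
  shows "\<not> consec r (last r) (hd r)"
proof -
  obtain a q where r: "r = a # q" using assms by (cases r) auto
  obtain b q' where q: "q = b # q'" using assms r by (cases q) auto
  have "q' \<noteq> []" using assms r q by auto
  have 1: "a \<notin> set q" using assms r by simp
  have "last q \<noteq> b" using assms r q \<open>q' \<noteq> []\<close> last_in_set[of q'] by auto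
  then have "last q \<noteq> hd q" using q by simp
  then show ?thesis
    using r q 1 consec_in_set[of q "last q" a] by (auto simp: consec_Cons doubleton_eq_iff)
qed

context graph
begin

lemma successively_iff_consec: "successively adj p \<longleftrightarrow> (\<forall>x y. consec p x y \<longrightarrow> adj x y)"
proof
  show "successively adj p \<Longrightarrow> \<forall>x y. consec p x y \<longrightarrow> adj x y"
    using successively_consec[OF _ symp_adj] by blast
  show "\<forall>x y. consec p x y \<longrightarrow> adj x y \<Longrightarrow> successively adj p"
    by (auto simp: successively_conv_nth consec_def)
qed

lemma ipath_rev: "ipath (rev p) \<longleftrightarrow> ipath p"
  unfolding ipath_def successively_iff_consec by simp

lemma consec_rotate: "consec ((s # Q @ P) @ [s]) x y \<longleftrightarrow> consec ((P @ s # Q) @ [hd (P @ s # Q)]) x y"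
proof (cases P)
  case (Cons a P')
  have "consec (s # Q @ a # (P' @ [s])) x y \<longleftrightarrow> consec (s # Q @ [a]) x y \<or> consec (a # P' @ [s]) x y"
    by (rule consec_glue)
  moreover have "consec (a # P' @ s # (Q @ [a])) x y \<longleftrightarrow> consec (a # P' @ [s]) x y \<or> consec (s # Q @ [a]) x y"
    by (rule consec_glue)
  ultimately show ?thesis using Cons by auto
qed simp

lemma cycle_rotate: "is_cycle V adj (P @ s # Q) \<Longrightarrow> is_cycle V adj (s # Q @ P)"
  unfolding is_cycle_eq successively_iff_consec using consec_rotate[of s Q P] by auto

lemma rotate_cycle:
  assumes cyc: "is_cycle V adj c" and xy: "consec (c @ [hd c]) x y"
  obtains c' where "is_cycle V adj c'" "set c' = set c"
    "\<And>a b. consec (c' @ [hd c']) a b \<longleftrightarrow> consec (c @ [hd c]) a b"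
    "last c' = x \<and> hd c' = y \<or> last c' = y \<and> hd c' = x"
proof (cases "consec c x y")
  case False
  moreover have "c \<noteq> []" using cyc by (auto simp: is_cycle_def)
  ultimately have "{x, y} = {last c, hd c}" using xy by (auto simp: consec_append)
  then show ?thesis using that[of c] cyc by (auto simp: doubleton_eq_iff)
next
  case True
  then obtain Z a b R where c: "c = (Z @ [a]) @ b # R" and ab: "{a, b} = {x, y}"
    unfolding consec_split by (metis append.assoc append_Cons append_Nil insert_commute)
  have "is_cycle V adj (b # R @ Z @ [a])" using cycle_rotate[of "Z @ [a]" b R] cyc c by simp
  moreover have "set (b # R @ Z @ [a]) = set c" unfolding c by auto
  moreover have "consec ((b # R @ Z @ [a]) @ [b]) s t \<longleftrightarrow> consec (c @ [hd c]) s t" for s t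
    using consec_rotate[of b R "Z @ [a]" s t] unfolding c .
  ultimately show ?thesis using that[of "b # R @ Z @ [a]"] ab by (auto simp: doubleton_eq_iff)
qed

text \<open>An ear of \<open>W\<close> with ends \<open>x\<close> and \<open>y\<close>. It may
  consist of a single vertex, which then has exactly the neighbours \<open>x\<close> and
  \<open>y\<close> in \<open>W\<close>.\<close>

definition attached :: "'a set \<Rightarrow> 'a list \<Rightarrow> 'a \<Rightarrow> 'a \<Rightarrow> bool" where
  "attached W ds x y \<longleftrightarrow> ds \<noteq> [] \<and> ipath ds \<and> set ds \<subseteq> V - W \<and>
     (\<forall>d\<in>set ds. \<forall>z\<in>W. adj d z \<longleftrightarrow> d = hd ds \<and> z = x \<or> d = last ds \<and> z = y)"

lemma attached_rev: "attached W ds x y \<Longrightarrow> attached W (rev ds) y x"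
  unfolding attached_def ipath_rev by (auto simp: hd_rev last_rev)

lemma attached_mono: "attached W ds x y \<Longrightarrow> U \<subseteq> W \<Longrightarrow> attached U ds x y"
  unfolding attached_def by blast

lemma attached_consec:
  assumes at: "attached W ds x y" and W: "x \<in> W" "y \<in> W" and z: "z \<in> set ds" "t \<in> W \<union> set ds"
  shows "adj z t \<longleftrightarrow> consec (x # ds @ [y]) z t"
proof -
  have ds: "ds \<noteq> []" "set ds \<inter> W = {}" using at by (auto simp: attached_def)
  have n: "x \<notin> set ds" "y \<notin> set ds" using ds W by auto
  have c: "consec (x # ds @ [y]) z t \<longleftrightarrow> consec ds z t \<or> {z, t} = {x, hd ds} \<or> {z, t} = {last ds, y}"
    by (rule consec_capped[OF ds(1)])
  show ?thesis
  proof (cases "t \<in> set ds")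
    case True
    have "{z, t} \<noteq> {x, hd ds}" "{z, t} \<noteq> {last ds, y}"
      using n True z(1) by (metis doubleton_eq_iff)+
    then show ?thesis
      unfolding c using at z(1) True unfolding attached_def ipath_def successively_iff_consec by blast
  next
    case False
    then have t: "t \<in> W" using z by blast
    have "\<not> consec ds z t" using False consec_in_set[of ds z t] by blast
    moreover have "hd ds \<in> set ds" "last ds \<in> set ds" using ds by auto
    ultimately have "consec (x # ds @ [y]) z t \<longleftrightarrow> z = hd ds \<and> t = x \<or> z = last ds \<and> t = y"
      unfolding c using n z(1) by (metis doubleton_eq_iff)
    then show ?thesis using at z(1) t unfolding attached_def by blast
  qed
qed

text \<open>The segment \<open>spath f I u v\<close> includes its two ends, so the ends of a
  skeleton edge are never bad together.\<close>

definition bad :: "lab_edges \<Rightarrow> (nat \<Rightarrow> 'a) \<Rightarrow> (nat \<Rightarrow> nat \<Rightarrow> 'a list) \<Rightarrow> 'a set \<Rightarrow> bool" where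
  "bad E f I T \<longleftrightarrow> \<not> (\<exists>u v. edge E u v \<and> T \<subseteq> set (spath f I u v))"

end

text \<open>The hole c through the edge uv is listed such that uv closes it: the list itself is a second path
  between u and v.\<close>

definition covered :: "nat \<Rightarrow> lab_edges \<Rightarrow> bool" where
  "covered n E \<longleftrightarrow> 4 \<le> n
     \<and> (\<forall>u<n. \<forall>v. \<exists>v1 v2. edge E u v1 \<and> edge E u v2 \<and> v1 \<noteq> v2 \<and> v1 \<noteq> v \<and> v2 \<noteq> v)
     \<and> (\<forall>u v. edge E u v \<longrightarrow> (\<exists>c. check_hole E c \<and> {last c, hd c} = {u, v}))"

context unichord_free_graph
begin

text \<open>Replacing the edge \<open>xy\<close> of the hole by the ear gives a cycle in which
  \<open>xy\<close> is the only chord.\<close>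

lemma hole_ear:
  assumes cyc: "is_cycle V adj c"
    and hole: "\<And>x y. x \<in> set c \<Longrightarrow> y \<in> set c \<Longrightarrow> adj x y \<Longrightarrow> consec (c @ [hd c]) x y"
    and xy: "consec (c @ [hd c]) x y" and ds: "attached (set c) ds x y"
  shows False
proof -
  obtain r where r: "is_cycle V adj r" "set r = set c"
    "\<And>a b. consec (r @ [hd r]) a b \<longleftrightarrow> consec (c @ [hd c]) a b"
    "last r = x \<and> hd r = y \<or> last r = y \<and> hd r = x"
    using rotate_cycle[OF cyc xy] by metis
  \<comment> \<open>The rotation makes \<open>xy\<close> the closing edge only up to direction; the
    ear is turned to run from \<open>last r\<close> to \<open>hd r\<close>.\<close>
  define es where "es = (if last r = x \<and> hd r = y then ds else rev ds)"
  have es: "attached (set r) es (last r) (hd r)"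
    unfolding es_def using ds attached_rev[OF ds] r(2,4) by auto
  have rc: "distinct r" "3 \<le> length r" "set r \<subseteq> V" "successively adj (r @ [hd r])"
    using r(1) by (auto simp: is_cycle_eq)
  have ne: "r \<noteq> []" "es \<noteq> []" using rc es by (auto simp: attached_def)
  have e: "distinct es" "successively adj es" "set es \<inter> set r = {}" "set es \<subseteq> V"
    using es by (auto simp: attached_def ipath_def)
  have ei: "consec es a b" if "a \<in> set es" "b \<in> set es" "adj a b" for a b
    using es that by (auto simp: attached_def ipath_def)
  have ea: "adj d z \<longleftrightarrow> d = hd es \<and> z = last r \<or> d = last es \<and> z = hd r" if "d \<in> set es" "z \<in> set r" for d z
    using es that by (auto simp: attached_def)
  have cc: "consec ((r @ es) @ [hd (r @ es)]) a b \<longleftrightarrow>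
      consec r a b \<or> consec es a b \<or> {a, b} = {last r, hd es} \<or> {a, b} = {last es, hd r}" for a b
    using ne by (auto simp: consec_append)
  have cr: "consec (r @ [hd r]) a b \<longleftrightarrow> consec r a b \<or> {a, b} = {last r, hd r}" for a b
    using ne by (auto simp: consec_append)
  have lr: "last r \<in> set r" "hd r \<in> set r" "hd es \<in> set es" "last es \<in> set es" using ne by auto
  have adjlast: "adj (last r) (hd r)"
    using rc(4) unfolding successively_iff_consec cr by blast
  have "is_cycle V adj (r @ es)"
    unfolding is_cycle_eq
  proof (intro conjI)
    show "successively adj ((r @ es) @ [hd (r @ es)])"
      unfolding successively_iff_consec cc
    proof (intro allI impI)
      fix a b assume "consec r a b \<or> consec es a b \<or> {a, b} = {last r, hd es} \<or> {a, b} = {last es, hd r}"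
      moreover have "adj (last r) (hd es)" "adj (last es) (hd r)"
        using ea[of "hd es" "last r"] ea[of "last es" "hd r"] lr adj_sym by auto
      ultimately show "adj a b"
        using rc(4) e(2) adj_sym unfolding successively_iff_consec cr by (auto simp: doubleton_eq_iff)
    qed
  qed (use rc e in auto)
  then show False
  proof (rule no_unichord)
    show "last r \<in> set (r @ es)" "hd r \<in> set (r @ es)" "adj (last r) (hd r)" using lr adjlast by auto
    have "hd r \<notin> set es" "last r \<notin> set es" using lr e(3) by auto
    then show "\<not> consec ((r @ es) @ [hd (r @ es)]) (last r) (hd r)"
      unfolding cc using not_consec_last_hd[OF rc(1,2)] consec_in_set[of es "last r" "hd r"] lr
      by (auto simp: doubleton_eq_iff)
    fix a b assume ab: "a \<in> set (r @ es)" "b \<in> set (r @ es)" "adj a b"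
    have mixed: "{d, z} = {last r, hd es} \<or> {d, z} = {last es, hd r}" if "d \<in> set es" "z \<in> set r" "adj d z" for d z
      using ea[OF that(1,2)] that(3) by auto
    show "consec ((r @ es) @ [hd (r @ es)]) a b \<or> {a, b} = {last r, hd r}"
    proof (cases "a \<in> set es")
      case True
      show ?thesis
      proof (cases "b \<in> set es")
        case True
        then show ?thesis using ei \<open>a \<in> set es\<close> ab(3) unfolding cc by blast
      next
        case False
        then show ?thesis using mixed[of a b] True ab unfolding cc by auto
      qed
    next
      case False
      then have a: "a \<in> set r" using ab by auto
      show ?thesis
      proof (cases "b \<in> set es")
        case True
        then show ?thesis using mixed[of b a] a adj_sym[OF ab(3)] unfolding cc by (auto simp: insert_commute)
      next
        case False
        then have "b \<in> set r" using ab by auto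
        then have "consec (r @ [hd r]) a b" using hole[of a b] a ab(3) r(2,3) by auto
        then show ?thesis unfolding cr cc by blast
      qed
    qed
  qed
qed

end

context tsf_graph
begin

lemma emb_hole:
  assumes "emb n E f I" "check_hole E c"
  shows "is_cycle V adj (real_cycle f I c)"
    and "x \<in> set (real_cycle f I c) \<Longrightarrow> y \<in> set (real_cycle f I c) \<Longrightarrow> adj x y \<Longrightarrow>
        consec (real_cycle f I c @ [hd (real_cycle f I c)]) x y"
    and "set (real_cycle f I c) \<subseteq> img n E f I"
    and "(u, v) \<in> set (cpairs c) \<Longrightarrow> consec (spath f I u v) a b \<Longrightarrow>
        consec (real_cycle f I c @ [hd (real_cycle f I c)]) a b"
    and "(u, v) \<in> set (cpairs c) \<Longrightarrow> set (spath f I u v) \<subseteq> set (real_cycle f I c)"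
proof -
  have chk: "check_cyc E c" "free_edges E c = []" using assms(2) by (auto simp: check_hole_def)
  show "is_cycle V adj (real_cycle f I c)" by (rule real_cycle_is_cycle[OF assms(1) chk(1)])
  show "x \<in> set (real_cycle f I c) \<Longrightarrow> y \<in> set (real_cycle f I c) \<Longrightarrow> adj x y \<Longrightarrow>
        consec (real_cycle f I c @ [hd (real_cycle f I c)]) x y"
    using real_cycle_chord[OF assms(1) chk(1)] chk(2) by auto
  show con: "(u, v) \<in> set (cpairs c) \<Longrightarrow> consec (spath f I u v) a b \<Longrightarrow>
        consec (real_cycle f I c @ [hd (real_cycle f I c)]) a b" for a b
    using consec_real_cycle[OF assms(1) chk(1)] by blast
  have ne: "real_cycle f I c \<noteq> []"
    using real_cycle_is_cycle[OF assms(1) chk(1)] by (auto simp: is_cycle_eq)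
  have e: "edge E u v" if "(u, v) \<in> set (cpairs c)" for u v
    using chk(1) that by (auto simp: check_cyc_def)
  have inr: "x \<in> set (real_cycle f I c)" if "consec (real_cycle f I c @ [hd (real_cycle f I c)]) x y" for x y
    using consec_in_set[OF that] ne by auto
  show "set (spath f I u v) \<subseteq> set (real_cycle f I c)" if uv: "(u, v) \<in> set (cpairs c)"
  proof
    fix x assume "x \<in> set (spath f I u v)"
    then obtain i where i: "i < length (spath f I u v)" "x = spath f I u v ! i" by (metis in_set_conv_nth)
    have len: "2 \<le> length (spath f I u v)" by (simp add: spath_def)
    have "\<exists>y. consec (spath f I u v) x y"
    proof (cases "Suc i < length (spath f I u v)")
      case True then show ?thesis using i unfolding consec_def by blast
    next
      case False
      then have "Suc (i - 1) < length (spath f I u v)" "Suc (i - 1) = i" using i len by auto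
      then show ?thesis using i unfolding consec_def by metis
    qed
    then show "x \<in> set (real_cycle f I c)" using con[OF uv] inr by blast
  qed
  show "set (real_cycle f I c) \<subseteq> img n E f I"
  proof
    fix x assume x: "x \<in> set (real_cycle f I c)"
    have "\<exists>y. consec (real_cycle f I c @ [hd (real_cycle f I c)]) x y"
    proof -
      obtain A B where "real_cycle f I c = A @ x # B" using x by (meson split_list)
      then show ?thesis by (cases B) (auto simp: consec_append consec_Cons)
    qed
    then obtain a b y where "(a, b) \<in> set (cpairs c)" "consec (spath f I a b) x y"
      using consec_real_cycle[OF assms(1) chk(1)] by blast
    then show "x \<in> img n E f I" using spath_img[OF assms(1) e, of a b] consec_in_set[of "spath f I a b" x y] by auto
  qed
qed

lemma img_bad_single:
  assumes "covered n E" "x \<in> img n E f I" "T \<subseteq> {x}"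
  shows "\<not> bad E f I T"
proof -
  have "\<exists>u v. edge E u v \<and> x \<in> set (spath f I u v)"
    using assms(1,2) unfolding img_def covered_def set_spath by blast
  then show ?thesis using assms(3) unfolding bad_def by blast
qed

text \<open>Interiors are disjoint from each other and from the skeleton vertices, so no other path
  can provide an edge at an inner vertex.\<close>

lemma consec_path_img:
  assumes emb: "emb n E f I" and e: "edge E u v" and z: "z \<in> set (I u v)" and t: "t \<in> img n E f I"
  shows "adj z t \<longleftrightarrow> consec (spath f I u v) z t"
proof -
  have z': "z \<in> img n E f I" using z e by (auto simp: img_def)
  have "{a, b} = {u, v}" if ab: "edge E a b" "consec (spath f I a b) z t" for a b
  proof (rule ccontr)
    assume ne: "{a, b} \<noteq> {u, v}"
    have "z \<in> set (spath f I a b)" using consec_in_set[OF ab(2)] by simp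
    moreover have "z \<notin> f ` {..<n}" using emb_edge[OF emb e] z by auto
    ultimately have "z \<in> set (I a b)" using emb_edge[OF emb ab(1)] by (auto simp: set_spath)
    then show False using emb_disj[OF emb ab(1) e ne] z by auto
  qed
  then show ?thesis
    unfolding emb_adj[OF emb z' t] using e spath_rev[OF emb e] by (metis consec_rev doubleton_eq_iff)
qed

text \<open>The part \<open>B\<close> of the path is replaced by the ear. As the ear sees the image
  only at \<open>x\<close> and \<open>y\<close>, the result is induced, and since its interior is
  nonempty all labels of \<open>E\<close> remain valid.\<close>

lemma reroute:
  assumes emb: "emb n E f I" and e: "edge E u v" and l: "(u, v, Unit) \<notin> set E \<and> (v, u, Unit) \<notin> set E"
    and ds: "attached (img n E f I) ds x y"
    and P: "spath f I u v = A @ x # B @ y # D" and B: "B \<noteq> []"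
  obtains J where "emb n E f (upd I u v J)" "f u # J @ [f v] = A @ x # ds @ y # D"
    "img n E f (upd I u v J) = (img n E f I - set (I u v)) \<union> set J"
proof -
  define P' where "P' = A @ x # ds @ y # D"
  note uv = emb_edge[OF emb e]
  have hdl: "hd (A @ x # B @ y # D) = f u" "last (A @ x # B @ y # D) = f v"
    using arg_cong[OF P, of hd] arg_cong[OF P, of last] by (simp_all add: spath_def)
  have dsp: "ds \<noteq> []" "distinct ds" "successively adj ds" "set ds \<inter> img n E f I = {}" "set ds \<subseteq> V"
    using ds by (auto simp: attached_def ipath_def)
  have P'ends: "hd P' = f u" "last P' = f v"
    using hdl by (cases A; cases D rule: rev_cases; auto simp: P'_def)+
  obtain J where J: "P' = f u # J @ [f v]" "J \<noteq> []"
  proof -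
    have "3 \<le> length P'" using dsp(1) by (cases ds) (auto simp: P'_def)
    from ends_butlast_tl[OF this] show ?thesis using that P'ends by metis
  qed
  have dP: "distinct (A @ x # B @ y # D)" using emb_path(2)[OF emb e] P by simp
  have sP: "set (A @ x # B @ y # D) \<subseteq> img n E f I" using spath_img[OF emb e] P by simp
  have dP': "distinct P'" using dP sP dsp unfolding P'_def by auto
  have ne: "I u v \<noteq> []" using P B by (auto simp: spath_def Cons_eq_append_conv)
  have IP: "set (I u v) = set (A @ x # B @ y # D) - {f u, f v}"
    using emb_path(2)[OF emb e] unfolding P[symmetric] by (auto simp: spath_def)
  have JP: "set J = set P' - {f u, f v}" using dP' unfolding J(1) by auto
  have BI: "set B \<subseteq> set (I u v)"
  proof
    fix b assume b: "b \<in> set B"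
    have "b \<noteq> hd (A @ x # B @ y # D)" using b dP by (cases A) auto
    moreover have "b \<noteq> last (A @ x # B @ y # D)" using b dP last_in_set[of D] by (auto split: if_splits)
    ultimately show "b \<in> set (I u v)" using b hdl unfolding IP by auto
  qed
  have Jsub: "z \<in> set ds \<or> z \<in> set (I u v) - set B" if "z \<in> set J" for z
    using that dP unfolding JP IP P'_def by auto
  \<comment> \<open>The whole path is taken out and the new interior \<open>J\<close> is put in with
    \<open>emb_place\<close>, so that only adjacencies at \<open>J\<close> have to be
    computed.\<close>
  have emb0: "emb n (drop_edge u v E) f I"
    and img0: "img n (drop_edge u v E) f I = img n E f I - set (I u v)"
    using emb_drop[OF emb e ne] by auto
  have c': "consec P' z t \<longleftrightarrow> consec (A @ [x]) z t \<or> consec (x # ds @ [y]) z t \<or> consec (y # D) z t" for z t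
    unfolding P'_def using consec_append[of A "x # ds @ y # D" z t] consec_append[of A "[x]" z t]
      consec_glue[of x ds y D z t] by auto
  have c: "consec (A @ x # B @ y # D) z t \<longleftrightarrow> consec (A @ [x]) z t \<or> consec (x # B @ [y]) z t \<or> consec (y # D) z t" for z t
    using consec_append[of A "x # B @ y # D" z t] consec_append[of A "[x]" z t]
      consec_glue[of x B y D z t] by auto
  have xyW: "x \<in> img n E f I" "y \<in> img n E f I" using sP by auto
  have AxyD: "set (A @ [x]) \<inter> set ds = {}" "set (y # D) \<inter> set ds = {}" using sP dsp by auto
  have dsadj: "adj d s \<longleftrightarrow> consec P' d s" if d: "d \<in> set ds" and s: "s \<in> img n E f I \<union> set ds" for d s
  proof -
    have "\<not> consec (A @ [x]) d s" "\<not> consec (y # D) d s" using consec_in_set[of _ d s] AxyD d by blast+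
    then show ?thesis unfolding c' attached_consec[OF ds xyW d s] by simp
  qed
  have adjJ: "adj z t \<longleftrightarrow> consec P' z t"
    if zt: "z \<in> set J" "t \<in> img n (drop_edge u v E) f I \<union> set J" for z t
  proof -
    show ?thesis
    proof (cases "z \<in> set ds")
      case True
      have "t \<in> img n E f I \<union> set ds"
        using zt(2) Jsub[of t] sP P unfolding img0 IP by auto
      then show ?thesis using dsadj[OF True] by blast
    next
      case z: False
      then have zI: "z \<in> set (I u v)" "z \<notin> set B" using Jsub[OF zt(1)] by auto
      then have zimg: "z \<in> img n E f I" using e by (auto simp: img_def)
      show ?thesis
      proof (cases "t \<in> set ds")
        case True
        then have "adj t z \<longleftrightarrow> consec P' t z" using dsadj[OF True, of z] zimg by simp
        then show ?thesis using adj_commute[of t z] consec_commute[of P' t z] by simp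
      next
        case False
        have tB: "t \<notin> set B" "t \<in> img n E f I"
          using zt(2) Jsub[of t] False BI sP unfolding img0 IP by auto
        have "\<not> consec (x # B @ [y]) z t" using consec_inner[OF _ B, of x y z t] zI tB by blast
        moreover have "\<not> consec (x # ds @ [y]) z t" using consec_inner[OF _ dsp(1), of x y z t] z False by blast
        ultimately have "consec P' z t \<longleftrightarrow> consec (A @ x # B @ y # D) z t" unfolding c c' by blast
        then show ?thesis using consec_path_img[OF emb e zI(1) tB(2)] P by simp
      qed
    qed
  qed
  have dj: "set J \<inter> img n (drop_edge u v E) f I = {}"
    unfolding img0 using Jsub dsp(4) by blast
  have JV: "set J \<subseteq> V"
  proof
    fix z assume "z \<in> set J"
    then show "z \<in> V" using Jsub[of z] dsp(5) emb_V[OF emb] sP unfolding IP by auto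
  qed
  have pl: "emb n ((u, v, Long) # drop_edge u v E) f (upd I u v J)"
    "img n ((u, v, Long) # drop_edge u v E) f (upd I u v J) = img n (drop_edge u v E) f I \<union> set J"
    using emb_place[OF emb0 _ _ _ _ J(2) _ JV dj] uv adjJ dP' unfolding J(1)
    by (auto simp: edge_drop_edge)
  have eq: "edge ((u, v, Long) # drop_edge u v E) a b \<longleftrightarrow> edge E a b" for a b
  proof -
    have "edge ((u, v, Long) # F) a b \<longleftrightarrow> {a, b} = {u, v} \<or> edge F a b" for F
      by (auto simp: edge_def doubleton_eq_iff)
    moreover have "edge E a b" if "{a, b} = {u, v}"
      using that e edge_commute by (auto simp: doubleton_eq_iff)
    ultimately show ?thesis using edge_drop_edge by blast
  qed
  \<comment> \<open>\<open>emb_place\<close> leaves the edge at the front with label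
    \<open>Long\<close>; relabelling restores the original list \<open>E\<close>.\<close>
  have "emb n E f (upd I u v J)"
  proof (rule emb_relabel[OF pl(1)])
    show "edge E a b \<longleftrightarrow> edge ((u, v, Long) # drop_edge u v E) a b" for a b using eq by simp
    show "upd I u v J a b = []" if "(a, b, Unit) \<in> set E" for a b
    proof -
      have "{a, b} \<noteq> {u, v}" using that l by (auto simp: doubleton_eq_iff)
      then show ?thesis using upd_other emb_Unit[OF emb that] by metis
    qed
    show "upd I u v J a b \<noteq> []" if "(a, b, Long) \<in> set E" for a b
      using emb_Long[OF emb that] J(2) by (auto simp: upd_def)
  qed
  moreover have "img n E f (upd I u v J) = (img n E f I - set (I u v)) \<union> set J"
    using pl(2) unfolding img_def eq img0[unfolded img_def, symmetric] .
  ultimately show ?thesis using that J(1) unfolding P'_def by simp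
qed

end

context graph
begin

lemma att_mono: "C \<subseteq> D \<Longrightarrow> att W C \<subseteq> att W D"
  unfolding att_def by blast

text \<open>Take a shortest walk in \<open>C\<close> whose ends see two different vertices of
  \<open>W\<close>. If it has several vertices, a neighbour in \<open>W\<close> beyond the two
  chosen ones would allow a shorter walk, so it is an ear. A walk of one vertex may have more
  neighbours, hence the separate alternative.\<close>

lemma attached_walk:
  assumes C: "conn_set C" "C \<subseteq> V - W" and xy: "x \<in> att W C" "y \<in> att W C" "x \<noteq> y"
  obtains d x' y' where "d \<in> C" "x' \<noteq> y'" "{x', y'} \<subseteq> att W {d}"
  | ds x' y' where "set ds \<subseteq> C" "attached W ds x' y'" "x' \<noteq> y'" "x' \<in> W" "y' \<in> W"
proof -
  define R where "R a b \<longleftrightarrow> (\<exists>x y. x \<in> W \<and> y \<in> W \<and> x \<noteq> y \<and> adj a x \<and> adj b y)" for a b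
  obtain c d where cd: "c \<in> C" "d \<in> C" "adj c x" "adj d y" "x \<in> W" "y \<in> W"
    using xy unfolding att_def by blast
  obtain q where q: "walk C q" "hd q = c" "last q = d" using C(1) cd unfolding conn_set_def by blast
  have "R (hd q) (last q)" unfolding R_def using q cd xy(3) by blast
  then obtain p where p: "walk C p" "R (hd p) (last p)" "ipath p"
    and min: "\<And>p'. walk C p' \<Longrightarrow> R (hd p') (last p') \<Longrightarrow> length p \<le> length p'"
    using minimal_walk[OF q(1), of R] by metis
  obtain s t where st: "s \<in> W" "t \<in> W" "s \<noteq> t" "adj (hd p) s" "adj (last p) t"
    using p(2) unfolding R_def by blast
  have pne: "p \<noteq> []" "set p \<subseteq> C" using p(1) by (auto simp: walk_def)
  show thesis
  proof (cases "length p = 1")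
    case True
    then have "hd p = last p" "hd p \<in> C" using pne by (cases p; auto)+
    then show ?thesis using that(1)[of "hd p" s t] st unfolding att_def by auto
  next
    case False
    have only: "d = hd p \<and> z = s \<or> d = last p \<and> z = t" if d: "d \<in> set p" and z: "z \<in> W" "adj d z" for d z
    proof -
      obtain a b where ab: "p = a @ d # b" using d by (meson split_list)
      have "a = [] \<or> z = t"
      proof (rule ccontr)
        assume n: "\<not> (a = [] \<or> z = t)"
        have "walk C (d # b)" using p(1) walk_appendD2[of C a "d # b"] ab by simp
        moreover have "R (hd (d # b)) (last (d # b))"
          unfolding R_def using z st n ab by (intro exI[of _ z] exI[of _ t]) auto
        ultimately have "length p \<le> length (d # b)" by (rule min)
        then show False using ab n by simp
      qed
      moreover have "b = [] \<or> z = s"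
      proof (rule ccontr)
        assume n: "\<not> (b = [] \<or> z = s)"
        have "walk C (a @ [d])" using p(1) walk_appendD1[of C "a @ [d]" b] ab by simp
        moreover have "R (hd (a @ [d])) (last (a @ [d]))"
          unfolding R_def using z st n ab by (intro exI[of _ s] exI[of _ z]) (cases a; auto)
        ultimately have "length p \<le> length (a @ [d])" by (rule min)
        then show False using ab n by simp
      qed
      moreover have "a \<noteq> [] \<or> b \<noteq> []" using False ab by auto
      ultimately show ?thesis using st(3) ab by auto
    qed
    have "attached W p s t"
      unfolding attached_def using only st p(3) pne C(2) by blast
    then show ?thesis using that(2)[of p s t] st pne by blast
  qed
qed

text \<open>If at most one vertex \<open>x\<close> of \<open>W\<close> were attached,
  \<open>x\<close> would separate the component from the rest; the two vertices \<open>a\<close> and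
  \<open>b\<close> ensure that something is left on the other side.\<close>

lemma two_attachments:
  assumes no: "\<not> has_1_cutset V adj" and W: "W \<subseteq> V" "a \<in> W" "b \<in> W" "a \<noteq> b" and w: "w \<in> V - W"
  obtains x y where "x \<in> att W (comp (V - W) w)" "y \<in> att W (comp (V - W) w)" "x \<noteq> y"
proof -
  let ?C = "comp (V - W) w"
  have Csub: "?C \<subseteq> V - W" by (rule comp_subset)
  have "\<not> att W ?C \<subseteq> {x}" if x: "x \<in> W" for x
  proof
    assume sub: "att W ?C \<subseteq> {x}"
    have "has_1_cutset V adj"
      unfolding has_1_cutset_def
    proof (intro exI conjI)
      show "x \<in> V" using x W by blast
      show "?C \<union> (V - {x} - ?C) = V - {x}" using Csub x by blast
      show "?C \<inter> (V - {x} - ?C) = {}" by blast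
      show "?C \<noteq> {}" using comp_self[OF w] by blast
      show "V - {x} - ?C \<noteq> {}" using W Csub by blast
      show "\<forall>c\<in>?C. \<forall>d\<in>V - {x} - ?C. \<not> adj c d"
      proof (intro ballI notI)
        fix c d assume cd: "c \<in> ?C" "d \<in> V - {x} - ?C" "adj c d"
        show False
        proof (cases "d \<in> W")
          case True then show False using sub cd unfolding att_def by blast
        next
          case False then show False using comp_closed[OF cd(1,3)] cd(2) by blast
        qed
      qed
    qed
    then show False using no by blast
  qed
  then have "\<not> att W ?C \<subseteq> {a}" using W by blast
  then obtain x where x: "x \<in> att W ?C" by blast
  then have "x \<in> W" by (simp add: att_def)
  then obtain y where "y \<in> att W ?C" "y \<noteq> x" using \<open>\<And>x. x \<in> W \<Longrightarrow> \<not> att W ?C \<subseteq> {x}\<close> by blast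
  then show ?thesis using that x by blast
qed

lemma walk_crossing:
  "successively R q \<Longrightarrow> q \<noteq> [] \<Longrightarrow> hd q \<in> A \<Longrightarrow> last q \<in> B \<Longrightarrow> A \<inter> B = {} \<Longrightarrow> set q \<subseteq> A \<union> B
    \<Longrightarrow> \<exists>x\<in>A. \<exists>y\<in>B. R x y"
proof (induction q)
  case (Cons a q)
  then show ?case by (cases q) (auto split: if_splits)
qed simp

end

context tsf_graph
begin

lemma covered_hole:
  assumes emb: "emb n E f I" and cov: "covered n E" and e: "edge E u v"
  obtains c where "check_hole E c" "set (spath f I u v) \<subseteq> set (real_cycle f I c)"
    "\<And>x y. consec (spath f I u v) x y \<Longrightarrow> consec (real_cycle f I c @ [hd (real_cycle f I c)]) x y"
proof -
  obtain c where c: "check_hole E c" "{last c, hd c} = {u, v}"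
    using cov e unfolding covered_def by blast
  have "c \<noteq> []" using c(1) by (auto simp: check_hole_def check_cyc_def)
  then have pr: "(last c, hd c) \<in> set (cpairs c)"
    unfolding cpairs_def by (cases c rule: rev_cases; cases c) (auto simp: zip_append1)
  have "spath f I u v = spath f I (last c) (hd c) \<or> spath f I u v = rev (spath f I (last c) (hd c))"
    using c(2) spath_rev[OF emb e] by (auto simp: doubleton_eq_iff)
  then show ?thesis
    using that[of c] c(1) emb_hole(4,5)[OF emb c(1) pr] by auto
qed

text \<open>The path lies on a hole inside the image, and \<open>hole_nbrs\<close> applies to that
  hole.\<close>

lemma card_att_spath:
  assumes emb: "emb n E f I" and cov: "covered n E" and e: "edge E u v" and d: "d \<notin> img n E f I"
    and sub: "att (img n E f I) {d} \<subseteq> set (spath f I u v)"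
  shows "card (att (img n E f I) {d}) \<le> 2"
proof -
  obtain c where c: "check_hole E c" "set (spath f I u v) \<subseteq> set (real_cycle f I c)"
    using covered_hole[OF emb cov e] by metis
  then show ?thesis
    using hole_nbrs[OF emb_hole(1)[OF emb c(1)] emb_hole(2)[OF emb c(1)], of d "att (img n E f I) {d}"]
      sub d emb_hole(3)[OF emb c(1)] unfolding att_def by blast
qed

text \<open>The edge \<open>xy\<close> lies on a hole inside the image, so \<open>hole_ear\<close>
  applies.\<close>

lemma no_ear_at_consec:
  assumes emb: "emb n E f I" and cov: "covered n E" and e: "edge E u v"
    and xy: "consec (spath f I u v) x y" and ds: "attached (img n E f I) ds x y"
  shows False
proof -
  obtain c where c: "check_hole E c" "consec (real_cycle f I c @ [hd (real_cycle f I c)]) x y"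
    using covered_hole[OF emb cov e] xy by metis
  then show False
    using hole_ear[OF emb_hole(1)[OF emb c(1)] emb_hole(2)[OF emb c(1)]]
      attached_mono[OF ds emb_hole(3)[OF emb c(1)]] by blast
qed

text \<open>A smallest bad connected set C is an ear or a vertex: a shortest walk in C between two attachments
  either is bad itself, or ends in one segment. In the second case the segment is rerouted through the
  walk, and what is left of C is bad for the new embedding.\<close>

lemma bad_component:
  assumes cov: "covered n E" and emb: "emb n E f I" and C: "conn_set C" "C \<subseteq> V - img n E f I"
    and bad: "bad E f I (att (img n E f I) C)"
  shows "\<exists>f I. emb n E f I \<and> ((\<exists>w\<in>V - img n E f I. bad E f I (att (img n E f I) {w}))
      \<or> (\<exists>ds x y. attached (img n E f I) ds x y \<and> x \<in> img n E f I \<and> y \<in> img n E f I \<and> bad E f I {x, y}))"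
  using emb C bad
proof (induction "card C" arbitrary: f I C rule: less_induct)
  case less
  note emb = less(2) and C = less(3,4) and bad = less(5)
  let ?W = "img n E f I"
  have finC: "finite C" using C(2) finV by (meson finite_Diff finite_subset)
  have "f 0 \<in> ?W" using cov unfolding covered_def img_def by simp
  then have "\<not> (\<exists>x. att ?W C \<subseteq> {x})"
  proof -
    have False if "att ?W C \<subseteq> {x}" for x
    proof (cases "x \<in> ?W")
      case True then show False using img_bad_single[OF cov True that] bad by simp
    next
      case False
      then have "att ?W C \<subseteq> {x'}" for x' using that unfolding att_def by auto
      then show False using img_bad_single[OF cov \<open>f 0 \<in> ?W\<close>] bad by blast
    qed
    then show ?thesis by blast
  qed
  then obtain x0 y0 where xy0: "x0 \<in> att ?W C" "y0 \<in> att ?W C" "x0 \<noteq> y0" by blast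
  \<comment> \<open>A bad ear is already a result. Otherwise both of its ends lie on one path, which
    is rerouted through it.\<close>
  have main: ?case if ds: "set ds \<subseteq> C" "attached ?W ds x y" "x \<noteq> y" "x \<in> ?W" "y \<in> ?W" for ds x y
  proof (cases "bad E f I {x, y}")
    case True
    then show ?thesis using emb ds by blast
  next
    case False
    then obtain u v where e: "edge E u v" and uv: "x \<in> set (spath f I u v)" "y \<in> set (spath f I u v)"
      unfolding bad_def by auto
    have dist: "distinct (spath f I u v)" using emb_path(2)[OF emb e] .
    obtain x' y' ds' A B D where P: "spath f I u v = A @ x' # B @ y' # D"
      and ds': "attached ?W ds' x' y'" "set ds' = set ds"
    proof -
      obtain A R where AR: "spath f I u v = A @ x # R" using uv(1) by (meson split_list)
      then have "y \<in> set A \<or> y \<in> set R" using uv(2) ds(3) by auto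
      then show ?thesis
      proof
        assume "y \<in> set R"
        then obtain B D where "R = B @ y # D" by (meson split_list)
        then show ?thesis using that[of A x B y D ds] AR ds(2) by simp
      next
        assume "y \<in> set A"
        then obtain B D where "A = B @ y # D" by (meson split_list)
        then show ?thesis using that[of B y D x R "rev ds"] AR attached_rev[OF ds(2)] by simp
      qed
    qed
    have B: "B \<noteq> []"
      using no_ear_at_consec[OF emb cov e _ ds'(1)] P by (auto simp: consec_append consec_Cons)
    have xyP: "x' \<in> set (spath f I u v)" "y' \<in> set (spath f I u v)" using P by auto
    have "I u v \<noteq> []" using P B by (auto simp: spath_def Cons_eq_append_conv)
    then have nu: "(u, v, Unit) \<notin> set E \<and> (v, u, Unit) \<notin> set E"
      using emb_Unit[OF emb] emb_edge[OF emb e] by auto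
    obtain J where J: "emb n E f (upd I u v J)" "f u # J @ [f v] = A @ x' # ds' @ y' # D"
      "img n E f (upd I u v J) = (?W - set (I u v)) \<union> set J"
      using reroute[OF emb e nu ds'(1) P B] .
    let ?I = "upd I u v J" and ?W' = "img n E f (upd I u v J)"
    have dsne: "ds' \<noteq> []" "set ds' \<inter> ?W = {}" using ds'(1) by (auto simp: attached_def)
    have setJ: "set (f u # J @ [f v]) = set A \<union> {x', y'} \<union> set D \<union> set ds'" unfolding J(2) by auto
    have Psub: "set A \<union> {x', y'} \<union> set D \<subseteq> set (spath f I u v)" using P by auto
    have PW: "set (spath f I u v) \<subseteq> ?W" by (rule spath_img[OF emb e])
    have "set J \<subseteq> set (f u # J @ [f v])" by auto
    then have "set J \<subseteq> set (spath f I u v) \<union> set ds'" unfolding setJ using Psub by auto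
    then have W'sub: "?W' \<subseteq> ?W \<union> set ds'" unfolding J(3) using PW by blast
    have fuvW: "f u \<in> ?W" "f v \<in> ?W" using PW by (auto simp: set_spath)
    have dsJ: "set ds' \<subseteq> set J"
    proof -
      have "set ds' \<subseteq> set (f u # J @ [f v])" unfolding setJ by blast
      moreover have "f u \<notin> set ds'" "f v \<notin> set ds'" using dsne(2) fuvW by blast+
      ultimately show ?thesis by auto
    qed
    have attds: "adj d z \<Longrightarrow> z \<in> {x', y'}" if "d \<in> set ds'" "z \<in> ?W" for d z
      using ds'(1) that unfolding attached_def by auto
    \<comment> \<open>Badness of \<open>C\<close> supplies an attachment \<open>t\<close> off the
      rerouted path. Its neighbour \<open>d\<close> is not on the ear, since the ear is attached
      only to that path, and so \<open>d\<close> survives in the smaller set.\<close>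
    have "\<not> att ?W C \<subseteq> set (spath f I u v)" using bad e unfolding bad_def by blast
    then obtain t d where t: "t \<in> ?W" "t \<notin> set (spath f I u v)" "d \<in> C" "adj d t"
      unfolding att_def by blast
    have dds: "d \<notin> set ds'" using attds[of d t] t xyP by auto
    define C' where "C' = comp (C - set ds') d"
    have C'sub: "C' \<subseteq> C - set ds'" unfolding C'_def by (rule comp_subset)
    have dC': "d \<in> C'" unfolding C'_def using comp_self t(3) dds by blast
    have "card C' < card C"
    proof (rule psubset_card_mono[OF finC])
      have "hd ds' \<in> C" using dsne ds(1) ds'(2) by auto
      then show "C' \<subset> C" using C'sub dsne hd_in_set[of ds'] by blast
    qed
    moreover have "conn_set C'" unfolding C'_def by (rule conn_set_comp)
    moreover have "C' \<subseteq> V - ?W'" using C'sub C(2) W'sub by blast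
    \<comment> \<open>Let \<open>e'\<close> be the first vertex of the ear on a walk from
      \<open>d\<close> to it. It is an inner vertex of the rerouted path and now an attachment, so
      the only segment that could contain all attachments is this path, and it misses
      \<open>t\<close>.\<close>
    moreover have "bad E f ?I (att ?W' C')"
    proof -
      have "t \<in> ?W'" using t(1,2) unfolding J(3) by (auto simp: set_spath)
      then have t': "t \<in> att ?W' C'" using t(4) dC' unfolding att_def by blast
      obtain p where p: "walk C p" "hd p = d" "last p = hd ds'"
        using C(1) t(3) dsne ds(1) ds'(2) unfolding conn_set_def by (metis hd_in_set subsetD)
      then have "\<exists>e\<in>set p. e \<in> set ds'" using dsne by (metis hd_in_set last_in_set walk_def)
      then obtain a e' b where abe: "p = a @ e' # b" "e' \<in> set ds'" "\<forall>z\<in>set a. z \<notin> set ds'"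
        using split_list_first_prop[of p "\<lambda>z. z \<in> set ds'"] by blast
      have ane: "a \<noteq> []" using abe p(2) dds by auto
      have wa: "walk C a" using p(1) abe ane walk_appendD1 by blast
      then have "walk (C - set ds') a" using abe(3) unfolding walk_def by auto
      then have "last a \<in> C'"
        unfolding C'_def comp_def using p(2) abe ane by (auto intro!: exI[of _ a])
      moreover have "adj (last a) e'"
        using p(1) abe ane by (auto simp: walk_def successively_append_iff)
      moreover have "e' \<in> ?W'" using abe(2) dsJ J(3) by auto
      ultimately have e'a: "e' \<in> att ?W' C'" unfolding att_def by blast
      have eJ: "e' \<in> set J" using abe(2) dsJ by auto
      show ?thesis
        unfolding bad_def
      proof
        assume "\<exists>u' v'. edge E u' v' \<and> att ?W' C' \<subseteq> set (spath f ?I u' v')"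
        then obtain u' v' where e2: "edge E u' v'" "att ?W' C' \<subseteq> set (spath f ?I u' v')" by blast
        have "e' \<notin> f ` {..<n}" using abe(2) dsne(2) by (auto simp: img_def)
        then have "e' \<in> set (?I u' v')"
          using e2 e'a emb_edge[OF J(1) e2(1)] by (auto simp: set_spath)
        moreover have "?I u v = J" by (rule upd_same)
        ultimately have "{u', v'} = {u, v}" using emb_disj[OF J(1) e2(1) e] eJ by auto
        then have "set (spath f ?I u' v') = set (spath f ?I u v)"
          using spath_rev[OF J(1) e] by (auto simp: doubleton_eq_iff)
        also have "\<dots> = set (f u # J @ [f v])" by (simp add: set_spath upd_same)
        also have "\<dots> \<subseteq> set (spath f I u v) \<union> set ds'" using setJ Psub by auto
        finally show False using e2(2) t' t(1,2) dsne(2) by auto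
      qed
    qed
    ultimately show ?thesis using less(1)[OF _ J(1)] by blast
  qed
  show ?case
  proof (rule attached_walk[OF C xy0])
    fix d x y assume d: "d \<in> C" "x \<noteq> y" "{x, y} \<subseteq> att ?W {d}"
    have dV: "d \<in> V - ?W" using d C by blast
    show ?case
    proof (cases "bad E f I (att ?W {d})")
      case True
      then show ?thesis using emb dV by blast
    next
      case False
      then obtain u v where e: "edge E u v" "att ?W {d} \<subseteq> set (spath f I u v)" unfolding bad_def by blast
      have "card (att ?W {d}) \<le> 2" using card_att_spath[OF emb cov e(1)] e(2) dV by blast
      moreover have fin: "finite (att ?W {d})"
        using finV emb_V[OF emb] unfolding att_def by (simp add: finite_subset)
      \<comment> \<open>With exactly two neighbours on the image, the single vertex \<open>d\<close>
        is an ear.\<close>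
      ultimately have eq: "att ?W {d} = {x, y}"
        using d(2,3) by (metis card_2_iff card_seteq)
      have "attached ?W [d] x y"
        unfolding attached_def ipath_def using dV eq unfolding att_def by auto
      then show ?thesis using main[of "[d]" x y] d unfolding att_def by auto
    qed
  next
    fix ds x y assume "set ds \<subseteq> C" "attached ?W ds x y" "x \<noteq> y" "x \<in> ?W" "y \<in> ?W"
    then show ?case using main by blast
  qed
qed

end

subsection \<open>Decomposition along unattached components\<close>

lemma set_expand_path:
  assumes "c \<noteq> []"
  shows "set (expand f I c @ [f (last c)]) = f ` set c \<union> (\<Union>(u, v)\<in>set (zip c (tl c)). set (I u v))"
proof -
  have "set c = set (butlast c) \<union> {last c}"
    using assms by (cases c rule: rev_cases) auto
  then show ?thesis unfolding set_append set_expand by auto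
qed

context graph
begin

lemma comp_trans: "y \<in> comp U x \<Longrightarrow> comp U y \<subseteq> comp U x"
proof
  fix z assume "y \<in> comp U x" "z \<in> comp U y"
  then obtain p q where p: "walk U p" "hd p = x" "last p = y" and q: "walk U q" "hd q = y" "last q = z"
    unfolding comp_def by blast
  show "z \<in> comp U x"
    unfolding comp_def using walk_join[OF p(1) q(1)] p q by (auto intro!: exI[of _ "p @ tl q"])
qed

lemma is_path_in_rev: "is_path_in adj W a b p \<Longrightarrow> is_path_in adj W b a (rev p)"
proof -
  assume p: "is_path_in adj W a b p"
  then have "successively adj p" unfolding is_path_in_def successively_conv_nth by blast
  then have "successively adj (rev p)" unfolding successively_iff_consec by simp
  then show ?thesis
    using p unfolding is_path_in_def successively_conv_nth by (auto simp: hd_rev last_rev)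
qed

lemma is_path_inI:
  "successively adj p \<Longrightarrow> distinct p \<Longrightarrow> set p \<subseteq> W \<Longrightarrow> p \<noteq> [] \<Longrightarrow> is_path_in adj W (hd p) (last p) p"
  unfolding is_path_in_def successively_conv_nth by auto

lemma induces_pathD:
  assumes "induces_path adj W a b"
  obtains p where "set p = W" "distinct p" "p \<noteq> []" "hd p = a" "last p = b"
    "\<And>x y. x \<in> W \<Longrightarrow> y \<in> W \<Longrightarrow> adj x y \<Longrightarrow> consec p x y"
proof -
  obtain p where p: "is_path_in adj W a b p" "set p = W"
    and ind: "\<forall>i j. i < length p \<and> j < length p \<and> adj (p ! i) (p ! j) \<longrightarrow> j = Suc i \<or> i = Suc j"
    using assms unfolding induces_path_def by blast
  have "consec p x y" if xy: "x \<in> W" "y \<in> W" "adj x y" for x y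
  proof -
    obtain i j where "i < length p" "x = p ! i" "j < length p" "y = p ! j"
      using xy p(2) by (metis in_set_conv_nth)
    then show ?thesis using ind xy(3) unfolding consec_def by blast
  qed
  then show ?thesis using that[of p] p unfolding is_path_in_def by blast
qed

end

context tsf_graph
begin

text \<open>One side of the cutset consists of the interior of a path and everything attached only
  to that path, the other of the rest. The outside vertex \<open>w\<close> keeps the first side from
  being a path, and the degrees of the skeleton do this for the second.\<close>

lemma unattached_cutset:
  assumes cov: "covered n E" and emb: "emb n E f I" and w: "w \<in> V - img n E f I"
    and nb: "\<And>C. conn_set C \<Longrightarrow> C \<subseteq> V - img n E f I \<Longrightarrow> \<not> bad E f I (att (img n E f I) C)"
  shows "has_1_cutset V adj \<or> has_proper_2_cutset V adj"
proof -
  let ?W = "img n E f I"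
  define K where "K z = comp (V - ?W) z" for z
  have Knc: "conn_set (K z)" and Ksub: "K z \<subseteq> V - ?W" for z
    unfolding K_def using conn_set_comp comp_subset by blast+
  have Kself: "z \<in> V - ?W \<Longrightarrow> z \<in> K z" for z unfolding K_def by (rule comp_self)
  have Kclosed: "y \<in> K z" if "x \<in> K z" "adj x y" "y \<notin> ?W" for x y z
    unfolding K_def by (rule comp_closed[OF that(1)[unfolded K_def] that(2)]) (use that adjV in auto)
  have Ktrans: "y \<in> K x \<Longrightarrow> K y \<subseteq> K x" for x y unfolding K_def by (rule comp_trans)
  have n4: "4 \<le> n" using cov by (simp add: covered_def)
  have WV: "?W \<subseteq> V" by (rule emb_V[OF emb])
  have fW: "f i \<in> ?W" if "i < n" for i using that by (auto simp: img_def)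
  have finj: "f i = f j \<longleftrightarrow> i = j" if "i < n" "j < n" for i j
    using emb_inj[OF emb] that by (auto simp: inj_on_def)
  show ?thesis
  proof (cases "has_1_cutset V adj")
    case no1: False
    have "f 0 \<noteq> f 1" using finj[of 0 1] n4 by simp
    moreover have "f 0 \<in> ?W" "f 1 \<in> ?W" using fW n4 by auto
    ultimately obtain x0 y0 where xy0: "x0 \<in> att ?W (K w)" "y0 \<in> att ?W (K w)" "x0 \<noteq> y0"
      using two_attachments[OF no1 WV _ _ _ w] unfolding K_def by metis
    have "\<not> bad E f I (att ?W (K w))" using nb Knc Ksub by blast
    then obtain u v where e: "edge E u v" and attw: "att ?W (K w) \<subseteq> set (spath f I u v)"
      unfolding bad_def by blast
    note uv = emb_edge[OF emb e]
    let ?P = "spath f I u v"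
    have PW: "set ?P \<subseteq> ?W" by (rule spath_img[OF emb e])
    \<comment> \<open>Otherwise all attachments of the component of \<open>w\<close> are the ends of
      one edge, which gives a triangle or an ear on an edge of a hole.\<close>
    have ne: "I u v \<noteq> []"
    proof
      assume I: "I u v = []"
      then have P: "set ?P = {f u, f v}" "consec ?P (f u) (f v)" by (auto simp: spath_def consec_Cons)
      have adjuv: "adj (f u) (f v)" using emb_path(1)[OF emb e] I by (simp add: spath_def)
      show False
      proof (rule attached_walk[OF Knc Ksub xy0])
        fix d x y assume d: "d \<in> K w" "x \<noteq> y" "{x, y} \<subseteq> att ?W {d}"
        then have "{x, y} \<subseteq> {f u, f v}" using attw P att_mono[of "{d}" "K w" ?W] by blast
        then have "{x, y} = {f u, f v}" using d(2) by auto
        then have "adj d (f u)" "adj d (f v)" using d(3) unfolding att_def by auto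
        then show False using no_triangle[of d "f u" "f v"] adjuv adj_sym by blast
      next
        fix ds x y assume ds: "set ds \<subseteq> K w" "attached ?W ds x y" "x \<noteq> y" "x \<in> ?W" "y \<in> ?W"
        have "hd ds \<in> set ds" "last ds \<in> set ds" using ds(2) by (auto simp: attached_def)
        then have "x \<in> att ?W (K w)" "y \<in> att ?W (K w)"
          using ds unfolding attached_def att_def by blast+
        then have "{x, y} = {f u, f v}" using attw P ds(3) by auto
        then have "consec ?P x y" using P(2) consec_commute by (metis doubleton_eq_iff)
        then show False using no_ear_at_consec[OF emb cov e _ ds(2)] by blast
      qed
    qed
    have setP: "set ?P = {f u, f v} \<union> set (I u v)" by (rule set_spath)
    \<comment> \<open>All components attached to this path alone are included, not only that of
      \<open>w\<close>; otherwise an inner vertex of the path could have a neighbour in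
      \<open>Y\<close>.\<close>
    define X where "X = set (I u v) \<union> {z \<in> V - ?W. att ?W (K z) \<subseteq> set ?P}"
    define Y where "Y = V - X - {f u, f v}"
    have fuv: "f u \<notin> X" "f v \<notin> X" using uv fW unfolding X_def by auto
    have inner: "z \<notin> set (I u v)" if "i < n" "z = f i" for z i using uv that by auto
    have skel: "edge E a b \<Longrightarrow> {a, b} \<noteq> {u, v} \<Longrightarrow> z \<in> set (spath f I a b) \<Longrightarrow> z \<notin> set (I u v)" for a b z
      using emb_disj[OF emb _ e, of a b] emb_edge[OF emb, of a b] uv unfolding set_spath by blast
    have noadj: "\<not> adj x y" if x: "x \<in> X" and y: "y \<in> Y" for x y
    proof
      assume xy: "adj x y"
      have yV: "y \<in> V" "y \<notin> set ?P" "y \<notin> X" using y unfolding Y_def X_def setP by auto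
      show False
      proof (cases "x \<in> set (I u v)")
        case xI: True
        then have xW: "x \<in> ?W" using PW setP by blast
        show False
        proof (cases "y \<in> ?W")
          case True
          then have "consec ?P x y" using consec_path_img[OF emb e xI] xy by blast
          then show False using consec_in_set[of ?P x y] yV by blast
        next
          case False
          have "\<not> bad E f I (att ?W (K y))" using nb Knc Ksub by blast
          then obtain a b where ab: "edge E a b" "att ?W (K y) \<subseteq> set (spath f I a b)" unfolding bad_def by blast
          have "x \<in> att ?W (K y)" unfolding att_def using xW Kself[of y] False yV adj_sym[OF xy] by blast
          then have "{a, b} = {u, v}" using skel[OF ab(1), of x] ab(2) xI by blast
          then have "set (spath f I a b) = set ?P"
            using spath_rev[OF emb e] by (auto simp: doubleton_eq_iff)
          then show False using ab(2) False yV unfolding X_def by blast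
        qed
      next
        case False
        then have xC: "x \<in> V - ?W" "att ?W (K x) \<subseteq> set ?P" using x unfolding X_def by auto
        show False
        proof (cases "y \<in> ?W")
          case True
          then have "y \<in> att ?W (K x)" unfolding att_def using Kself[OF xC(1)] xy by blast
          then show False using xC yV by blast
        next
          case False
          then have "y \<in> K x" using Kclosed[OF Kself[OF xC(1)] xy] by blast
          then have "att ?W (K y) \<subseteq> set ?P" using Ktrans att_mono xC(2) by (meson order_trans)
          then show False using False yV unfolding X_def by blast
        qed
      qed
    qed
    have finX: "finite X" and finY: "finite Y" using finV unfolding X_def Y_def by auto
    have wX: "w \<in> X" using w attw unfolding X_def by blast
    have cardX: "2 \<le> card X"
    proof -
      have "hd (I u v) \<in> set (I u v)" using ne by simp
      then have "hd (I u v) \<in> X" "hd (I u v) \<noteq> w" using w PW setP unfolding X_def by auto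
      then have "card {hd (I u v), w} \<le> card X" using wX finX by (intro card_mono) auto
      moreover have "card {hd (I u v), w} = 2" using \<open>hd (I u v) \<noteq> w\<close> by simp
      ultimately show ?thesis by linarith
    qed
    have fY: "f i \<in> Y" if "i < n" "i \<noteq> u" "i \<noteq> v" for i
      using that uv finj fW[OF that(1)] WV unfolding Y_def X_def by auto
    \<comment> \<open>At least four skeleton vertices leave two besides \<open>u\<close> and
      \<open>v\<close>.\<close>
    have cardY: "2 \<le> card Y"
    proof -
      have "f ` ({..<n} - {u, v}) \<subseteq> Y" using fY by auto
      then have "card (f ` ({..<n} - {u, v})) \<le> card Y" using finY by (intro card_mono)
      moreover have "card (f ` ({..<n} - {u, v})) = card ({..<n} - {u, v})"
        using emb_inj[OF emb] by (intro card_image) (auto simp: inj_on_def)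
      moreover have "card ({..<n} - {u, v}) = n - 2" using uv by (simp add: card_Diff_subset)
      ultimately show ?thesis using n4 by linarith
    qed
    have nadj: "\<not> adj (f u) (f v)"
    proof
      assume "adj (f u) (f v)"
      then obtain a b where ab: "edge E a b" "consec (spath f I a b) (f u) (f v)"
        using emb_adj[OF emb fW fW] uv by blast
      then have "I a b = []" "{u, v} = {a, b}" using consec_spath_ends[OF emb ab(1) _ _ ab(2)] uv by auto
      then show False using ne emb_edge[OF emb ab(1)] by (auto simp: doubleton_eq_iff)
    qed
    have pathX: "is_path_in adj (X \<union> {f u, f v}) (f u) (f v) ?P"
    proof -
      have "set ?P \<subseteq> X \<union> {f u, f v}" unfolding setP X_def by blast
      moreover have "?P \<noteq> []" "hd ?P = f u" "last ?P = f v" by (simp_all add: spath_def)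
      ultimately show ?thesis
        using is_path_inI[OF emb_path(1)[OF emb e] emb_path(2)[OF emb e]] by metis
    qed
    \<comment> \<open>The second path is what remains of the hole through \<open>uv\<close> when the
      path of this edge is removed; its interior uses other edges and hence avoids
      \<open>X\<close>.\<close>
    have pathY: "contains_path adj (Y \<union> {f u, f v}) (f u) (f v)"
    proof -
      obtain c where c: "check_hole E c" "{last c, hd c} = {u, v}"
        using cov e unfolding covered_def by blast
      have cc: "distinct c" "3 \<le> length c" "\<And>a b. (a, b) \<in> set (cpairs c) \<Longrightarrow> edge E a b"
        using c(1) by (auto simp: check_hole_def check_cyc_def)
      then have cne: "c \<noteq> []" by auto
      have zc: "set (zip c (tl c)) \<subseteq> set (cpairs c)" unfolding cpairs_def set_zip by (force simp: nth_append)
      have pne: "{a, b} \<noteq> {u, v}" if abz: "(a, b) \<in> set (zip c (tl c))" for a b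
      proof
        assume ab: "{a, b} = {u, v}"
        have "consec c a b"
        proof -
          obtain i where i: "i < length c" "i < length (tl c)" "c ! i = a" "tl c ! i = b"
            using abz by (auto simp: in_set_zip)
          then have "Suc i < length c" "c ! Suc i = b" by (auto simp: nth_tl)
          then show ?thesis using i(3) unfolding consec_def by blast
        qed
        then have "consec c (last c) (hd c)"
          using ab c(2) consec_commute by (metis doubleton_eq_iff)
        then show False using not_consec_last_hd[OF cc(1,2)] by blast
      qed
      have clt: "a < n" if ac: "a \<in> set c" for a
      proof -
        obtain i where i: "i < length c" "c ! i = a" using ac by (meson in_set_conv_nth)
        have "length (cpairs c) = length c" using cne by (simp add: cpairs_def)
        moreover have "fst (cpairs c ! i) = a" using i cne by (simp add: cpairs_def)
        ultimately have "(a, snd (cpairs c ! i)) \<in> set (cpairs c)" using i(1) by (metis nth_mem prod.collapse)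
        then show ?thesis using emb_edge[OF emb cc(3)] by blast
      qed
      define p where "p = expand f I c @ [f (last c)]"
      have setp: "set p = f ` set c \<union> (\<Union>(u, v)\<in>set (zip c (tl c)). set (I u v))"
        unfolding p_def by (rule set_expand_path[OF cne])
      have "distinct (expand f I (c @ [hd c]))"
        using real_cycle_is_cycle[OF emb, of c] c(1) by (auto simp: check_hole_def is_cycle_def real_cycle_def)
      moreover have "expand f I (c @ [hd c]) = p @ I (last c) (hd c)"
      proof -
        have "expand f I (d @ [s]) = expand f I d @ f (last d) # I (last d) s" if "d \<noteq> []" for d s
          using that by (induction f I d rule: expand.induct) auto
        then show ?thesis unfolding p_def using cne by simp
      qed
      ultimately have dp: "distinct p" by simp
      have sp: "successively adj p"
        unfolding p_def by (rule successively_expand) (use emb_path(1)[OF emb] cc(3) zc in blast)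
      have "set p \<subseteq> ?W"
      proof
        fix x assume "x \<in> set p"
        then consider a where "a \<in> set c" "x = f a" | a b where "(a, b) \<in> set (zip c (tl c))" "x \<in> set (I a b)"
          unfolding setp by blast
        then show "x \<in> ?W"
        proof cases
          case 1
          then show ?thesis using fW clt by blast
        next
          case 2
          then have "edge E a b" using zc cc(3) by blast
          then show ?thesis using 2 unfolding img_def by blast
        qed
      qed
      moreover have "set p \<inter> set (I u v) = {}"
      proof -
        have "set (I a b) \<inter> set (I u v) = {}" if "(a, b) \<in> set (zip c (tl c))" for a b
          using emb_disj[OF emb cc(3) e pne[OF that]] that zc by blast
        moreover have "f ` set c \<inter> set (I u v) = {}" using clt inner by blast
        ultimately show ?thesis unfolding setp by blast
      qed
      ultimately have "set p \<subseteq> Y \<union> {f u, f v}" using WV unfolding Y_def X_def by blast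
      then have path: "is_path_in adj (Y \<union> {f u, f v}) (hd p) (last p) p"
        using is_path_inI[OF sp dp] by (simp add: p_def)
      have "hd p = f (hd c)" unfolding p_def using cne by (induction f I c rule: expand.induct) auto
      moreover have "last p = f (last c)" by (simp add: p_def)
      ultimately show ?thesis
        unfolding contains_path_def using path is_path_in_rev[OF path] c(2) by (auto simp: doubleton_eq_iff)
    qed
    \<comment> \<open>On an inducing path \<open>w\<close> would be an inner vertex separating
      \<open>f u\<close> from \<open>f v\<close>, but the path \<open>?P\<close> joins them without
      \<open>w\<close>.\<close>
    have nX: "\<not> induces_path adj (X \<union> {f u, f v}) (f u) (f v)"
    proof
      assume "induces_path adj (X \<union> {f u, f v}) (f u) (f v)"
      then obtain p where p: "set p = X \<union> {f u, f v}" "distinct p" "p \<noteq> []" "hd p = f u" "last p = f v"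
        "\<And>x y. x \<in> X \<union> {f u, f v} \<Longrightarrow> y \<in> X \<union> {f u, f v} \<Longrightarrow> adj x y \<Longrightarrow> consec p x y"
        by (rule induces_pathD) blast
      have "w \<in> set p" using p(1) wX by blast
      then obtain A B where AB: "p = A @ w # B" by (meson split_list)
      have wP: "w \<notin> set ?P" using w PW by blast
      then have wuv: "w \<noteq> f u" "w \<noteq> f v" using setP by auto
      have "A \<noteq> []" "B \<noteq> []" using AB p(4,5) wuv by auto
      then have "hd A = f u" "last B = f v" using AB p(4,5) by auto
      then have hA: "f u \<in> set A" "f v \<in> set B"
        using \<open>A \<noteq> []\<close> \<open>B \<noteq> []\<close> hd_in_set last_in_set by metis+
      have dAB: "set A \<inter> set B = {}" "w \<notin> set A \<union> set B" using p(2) AB by auto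
      have "set ?P \<subseteq> set A \<union> set B" using pathX wP p(1) AB unfolding is_path_in_def by auto
      then obtain x y where xy: "x \<in> set A" "y \<in> set B" "adj x y"
        using walk_crossing[OF emb_path(1)[OF emb e], of "set A" "set B"] hA dAB
        by (auto simp: spath_def)
      have "consec p x y" using p(1,6) xy AB by auto
      then have "consec (A @ w # B) x y" unfolding AB .
      then show False
        using xy dAB consec_in_set[of A x y] consec_in_set[of B x y]
        by (auto simp: consec_append consec_Cons[of w] doubleton_eq_iff)
    qed
    \<comment> \<open>As an end of an inducing path, \<open>f u\<close> would have a single
      neighbour there. Two further skeleton edges at \<open>u\<close> provide two neighbours outside
      \<open>X\<close>.\<close>
    have nY: "\<not> induces_path adj (Y \<union> {f u, f v}) (f u) (f v)"
    proof
      assume "induces_path adj (Y \<union> {f u, f v}) (f u) (f v)"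
      then obtain p where p: "set p = Y \<union> {f u, f v}" "distinct p" "p \<noteq> []" "hd p = f u" "last p = f v"
        "\<And>x y. x \<in> Y \<union> {f u, f v} \<Longrightarrow> y \<in> Y \<union> {f u, f v} \<Longrightarrow> adj x y \<Longrightarrow> consec p x y"
        by (rule induces_pathD) blast
      obtain q where q: "p = f u # q" using p(3,4) by (cases p) auto
      have uq: "f u \<notin> set q" using p(2) q by simp
      have one: "z = hd q" if "z \<in> Y \<union> {f u, f v}" "adj (f u) z" for z
      proof -
        have "consec p (f u) z" using p(6) that by blast
        then show ?thesis using uq consec_in_set[of q "f u" z] by (auto simp: q consec_Cons doubleton_eq_iff)
      qed
      have ex: "\<exists>z. z \<in> Y \<union> {f u, f v} \<and> adj (f u) z \<and> z \<in> insert (f a) (set (I u a)) \<and> (I u a \<noteq> [] \<longrightarrow> z \<in> set (I u a)) \<and> (I u a = [] \<longrightarrow> z = f a)"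
        if a: "edge E u a" "a \<noteq> v" for a
      proof -
        define z where "z = hd (I u a @ [f a])"
        have "adj (f u) z" using emb_path(1)[OF emb a(1)] unfolding z_def spath_def
          by (cases "I u a") (auto simp: successively_Cons)
        moreover have z: "z \<in> insert (f a) (set (I u a))" "I u a \<noteq> [] \<longrightarrow> z \<in> set (I u a)" "I u a = [] \<longrightarrow> z = f a"
          unfolding z_def by (cases "I u a"; auto)+
        moreover have "z \<in> Y \<union> {f u, f v}"
        proof -
          have zP: "z \<in> set (spath f I u a)" using z(1) unfolding set_spath by auto
          then have "z \<in> ?W" using spath_img[OF emb a(1)] by blast
          moreover have "z \<notin> set (I u v)"
            using skel[OF a(1) _ zP] a(2) uv by (auto simp: doubleton_eq_iff)
          ultimately show ?thesis using WV unfolding Y_def X_def by auto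
        qed
        ultimately show ?thesis by blast
      qed
      obtain a b where ab: "edge E u a" "edge E u b" "a \<noteq> b" "a \<noteq> v" "b \<noteq> v"
        using cov uv unfolding covered_def by metis
      obtain z z' where z: "adj (f u) z" "z \<in> Y \<union> {f u, f v}" "I u a \<noteq> [] \<longrightarrow> z \<in> set (I u a)" "I u a = [] \<longrightarrow> z = f a"
        and z': "adj (f u) z'" "z' \<in> Y \<union> {f u, f v}" "I u b \<noteq> [] \<longrightarrow> z' \<in> set (I u b)" "I u b = [] \<longrightarrow> z' = f b"
        using ex[OF ab(1,4)] ex[OF ab(2,5)] by blast
      have "z = z'" using one[of z] one[of z'] z z' by simp
      moreover have "{u, a} \<noteq> {u, b}" using ab(3) by (auto simp: doubleton_eq_iff)
      then have "set (I u a) \<inter> set (I u b) = {}" by (rule emb_disj[OF emb ab(1,2)])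
      moreover have "f a \<noteq> f b" "f a \<notin> set (I u b)" "f b \<notin> set (I u a)"
        using emb_edge[OF emb ab(1)] emb_edge[OF emb ab(2)] finj ab(3) by auto
      ultimately show False using z(3,4) z'(3,4) by (cases "I u a = []"; cases "I u b = []") auto
    qed
    have "has_proper_2_cutset V adj"
      unfolding has_proper_2_cutset_def
    proof (intro exI conjI)
      show "f u \<in> V" "f v \<in> V" using fW uv WV by blast+
      show "f u \<noteq> f v" using finj uv by blast
      show "X \<union> Y \<union> {f u, f v} = V"
        using fuv fW uv WV PW setP unfolding Y_def X_def by blast
      show "X \<inter> Y = {}" "f u \<notin> X \<union> Y" "f v \<notin> X \<union> Y" using fuv unfolding Y_def by auto
      show "contains_path adj (X \<union> {f u, f v}) (f u) (f v)" unfolding contains_path_def using pathX by blast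
    qed (use nadj cardX cardY noadj pathY nX nY in blast)+
    then show ?thesis ..
  qed simp
qed

end

subsection \<open>Two-extensions and extensions of skeletons\<close>

definition skel :: "(nat \<times> nat) list \<Rightarrow> (nat \<times> nat) list \<Rightarrow> lab_edges" where
  "skel Ls Us = map (\<lambda>(u, v). (u, v, Long)) Ls @ map (\<lambda>(u, v). (u, v, Unit)) Us"

fun pairs_distinct :: "(nat \<times> nat) list \<Rightarrow> bool" where
  "pairs_distinct [] \<longleftrightarrow> True"
| "pairs_distinct ((u, v) # Ls) \<longleftrightarrow>
     (\<forall>(a, b)\<in>set Ls. \<not> (a = u \<and> b = v \<or> a = v \<and> b = u)) \<and> pairs_distinct Ls"

text \<open>A long edge of the skeletons below corresponds to a path of length 2 in the Petersen or Heawood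
  graph. Splitting each long path after its first edge makes the skeleton an induced subgraph, where
  only the second half may still be subdivided.\<close>

fun halve :: "nat \<Rightarrow> lab_edges \<Rightarrow> (nat \<times> nat) list \<Rightarrow> nat \<times> lab_edges" where
  "halve n E [] = (n, E)"
| "halve n E ((u, v) # Ls) = halve (Suc n) (set_lab u n Unit (split_edge n u v E)) Ls"

text \<open>The list \<open>g\<close> gives the places of the skeleton vertices in the host graph,
  so \<open>filter (adjH (g ! u)) g\<close> counts the degree in the induced subgraph. Every edge
  that may still be subdivided needs an end of degree 2.\<close>

definition check_ext :: "nat set \<Rightarrow> (nat \<Rightarrow> nat \<Rightarrow> bool) \<Rightarrow> nat list \<Rightarrow> nat \<times> lab_edges \<Rightarrow> bool" where
  "check_ext VH adjH g K \<longleftrightarrow> length g = fst K \<and> distinct g \<and> set g \<subseteq> VH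
     \<and> (\<forall>(u, v, l)\<in>set (snd K). l \<noteq> Unit \<longrightarrow>
          length (filter (adjH (g ! u)) g) = 2 \<or> length (filter (adjH (g ! v)) g) = 2)
     \<and> (\<forall>u\<in>set [0..<fst K]. \<forall>v\<in>set [0..<fst K]. edge (snd K) u v \<longleftrightarrow> adjH (g ! u) (g ! v))"

lemma pairs_distinctD:
  "pairs_distinct Ls \<Longrightarrow> i < length Ls \<Longrightarrow> j < length Ls \<Longrightarrow> i \<noteq> j \<Longrightarrow>
    {fst (Ls ! i), snd (Ls ! i)} \<noteq> {fst (Ls ! j), snd (Ls ! j)}"
proof (induction Ls arbitrary: i j rule: pairs_distinct.induct)
  case (2 u v Ls)
  have *: "{fst (Ls ! k), snd (Ls ! k)} \<noteq> {u, v}" if "k < length Ls" for k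
    using 2(2) nth_mem[OF that] by (fastforce simp: doubleton_eq_iff)
  show ?case
    using 2 *[of "i - 1"] *[of "j - 1"] by (cases i; cases j) auto
qed simp

context graph
begin

lemma emb_halve:
  "emb n E f I \<Longrightarrow> (\<forall>(u, v)\<in>set Ls. (u, v, Long) \<in> set E) \<Longrightarrow> pairs_distinct Ls \<Longrightarrow>
    \<exists>f I'. emb (fst (halve n E Ls)) (snd (halve n E Ls)) f I' \<and>
      img (fst (halve n E Ls)) (snd (halve n E Ls)) f I' = W"
  if "img n E f I = W"
  using that
proof (induction n E Ls arbitrary: f I rule: halve.induct)
  case (1 n E)
  then show ?case by auto
next
  case (2 n E u v Ls)
  have uvL: "(u, v, Long) \<in> set E" using 2(3) by simp
  have e: "edge E u v" using edgeI[OF uvL] .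
  have "I u v \<noteq> []" using emb_Long[OF 2(2) uvL] .
  \<comment> \<open>The split is at the first inner vertex, so the first half is a single edge and
    can be labelled \<open>Unit\<close>.\<close>
  then obtain p B where pB: "I u v = [] @ p # B" by (cases "I u v") auto
  define f' where "f' = f(n := p)"
  define I' where "I' = upd (upd I u n []) n v B"
  have sp: "emb (Suc n) (split_edge n u v E) f' I'" "img (Suc n) (split_edge n u v E) f' I' = img n E f I"
    "I' u n = []"
    using emb_split[OF 2(2) e pB] unfolding f'_def I'_def by auto
  let ?E = "set_lab u n Unit (split_edge n u v E)"
  have emb': "emb (Suc n) ?E f' I'" using emb_set_lab[OF sp(1)] sp(3) by blast
  have "img (Suc n) ?E f' I' = W"
    using sp(2) 2(5) unfolding img_def edge_set_lab by simp
  moreover have "\<forall>(a, b)\<in>set Ls. (a, b, Long) \<in> set ?E"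
  proof (clarify)
    fix a b assume ab: "(a, b) \<in> set Ls"
    then have abL: "(a, b, Long) \<in> set E" using 2(3) by auto
    have "{a, b} \<noteq> {u, v}" using 2(4) ab by (auto simp: doubleton_eq_iff)
    then have "(a, b, Long) \<in> set (split_edge n u v E)"
      using abL drop_edge_iff unfolding split_edge_def by simp
    moreover have "b \<noteq> n" using emb_edge[OF 2(2) edgeI[OF abL]] by auto
    ultimately show "(a, b, Long) \<in> set ?E" unfolding set_lab_def by force
  qed
  ultimately show ?case using 2(1)[OF emb'] 2(4) by simp
qed

lemma emb_two_extension:
  assumes emb: "emb n E f I" and V: "img n E f I = V" and chk: "check_ext VH adjH g (n, E)"
  shows "two_extension V adj VH adjH"
proof -
  have g: "length g = n" "distinct g" "set g \<subseteq> VH"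
    and deg: "\<And>u v l. (u, v, l) \<in> set E \<Longrightarrow> l \<noteq> Unit \<Longrightarrow>
          length (filter (adjH (g ! u)) g) = 2 \<or> length (filter (adjH (g ! v)) g) = 2"
    and eH: "\<And>u v. u < n \<Longrightarrow> v < n \<Longrightarrow> edge E u v \<longleftrightarrow> adjH (g ! u) (g ! v)"
    using chk by (auto simp: check_ext_def)
  \<comment> \<open>\<open>two_extension\<close> is indexed by vertices of the host graph, the
    embedding by positions in \<open>g\<close>; \<open>ix\<close> translates.\<close>
  define ix where "ix a = (THE i. i < n \<and> g ! i = a)" for a
  have ixg: "ix (g ! i) = i" if "i < n" for i
    unfolding ix_def using that g(1,2) by (auto simp: nth_eq_iff_index_eq)
  have ix: "ix a < n" "g ! ix a = a" if "a \<in> set g" for a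
    using that ixg g(1) by (metis in_set_conv_nth)+
  have eS: "edge E (ix a) (ix b) \<longleftrightarrow> adjH a b" if "a \<in> set g" "b \<in> set g" for a b
    using eH[of "ix a" "ix b"] ix that by simp
  have fim: "(\<lambda>a. f (ix a)) ` set g = f ` {..<n}"
  proof -
    have "ix ` set g = {..<n}" using ix ixg g(1) by (force simp: image_iff set_conv_nth)
    then show ?thesis by (metis image_image)
  qed
  have int: "interior (spath f I u v) = set (I u v)" for u v
    by (simp add: interior_def spath_def)
  have degS: "degree (set g) adjH a = length (filter (adjH a) g)" for a
  proof -
    have "{y \<in> set g. adjH a y} = set (filter (adjH a) g)" by auto
    then show ?thesis
      unfolding degree_def using distinct_card[OF distinct_filter[OF g(2)]] by metis
  qed
  let ?S = "set g" and ?f = "\<lambda>a. f (ix a)" and ?P = "\<lambda>a b. spath f I (ix a) (ix b)"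
  have c1: "inj_on ?f ?S"
  proof (rule inj_onI)
    fix a b assume ab: "a \<in> ?S" "b \<in> ?S" "f (ix a) = f (ix b)"
    then have "ix a = ix b" using emb_inj[OF emb] ix(1) unfolding inj_on_def by blast
    then show "a = b" using ix(2) ab by metis
  qed
  have c2: "?f ` ?S \<subseteq> V" unfolding fim using V by (auto simp: img_def)
  have c3: "is_path_in adj V (?f a) (?f b) (?P a b) \<and> length (?P a b) \<ge> 2
          \<and> ?P b a = rev (?P a b) \<and> interior (?P a b) \<inter> ?f ` ?S = {}
          \<and> (length (?P a b) > 2 \<longrightarrow> degree ?S adjH a = 2 \<or> degree ?S adjH b = 2)"
    if ab: "a \<in> ?S" "b \<in> ?S" "adjH a b" for a b
  proof (intro conjI)
    have e: "edge E (ix a) (ix b)" using eS ab by simp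
    show "is_path_in adj V (?f a) (?f b) (?P a b)"
      using is_path_inI[OF emb_path[OF emb e], of V] spath_img[OF emb e] V by (simp add: spath_def)
    show "?P b a = rev (?P a b)" by (rule spath_rev[OF emb e])
    show "interior (?P a b) \<inter> ?f ` ?S = {}" unfolding int fim using emb_edge[OF emb e] by blast
    show "length (?P a b) > 2 \<longrightarrow> degree ?S adjH a = 2 \<or> degree ?S adjH b = 2"
    proof
      assume "length (?P a b) > 2"
      then have "I (ix a) (ix b) \<noteq> []" by (auto simp: spath_def)
      then have ne: "I (ix a) (ix b) \<noteq> []" "I (ix b) (ix a) \<noteq> []" using emb_edge[OF emb e] by auto
      obtain l where "(ix a, ix b, l) \<in> set E \<or> (ix b, ix a, l) \<in> set E" using e edge_iff by blast
      moreover from this have "l \<noteq> Unit" using ne emb_Unit[OF emb] by blast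
      ultimately show "degree ?S adjH a = 2 \<or> degree ?S adjH b = 2"
        using deg[of "ix a" "ix b" l] deg[of "ix b" "ix a" l] ix ab unfolding degS by auto
    qed
  qed (simp add: spath_def)
  have c4: "interior (?P a b) \<inter> interior (?P a' b') = {}"
    if "a \<in> ?S" "b \<in> ?S" "a' \<in> ?S" "b' \<in> ?S" "adjH a b" "adjH a' b'" "{a, b} \<noteq> {a', b'}" for a b a' b'
  proof -
    have "{ix a, ix b} \<noteq> {ix a', ix b'}"
      using that(7) ix(2) that(1-4) by (metis doubleton_eq_iff)
    then show ?thesis unfolding int using emb_disj[OF emb] eS that by blast
  qed
  have c5: "V = ?f ` ?S \<union> \<Union> {interior (?P a b) |a b. a \<in> ?S \<and> b \<in> ?S \<and> adjH a b}"
  proof -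
    have "\<Union> {interior (?P a b) |a b. a \<in> ?S \<and> b \<in> ?S \<and> adjH a b} = {x. \<exists>u v. edge E u v \<and> x \<in> set (I u v)}"
      (is "?A = ?B")
    proof
      show "?A \<subseteq> ?B" unfolding int using eS by blast
      show "?B \<subseteq> ?A"
      proof
        fix x assume "x \<in> ?B"
        then obtain u v where uv: "edge E u v" "x \<in> set (I u v)" by blast
        then have lt: "u < n" "v < n" using emb_edge[OF emb uv(1)] by auto
        then have "g ! u \<in> ?S" "g ! v \<in> ?S" "adjH (g ! u) (g ! v)" using g(1) eH uv(1) by auto
        moreover have "x \<in> interior (?P (g ! u) (g ! v))" using uv(2) ixg lt int by simp
        ultimately show "x \<in> ?A" by blast
      qed
    qed
    then show ?thesis unfolding fim using V by (simp add: img_def)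
  qed
  have c6: "\<exists>a\<in>?S. \<exists>b\<in>?S. adjH a b \<and> consec (?P a b) x y" if xy: "adj x y" for x y
  proof -
    obtain u v where uv: "edge E u v" "consec (spath f I u v) x y"
      using emb_adj[OF emb, of x y] adjV[OF xy] V xy by auto
    then have lt: "u < n" "v < n" using emb_edge[OF emb uv(1)] by auto
    then have "g ! u \<in> ?S" "g ! v \<in> ?S" "adjH (g ! u) (g ! v)" using g(1) eH uv(1) by auto
    moreover have "consec (?P (g ! u) (g ! v)) x y" using uv(2) ixg lt by simp
    ultimately show ?thesis by blast
  qed
  show ?thesis
    unfolding two_extension_def
  proof (intro exI[of _ ?S] exI[of _ ?f] exI[of _ ?P] conjI)
    show "?S \<subseteq> VH" "inj_on ?f ?S" "?f ` ?S \<subseteq> V" by (fact g(3) c1 c2)+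
    show "\<forall>a\<in>?S. \<forall>b\<in>?S. adjH a b \<longrightarrow> is_path_in adj V (?f a) (?f b) (?P a b) \<and> length (?P a b) \<ge> 2
          \<and> ?P b a = rev (?P a b) \<and> interior (?P a b) \<inter> ?f ` ?S = {}
          \<and> (length (?P a b) > 2 \<longrightarrow> degree ?S adjH a = 2 \<or> degree ?S adjH b = 2)"
      by (intro ballI impI) (rule c3)
    show "\<forall>a\<in>?S. \<forall>b\<in>?S. \<forall>a'\<in>?S. \<forall>b'\<in>?S. adjH a b \<and> adjH a' b' \<and> {a, b} \<noteq> {a', b'} \<longrightarrow>
          interior (?P a b) \<inter> interior (?P a' b') = {}"
      by (intro ballI impI, elim conjE) (rule c4)
    show "V = ?f ` ?S \<union> \<Union> {interior (?P a b) |a b. a \<in> ?S \<and> b \<in> ?S \<and> adjH a b}" by (fact c5)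
    show "\<forall>x y. adj x y \<longrightarrow> (\<exists>a\<in>?S. \<exists>b\<in>?S. adjH a b \<and> consec (?P a b) x y)"
      by (intro allI impI) (rule c6)
  qed
qed

end

text \<open>Locations on a skeleton are numbers: l is the vertex l if l < m, and the interior of the long edge
  number l - m otherwise. Splitting at a list of locations makes all of them vertices.\<close>

fun splits :: "nat \<Rightarrow> (nat \<times> nat) list \<Rightarrow> nat \<Rightarrow> lab_edges \<Rightarrow> nat list
    \<Rightarrow> nat \<times> lab_edges \<times> nat list" where
  "splits m Ls n E [] = (n, E, [])"
| "splits m Ls n E (l # ls) =
     (if l < m then (case splits m Ls n E ls of (n', E', ps) \<Rightarrow> (n', E', l # ps))
      else (case Ls ! (l - m) of (u, v) \<Rightarrow>
        (case splits m Ls (Suc n) (split_edge n u v E) ls of (n', E', ps) \<Rightarrow> (n', E', n # ps))))"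

definition loc_at :: "nat \<Rightarrow> (nat \<times> nat) list \<Rightarrow> (nat \<Rightarrow> 'a) \<Rightarrow> (nat \<Rightarrow> nat \<Rightarrow> 'a list) \<Rightarrow> nat \<Rightarrow> 'a \<Rightarrow> bool" where
  "loc_at m Ls f I l x \<longleftrightarrow> l < m + length Ls \<and>
     (if l < m then x = f l else x \<in> set (I (fst (Ls ! (l - m))) (snd (Ls ! (l - m)))))"

context graph
begin

text \<open>Every long edge is split at most once, because after a split its number no longer names
  an edge of the current skeleton. Therefore the locations inside long edges have to be
  distinct.\<close>

lemma emb_splits:
  assumes "emb n E f I" "m \<le> n" "list_all2 (loc_at m Ls f I) ls xs"
    "distinct (filter (\<lambda>l. m \<le> l) ls)" "pairs_distinct Ls"
    "\<And>u v. (u, v) \<in> set Ls \<Longrightarrow> u < m \<and> v < m"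
    "\<And>l. l \<in> set ls \<Longrightarrow> m \<le> l \<Longrightarrow> edge E (fst (Ls ! (l - m))) (snd (Ls ! (l - m)))"
    "splits m Ls n E ls = (n', E', ps)"
  shows "\<exists>f' I'. emb n' E' f' I' \<and> img n' E' f' I' = img n E f I \<and> n \<le> n' \<and> (\<forall>i<n. f' i = f i)
    \<and> map f' ps = xs \<and> (\<forall>p\<in>set ps. p < n')"
  using assms
proof (induction ls arbitrary: n E f I xs n' E' ps)
  case Nil
  then show ?case by (intro exI[of _ f] exI[of _ I]) auto
next
  case (Cons l ls)
  note emb = Cons.prems(1) and mn = Cons.prems(2) and locs = Cons.prems(3) and dist = Cons.prems(4)
    and pd = Cons.prems(5) and lt = Cons.prems(6) and ed = Cons.prems(7) and spl = Cons.prems(8)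
  obtain x ys where xs: "xs = x # ys" "loc_at m Ls f I l x" "list_all2 (loc_at m Ls f I) ls ys"
    using locs by (cases xs) auto
  show ?case
  proof (cases "l < m")
    case True
    obtain qs where qs: "splits m Ls n E ls = (n', E', qs)" "ps = l # qs"
      using spl True by (auto split: prod.splits)
    obtain f' I' where f': "emb n' E' f' I'" "img n' E' f' I' = img n E f I" "n \<le> n'" "\<forall>i<n. f' i = f i"
      "map f' qs = ys" "\<forall>p\<in>set qs. p < n'"
      using Cons.IH[OF emb mn xs(3) _ pd lt _ qs(1)] dist ed True by auto
    have "f' l = x" using xs(2) True mn f'(4) by (simp add: loc_at_def)
    then show ?thesis using f' qs(2) xs(1) True mn by (intro exI[of _ f'] exI[of _ I']) auto
  next
    case False
    obtain u v where uv: "Ls ! (l - m) = (u, v)" by (cases "Ls ! (l - m)")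
    have lm: "l - m < length Ls" using xs(2) False by (auto simp: loc_at_def)
    have uvL: "(u, v) \<in> set Ls" using nth_mem[OF lm] uv by simp
    have e: "edge E u v" using ed[of l] False uv by simp
    have "x \<in> set (I u v)" using xs(2) False uv by (simp add: loc_at_def)
    then obtain A B where AB: "I u v = A @ x # B" by (meson split_list)
    define g where "g = f(n := x)"
    define J where "J = upd (upd I u n A) n v B"
    have sp: "emb (Suc n) (split_edge n u v E) g J" "img (Suc n) (split_edge n u v E) g J = img n E f I"
      using emb_split[OF emb e AB] unfolding g_def J_def by auto
    obtain qs where qs: "splits m Ls (Suc n) (split_edge n u v E) ls = (n', E', qs)" "ps = n # qs"
      using spl False uv by (auto split: prod.splits)
    have Jold: "J a b = I a b" if "a < n" "b < n" for a b
      using that unfolding J_def by (simp add: upd_def)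
    have locJ: "loc_at m Ls g J k y" if "loc_at m Ls f I k y" for k y
    proof (cases "k < m")
      case True
      then show ?thesis using that mn unfolding loc_at_def g_def by simp
    next
      case False
      then have "k - m < length Ls" using that by (auto simp: loc_at_def)
      then have "(fst (Ls ! (k - m)), snd (Ls ! (k - m))) \<in> set Ls" by simp
      then have "fst (Ls ! (k - m)) < n" "snd (Ls ! (k - m)) < n"
        using lt[of "fst (Ls ! (k - m))" "snd (Ls ! (k - m))"] mn by auto
      then show ?thesis using that False Jold unfolding loc_at_def by simp
    qed
    have locs': "list_all2 (loc_at m Ls g J) ls ys"
      by (rule list_all2_mono[OF xs(3)]) (rule locJ)
    have ed': "edge (split_edge n u v E) (fst (Ls ! (k - m))) (snd (Ls ! (k - m)))"
      if k: "k \<in> set ls" "m \<le> k" for k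
    proof -
      obtain i where i: "i < length ls" "ls ! i = k" using k(1) by (meson in_set_conv_nth)
      then have "loc_at m Ls f I k (ys ! i)" using xs(3) list_all2_nthD by blast
      then have km: "k - m < length Ls" using k(2) by (auto simp: loc_at_def)
      have "k \<noteq> l" using dist k False by auto
      then have "k - m \<noteq> l - m" using k(2) False by simp
      then have "{fst (Ls ! (k - m)), snd (Ls ! (k - m))} \<noteq> {u, v}"
        using pairs_distinctD[OF pd km lm] uv by simp
      then have "edge (drop_edge u v E) (fst (Ls ! (k - m))) (snd (Ls ! (k - m)))"
        using ed[of k] k edge_drop_edge by simp
      then show ?thesis unfolding split_edge_def edge_def by auto
    qed
    obtain f' I' where f': "emb n' E' f' I'" "img n' E' f' I' = img n E f I" "Suc n \<le> n'" "\<forall>i<Suc n. f' i = g i"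
      "map f' qs = ys" "\<forall>p\<in>set qs. p < n'"
      using Cons.IH[OF sp(1) _ locs' _ pd lt ed' qs(1)] dist mn sp(2) False by auto
    have "f' n = x" "\<forall>i<n. f' i = f i" using f'(4) by (auto simp: g_def)
    then show ?thesis using f' qs(2) xs(1) by (intro exI[of _ f'] exI[of _ I']) auto
  qed
qed

end

section \<open>Finite checks for ears and single vertices\<close>

definition on_seg :: "nat \<Rightarrow> (nat \<times> nat) list \<Rightarrow> nat \<Rightarrow> nat \<Rightarrow> nat \<Rightarrow> bool" where
  "on_seg n Ls l u v \<longleftrightarrow> (if l < n then l = u \<or> l = v else Ls ! (l - n) = (u, v))"

text \<open>Attachments on a common segment are not bad, so these pairs of locations are left out of
  the ear tables.\<close>

definition share :: "nat \<Rightarrow> (nat \<times> nat) list \<Rightarrow> (nat \<times> nat) list \<Rightarrow> nat \<Rightarrow> nat \<Rightarrow> bool" where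
  "share n Ls Us i j \<longleftrightarrow> (\<exists>(u, v)\<in>set (Ls @ Us). on_seg n Ls i u v \<and> on_seg n Ls j u v)"

definition on_cyc :: "nat \<Rightarrow> (nat \<times> nat) list \<Rightarrow> nat list \<Rightarrow> nat \<Rightarrow> bool" where
  "on_cyc n Ls c l \<longleftrightarrow> (if l < n then l \<in> set c else l < n + length Ls \<and>
     (Ls ! (l - n) \<in> set (cpairs c) \<or> (snd (Ls ! (l - n)), fst (Ls ! (l - n))) \<in> set (cpairs c)))"

definition cover_check :: "nat \<Rightarrow> (nat \<times> nat) list \<Rightarrow> (nat \<times> nat) list \<Rightarrow> nat list list \<Rightarrow> bool" where
  "cover_check n Ls Us Cs \<longleftrightarrow> 4 \<le> n \<and> pairs_distinct Ls
     \<and> (\<forall>u\<in>set [0..<n]. 3 \<le> length (filter (edge (skel Ls Us) u) [0..<n]))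
     \<and> (\<forall>c\<in>set Cs. check_hole (skel Ls Us) c)
     \<and> (\<forall>(u, v)\<in>set (Ls @ Us). \<exists>c\<in>set Cs. last c = u \<and> hd c = v \<or> last c = v \<and> hd c = u)"

text \<open>Prescribing the exact list of keys makes the table complete. The ear becomes a
  \<open>Long\<close> edge since it has a vertex of its own, and its ends must not be joined
  already, as a skeleton cannot represent parallel edges.\<close>

definition ear_check :: "nat \<Rightarrow> (nat \<times> nat) list \<Rightarrow> (nat \<times> nat) list
    \<Rightarrow> (nat \<times> lab_edges) list \<Rightarrow> ((nat \<times> nat) \<times> cert) list \<Rightarrow> bool" where
  "ear_check n Ls Us G tab \<longleftrightarrow>
     map fst tab = filter (\<lambda>(i, j). \<not> share n Ls Us i j)
       (concat (map (\<lambda>j. map (\<lambda>i. (i, j)) [0..<j]) [0..<n + length Ls]))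
     \<and> (\<forall>((i, j), t)\<in>set tab. case splits n Ls n (skel Ls Us) [i, j] of (n', E', ps) \<Rightarrow>
          \<not> edge E' (ps ! 0) (ps ! 1) \<and> check G n' ((ps ! 0, ps ! 1, Long) # E') t)"

text \<open>Different neighbours cannot share a vertex location, but they can lie inside the same
  long edge. So a repeated long location is not skipped and must be covered by a hole.\<close>

definition skip :: "nat \<Rightarrow> (nat \<times> nat) list \<Rightarrow> nat \<Rightarrow> nat \<Rightarrow> bool" where
  "skip n Cl i j \<longleftrightarrow> i = j \<and> i < n \<or> (i, j) \<in> set Cl"

text \<open>For a vertex with at least three neighbours on the embedding. No two of them are at distance at most
  two along unit edges (Cl), no three lie on a hole (Hs), and the few remaining sets of three or four
  locations, sorted, come with certificates (tab).\<close>

definition star_check :: "nat \<Rightarrow> (nat \<times> nat) list \<Rightarrow> (nat \<times> nat) list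
    \<Rightarrow> (nat \<times> lab_edges) list \<Rightarrow> (nat \<times> nat) list \<Rightarrow> (nat list \<times> nat list) list
    \<Rightarrow> (nat list \<times> cert) list \<Rightarrow> bool" where
  "star_check n Ls Us G Cl Hs tab \<longleftrightarrow>
     (\<forall>(i, j)\<in>set Cl. i < n \<and> j < n \<and> i \<noteq> j \<and> (unit_edge (skel Ls Us) i j
        \<or> (\<exists>x\<in>set [0..<n]. unit_edge (skel Ls Us) i x \<and> unit_edge (skel Ls Us) x j)))
     \<and> (\<forall>(c, ls)\<in>set Hs. check_hole (skel Ls Us) c \<and> (\<forall>l\<in>set ls. on_cyc n Ls c l))
     \<and> (\<forall>k\<in>set [0..<n + length Ls]. \<forall>j\<in>set [0..<Suc k]. skip n Cl j k \<or>
         (\<forall>i\<in>set [0..<Suc j]. skip n Cl i j \<or> skip n Cl i k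
           \<or> (\<exists>(c, ls)\<in>set Hs. i \<in> set ls \<and> j \<in> set ls \<and> k \<in> set ls) \<or> [i, j, k] \<in> set (map fst tab)))
     \<and> (\<forall>s\<in>set (map fst tab). \<forall>t\<in>set (map fst tab). s ! 0 = t ! 0 \<and> s ! 1 = t ! 1 \<and> s ! 2 \<le> t ! 2
           \<and> length s = 3 \<and> length t = 3
           \<and> [s ! 0, s ! 2, t ! 2] \<in> set (map fst tab) \<and> [s ! 1, s ! 2, t ! 2] \<in> set (map fst tab)
           \<longrightarrow> [s ! 0, s ! 1, s ! 2, t ! 2] \<in> set (map fst tab))
     \<and> (\<forall>s\<in>set (map fst tab). \<forall>t\<in>set (map fst tab). \<not> (length s = 4 \<and> length t = 4 \<and> take 3 s = take 3 t
           \<and> [s ! 2, s ! 3, t ! 3] \<in> set (map fst tab)))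
     \<and> (\<forall>(ls, t)\<in>set tab. distinct ls \<and> (case splits n Ls n (skel Ls Us) ls of (n', E', ps) \<Rightarrow>
          check G (Suc n') (star_edges n' ps E') t))"

lemma mem_skel: "(u, v, l) \<in> set (skel Ls Us) \<longleftrightarrow> l = Long \<and> (u, v) \<in> set Ls \<or> l = Unit \<and> (u, v) \<in> set Us"
  unfolding skel_def by auto

lemma edge_skel: "edge (skel Ls Us) u v \<longleftrightarrow> (u, v) \<in> set (Ls @ Us) \<or> (v, u) \<in> set (Ls @ Us)"
  unfolding edge_iff mem_skel by auto

lemma covered_skel:
  assumes chk: "cover_check n Ls Us Cs"
  shows "covered n (skel Ls Us)"
  unfolding covered_def
proof (intro conjI allI impI)
  show "4 \<le> n" using chk by (simp add: cover_check_def)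
  fix u v assume "u < n"
  define ns where "ns = filter (edge (skel Ls Us) u) [0..<n]"
  have "3 \<le> length ns" "distinct ns" "\<forall>x\<in>set ns. edge (skel Ls Us) u x"
    using chk \<open>u < n\<close> by (auto simp: cover_check_def ns_def)
  then obtain a b c where "a \<in> set ns" "b \<in> set ns" "c \<in> set ns" "a \<noteq> b" "a \<noteq> c" "b \<noteq> c"
    by (cases ns; cases "tl ns"; cases "tl (tl ns)") auto
  then show "\<exists>v1 v2. edge (skel Ls Us) u v1 \<and> edge (skel Ls Us) u v2 \<and> v1 \<noteq> v2 \<and> v1 \<noteq> v \<and> v2 \<noteq> v"
    using \<open>\<forall>x\<in>set ns. _ x\<close> by metis
next
  fix u v assume "edge (skel Ls Us) u v"
  then have uv: "(u, v) \<in> set (Ls @ Us) \<or> (v, u) \<in> set (Ls @ Us)" by (simp only: edge_skel)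
  have "\<exists>c\<in>set Cs. last c = a \<and> hd c = b \<or> last c = b \<and> hd c = a" if "(a, b) \<in> set (Ls @ Us)" for a b
    using chk that unfolding cover_check_def by fast
  then obtain c where "c \<in> set Cs" "last c = u \<and> hd c = v \<or> last c = v \<and> hd c = u"
    using uv by blast
  then have "check_hole (skel Ls Us) c" "{last c, hd c} = {u, v}"
    using chk by (auto simp: cover_check_def)
  then show "\<exists>c. check_hole (skel Ls Us) c \<and> {last c, hd c} = {u, v}" by blast
qed

context graph
begin

lemma img_loc:
  assumes emb: "emb n (skel Ls Us) f I" and x: "x \<in> img n (skel Ls Us) f I"
  shows "\<exists>l. loc_at n Ls f I l x"
proof (cases "x \<in> f ` {..<n}")
  case True
  then show ?thesis unfolding loc_at_def by fastforce
next
  case False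
  then obtain u v l where uvl: "(u, v, l) \<in> set (skel Ls Us)" "x \<in> set (I u v)"
    using x unfolding img_emb[OF emb] by auto
  then have "l \<noteq> Unit" using emb_Unit[OF emb] by fastforce
  then have "(u, v) \<in> set Ls" using uvl(1) mem_skel by blast
  then obtain i where i: "i < length Ls" "Ls ! i = (u, v)" by (meson in_set_conv_nth)
  then have "loc_at n Ls f I (n + i) x" using uvl(2) by (simp add: loc_at_def)
  then show ?thesis ..
qed

lemma loc_on_seg:
  assumes "loc_at n Ls f I l x" "on_seg n Ls l u v"
  shows "x \<in> set (spath f I u v)"
  using assms unfolding loc_at_def on_seg_def set_spath by (auto split: if_splits)

lemma splits_skel:
  assumes emb: "emb n (skel Ls Us) f I" and pd: "pairs_distinct Ls"
    and loc: "list_all2 (loc_at n Ls f I) ls xs" and d: "distinct ls"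
    and spl: "splits n Ls n (skel Ls Us) ls = (n', E', ps)"
  obtains f' I' where "emb n' E' f' I'" "img n' E' f' I' = img n (skel Ls Us) f I" "map f' ps = xs"
    "\<forall>p\<in>set ps. p < n'"
proof -
  have lt: "u < n \<and> v < n" if "(u, v) \<in> set Ls" for u v
    using emb_edge[OF emb, of u v] that by (auto simp: edge_skel)
  have ed: "edge (skel Ls Us) (fst (Ls ! (l - n))) (snd (Ls ! (l - n)))" if l: "l \<in> set ls" "n \<le> l" for l
  proof -
    obtain i where "i < length ls" "ls ! i = l" using l by (meson in_set_conv_nth)
    then have "loc_at n Ls f I l (xs ! i)" using loc list_all2_nthD by blast
    then have "l - n < length Ls" using l(2) by (auto simp: loc_at_def)
    then show ?thesis unfolding edge_skel using nth_mem by fastforce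
  qed
  show ?thesis
    using emb_splits[OF emb order_refl loc distinct_filter[OF d] pd lt ed spl] that by blast
qed

end

context tsf_graph
begin

text \<open>The ends of the ear are made skeleton vertices, the ear is added as a new edge, and the
  certificate for the two locations is evaluated.\<close>

lemma ear_step:
  assumes emb: "emb n (skel Ls Us) f I" and pd: "pairs_distinct Ls" and chk: "ear_check n Ls Us G tab"
    and at: "attached (img n (skel Ls Us) f I) ds x y"
    and xy: "x \<in> img n (skel Ls Us) f I" "y \<in> img n (skel Ls Us) f I" "x \<noteq> y" "bad (skel Ls Us) f I {x, y}"
  shows "\<exists>K\<in>set G. \<exists>f I. emb (fst K) (snd K) f I"
proof -
  let ?E = "skel Ls Us"
  let ?W = "img n ?E f I"
  have main: ?thesis
    if at: "attached ?W ds x y" and l: "loc_at n Ls f I i x" "loc_at n Ls f I j y" "i < j"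
      and xy: "x \<in> ?W" "y \<in> ?W" "x \<noteq> y" "bad ?E f I {x, y}" for ds x y i j
  proof -
    have "\<not> share n Ls Us i j"
    proof
      assume "share n Ls Us i j"
      then obtain u v where uv: "(u, v) \<in> set (Ls @ Us)" "on_seg n Ls i u v" "on_seg n Ls j u v"
        unfolding share_def by blast
      then have "edge ?E u v" unfolding edge_skel by blast
      then show False using loc_on_seg[OF l(1) uv(2)] loc_on_seg[OF l(2) uv(3)] xy(4)
        unfolding bad_def by blast
    qed
    moreover have "j < n + length Ls" using l(2) by (auto simp: loc_at_def)
    ultimately have "(i, j) \<in> set (filter (\<lambda>(i, j). \<not> share n Ls Us i j)
       (concat (map (\<lambda>j. map (\<lambda>i. (i, j)) [0..<j]) [0..<n + length Ls])))"
      using l(3) by force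
    then have "(i, j) \<in> set (map fst tab)" using chk unfolding ear_check_def by simp
    then obtain t where t: "((i, j), t) \<in> set tab" by auto
    obtain n' E' ps where spl: "splits n Ls n ?E [i, j] = (n', E', ps)" by (cases "splits n Ls n ?E [i, j]")
    have c: "\<not> edge E' (ps ! 0) (ps ! 1)" "check G n' ((ps ! 0, ps ! 1, Long) # E') t"
      using chk t spl unfolding ear_check_def by fastforce+
    obtain f' I' where f': "emb n' E' f' I'" "img n' E' f' I' = ?W" "map f' ps = [x, y]" "\<forall>p\<in>set ps. p < n'"
      using splits_skel[OF emb pd _ _ spl, of "[x, y]"] l by auto
    then obtain p q where pq: "ps = [p, q]" "f' p = x" "f' q = y" by auto
    have ds: "ds \<noteq> []" "distinct ds" "set ds \<subseteq> V" "set ds \<inter> ?W = {}"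
      using at by (auto simp: attached_def ipath_def)
    have "emb n' ((p, q, Long) # E') f' (upd I' p q ds)"
    proof (rule emb_place(1)[OF f'(1)])
      show "p < n'" "q < n'" using f'(4) pq by auto
      show "p \<noteq> q" using pq xy(3) by auto
      show "\<not> edge E' p q" using c(1) pq(1) by simp
      show "adj z s \<longleftrightarrow> consec (f' p # ds @ [f' q]) z s" if "z \<in> set ds" "s \<in> img n' E' f' I' \<union> set ds" for z s
        using attached_consec[OF at xy(1,2)] that unfolding f'(2) pq(2,3) by blast
    qed (use ds f'(2) in auto)
    then show ?thesis using emb_check[of n' "(p, q, Long) # E'"] c(2) pq(1) by simp
  qed
  obtain i j where l: "loc_at n Ls f I i x" "loc_at n Ls f I j y"
    using img_loc[OF emb] xy by blast
  \<comment> \<open>Different points with the same location lie inside one long edge and are not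
    bad.\<close>
  have "i \<noteq> j"
  proof
    assume ij: "i = j"
    then have "n \<le> i" using l xy(3) by (auto simp: loc_at_def split: if_splits)
    then have "i - n < length Ls" using l by (auto simp: loc_at_def)
    then have "Ls ! (i - n) \<in> set Ls" by simp
    moreover obtain u v where uv: "Ls ! (i - n) = (u, v)" by (cases "Ls ! (i - n)")
    ultimately have "edge ?E u v" by (simp add: edge_skel)
    moreover have "on_seg n Ls i u v" using uv \<open>n \<le> i\<close> by (simp add: on_seg_def)
    ultimately show False
      using loc_on_seg[OF l(1)] loc_on_seg[OF l(2)] ij xy(4) unfolding bad_def by blast
  qed
  then consider "i < j" | "j < i" by linarith
  then show ?thesis
  proof cases
    case 1
    then show ?thesis using main[OF at l _ xy] by blast
  next
    case 2
    have "bad ?E f I {y, x}" using xy(4) by (simp add: insert_commute)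
    then show ?thesis using main[OF attached_rev[OF at] l(2,1) 2 xy(2,1)] xy(3) by blast
  qed
qed

lemma on_cyc_loc:
  assumes emb: "emb n (skel Ls Us) f I" and c: "check_hole (skel Ls Us) c"
    and l: "on_cyc n Ls c l" "loc_at n Ls f I l x"
  shows "x \<in> set (real_cycle f I c)"
proof (cases "l < n")
  case True
  have "check_cyc (skel Ls Us) c" using c by (simp add: check_hole_def)
  then have "set (real_cycle f I c) = f ` set c \<union> (\<Union>(u, v)\<in>set (cpairs c). set (I u v))"
    by (rule set_real_cycle[OF emb])
  then show ?thesis using True l by (auto simp: on_cyc_def loc_at_def)
next
  case False
  obtain u v where uv: "Ls ! (l - n) = (u, v)" by (cases "Ls ! (l - n)")
  have "l - n < length Ls" using l(2) False by (auto simp: loc_at_def)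
  then have "(u, v) \<in> set Ls" using nth_mem uv by fastforce
  then have e: "edge (skel Ls Us) u v" by (simp add: edge_skel)
  have x: "x \<in> set (spath f I u v)" using l(2) False uv by (simp add: loc_at_def set_spath)
  then have "x \<in> set (spath f I v u)" using spath_rev[OF emb e] by simp
  then show ?thesis using x l(1) False uv emb_hole(5)[OF emb c] by (auto simp: on_cyc_def)
qed

lemma star_step:
  assumes emb: "emb n (skel Ls Us) f I" and pd: "pairs_distinct Ls" and chk: "star_check n Ls Us G Cl Hs tab"
    and w: "w \<in> V - img n (skel Ls Us) f I"
    and T: "T = att (img n (skel Ls Us) f I) {w}" "3 \<le> card T"
  shows "\<exists>K\<in>set G. \<exists>f I. emb (fst K) (snd K) f I"
proof -
  let ?E = "skel Ls Us"
  let ?W = "img n ?E f I"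
  define Exc where "Exc = set (map fst tab)"
  have Cl: "\<And>i j. (i, j) \<in> set Cl \<Longrightarrow> i < n \<and> j < n \<and> i \<noteq> j \<and> (unit_edge ?E i j
        \<or> (\<exists>x\<in>set [0..<n]. unit_edge ?E i x \<and> unit_edge ?E x j))"
    and Hs: "\<And>c ls. (c, ls) \<in> set Hs \<Longrightarrow> check_hole ?E c \<and> (\<forall>l\<in>set ls. on_cyc n Ls c l)"
    and trip: "\<And>i j k. k < n + length Ls \<Longrightarrow> j \<le> k \<Longrightarrow> i \<le> j \<Longrightarrow> \<not> skip n Cl j k \<Longrightarrow> \<not> skip n Cl i j \<Longrightarrow>
        \<not> skip n Cl i k \<Longrightarrow> (\<exists>(c, ls)\<in>set Hs. i \<in> set ls \<and> j \<in> set ls \<and> k \<in> set ls) \<or> [i, j, k] \<in> Exc"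
    and quad: "\<And>a b c d. [a, b, c] \<in> Exc \<Longrightarrow> [a, b, d] \<in> Exc \<Longrightarrow> c \<le> d \<Longrightarrow> [a, c, d] \<in> Exc \<Longrightarrow> [b, c, d] \<in> Exc
        \<Longrightarrow> [a, b, c, d] \<in> Exc"
    and quint: "\<And>a b c d e. [a, b, c, d] \<in> Exc \<Longrightarrow> [a, b, c, e] \<in> Exc \<Longrightarrow> [c, d, e] \<notin> Exc"
    and tab: "\<And>ls t n' E' ps. (ls, t) \<in> set tab \<Longrightarrow> distinct ls \<and> (splits n Ls n ?E ls = (n', E', ps) \<longrightarrow>
          check G (Suc n') (star_edges n' ps E') t)"
  proof -
    note c = chk[unfolded star_check_def, folded Exc_def]
    show "\<And>i j. (i, j) \<in> set Cl \<Longrightarrow> i < n \<and> j < n \<and> i \<noteq> j \<and> (unit_edge ?E i j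
        \<or> (\<exists>x\<in>set [0..<n]. unit_edge ?E i x \<and> unit_edge ?E x j))"
    proof -
      fix i j assume "(i, j) \<in> set Cl"
      moreover from c have "\<forall>(i, j)\<in>set Cl. i < n \<and> j < n \<and> i \<noteq> j \<and> (unit_edge ?E i j
        \<or> (\<exists>x\<in>set [0..<n]. unit_edge ?E i x \<and> unit_edge ?E x j))" by (elim conjE)
      ultimately show "i < n \<and> j < n \<and> i \<noteq> j \<and> (unit_edge ?E i j
        \<or> (\<exists>x\<in>set [0..<n]. unit_edge ?E i x \<and> unit_edge ?E x j))" by fast
    qed
    show "\<And>c ls. (c, ls) \<in> set Hs \<Longrightarrow> check_hole ?E c \<and> (\<forall>l\<in>set ls. on_cyc n Ls c l)"
    proof -
      fix d ls assume "(d, ls) \<in> set Hs"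
      moreover from c have "\<forall>(c, ls)\<in>set Hs. check_hole ?E c \<and> (\<forall>l\<in>set ls. on_cyc n Ls c l)" by (elim conjE)
      ultimately show "check_hole ?E d \<and> (\<forall>l\<in>set ls. on_cyc n Ls d l)" by fast
    qed
    show "(\<exists>(c, ls)\<in>set Hs. i \<in> set ls \<and> j \<in> set ls \<and> k \<in> set ls) \<or> [i, j, k] \<in> Exc"
      if "k < n + length Ls" "j \<le> k" "i \<le> j" "\<not> skip n Cl j k" "\<not> skip n Cl i j" "\<not> skip n Cl i k" for i j k
    proof -
      have m: "k \<in> set [0..<n + length Ls]" "j \<in> set [0..<Suc k]" "i \<in> set [0..<Suc j]"
        using that(1-3) by auto
      from c have "\<forall>k\<in>set [0..<n + length Ls]. \<forall>j\<in>set [0..<Suc k]. skip n Cl j k \<or>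
         (\<forall>i\<in>set [0..<Suc j]. skip n Cl i j \<or> skip n Cl i k
           \<or> (\<exists>(c, ls)\<in>set Hs. i \<in> set ls \<and> j \<in> set ls \<and> k \<in> set ls) \<or> [i, j, k] \<in> Exc)" by (elim conjE)
      then show ?thesis using m that(4-6) by blast
    qed
    show "[a, b, c, d] \<in> Exc" if "[a, b, c] \<in> Exc" "[a, b, d] \<in> Exc" "c \<le> d" "[a, c, d] \<in> Exc" "[b, c, d] \<in> Exc"
      for a b c d
    proof -
      from c have "\<forall>s\<in>Exc. \<forall>t\<in>Exc. s ! 0 = t ! 0 \<and> s ! 1 = t ! 1 \<and> s ! 2 \<le> t ! 2
           \<and> length s = 3 \<and> length t = 3 \<and> [s ! 0, s ! 2, t ! 2] \<in> Exc \<and> [s ! 1, s ! 2, t ! 2] \<in> Exc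
           \<longrightarrow> [s ! 0, s ! 1, s ! 2, t ! 2] \<in> Exc" by (elim conjE)
      from this[rule_format, OF that(1,2)] show ?thesis using that by simp
    qed
    show "[c, d, e] \<notin> Exc" if "[a, b, c, d] \<in> Exc" "[a, b, c, e] \<in> Exc" for a b c d e
    proof -
      from c have "\<forall>s\<in>Exc. \<forall>t\<in>Exc. \<not> (length s = 4 \<and> length t = 4 \<and> take 3 s = take 3 t
           \<and> [s ! 2, s ! 3, t ! 3] \<in> Exc)" by (elim conjE)
      from this[rule_format, OF that] show ?thesis by simp
    qed
    show "distinct ls \<and> (splits n Ls n ?E ls = (n', E', ps) \<longrightarrow>
          check G (Suc n') (star_edges n' ps E') t)" if "(ls, t) \<in> set tab" for ls t n' E' ps
    proof -
      from c have "\<forall>(ls, t)\<in>set tab. distinct ls \<and> (case splits n Ls n (skel Ls Us) ls of (n', E', ps) \<Rightarrow>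
          check G (Suc n') (star_edges n' ps E') t)" by (elim conjE)
      then show ?thesis using that by fastforce
    qed
  qed
  have finT: "finite T" using finV emb_V[OF emb] T(1) unfolding att_def by (simp add: finite_subset)
  have TW: "x \<in> ?W" "adj w x" if "x \<in> T" for x using that unfolding T(1) att_def by auto
  define loc where "loc x = (SOME l. loc_at n Ls f I l x)" for x
  have loc: "loc_at n Ls f I (loc x) x" if "x \<in> T" for x
    unfolding loc_def by (rule someI_ex) (rule img_loc[OF emb TW(1)[OF that]])
  obtain us where us: "set us = T" "distinct us" using finite_distinct_list[OF finT] by blast
  \<comment> \<open>Sorting by location brings the neighbours into the order of the keys of the
    table.\<close>
  define ts where "ts = sort_key loc us"
  have ts: "set ts = T" "distinct ts" "sorted (map loc ts)" unfolding ts_def using us by auto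
  define ls where "ls = map loc ts"
  have lenT: "length ls = length ts" "length ts = card T" using ts distinct_card by (fastforce simp: ls_def)+
  have la: "list_all2 (loc_at n Ls f I) ls ts"
    unfolding list_all2_conv_all_nth using ts(1) loc by (auto simp: ls_def)
  \<comment> \<open>Neighbours of \<open>w\<close> at locations listed in \<open>Cl\<close> are
    joined by one or two unit edges and would form a triangle or a square with
    \<open>w\<close>.\<close>
  have noskip: "\<not> skip n Cl (loc x) (loc y)" if xy: "x \<in> T" "y \<in> T" "x \<noteq> y" for x y
  proof
    note lx = loc[OF xy(1)] and ly = loc[OF xy(2)]
    assume "skip n Cl (loc x) (loc y)"
    then consider "loc x = loc y" "loc x < n" | "(loc x, loc y) \<in> set Cl" unfolding skip_def by blast
    then show False
    proof cases
      case 1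
      then show False using lx ly xy(3) by (simp add: loc_at_def)
    next
      case 2
      note cl = Cl[OF 2]
      have f: "x = f (loc x)" "y = f (loc y)" using cl lx ly by (auto simp: loc_at_def)
      have wxy: "adj w x" "adj w y" using TW xy by auto
      show False
      proof (cases "unit_edge ?E (loc x) (loc y)")
        case True
        then have "adj x y" using emb_unit_edge[OF emb] f by metis
        then show False using no_triangle[of w x y] wxy adj_sym by blast
      next
        case False
        then obtain z where "unit_edge ?E (loc x) z" "unit_edge ?E z (loc y)" using cl by blast
        then have z: "adj x (f z)" "adj (f z) y" "z < n" using emb_unit_edge[OF emb] f by metis+
        then have "w = f z \<or> x = y" using no_square[of w x "f z" y] wxy adj_sym by blast
        then show False using xy(3) w z(3) by (auto simp: img_def)
      qed
    qed
  qed
  \<comment> \<open>No three neighbours lie on a hole, by \<open>hole_nbrs\<close>; so each triple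
    of neighbours must be a key.\<close>
  have exc: "[ls ! i, ls ! j, ls ! k] \<in> Exc" if ijk: "i < j" "j < k" "k < length ts" for i j k
  proof -
    let ?x = "ts ! i" and ?y = "ts ! j" and ?z = "ts ! k"
    have mem: "?x \<in> T" "?y \<in> T" "?z \<in> T" using ts(1) ijk by auto
    have ne: "?x \<noteq> ?y" "?x \<noteq> ?z" "?y \<noteq> ?z" using ts(2) ijk by (auto simp: nth_eq_iff_index_eq)
    have l: "ls ! i = loc ?x" "ls ! j = loc ?y" "ls ! k = loc ?z" using ijk by (auto simp: ls_def)
    have so: "loc ?x \<le> loc ?y" "loc ?y \<le> loc ?z"
      using sorted_nth_mono[OF ts(3), of i j] sorted_nth_mono[OF ts(3), of j k] ijk by auto
    have "loc ?z < n + length Ls" using loc[OF mem(3)] by (simp add: loc_at_def)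
    from trip[OF this so(2,1)] have "(\<exists>(c, ls)\<in>set Hs. loc ?x \<in> set ls \<and> loc ?y \<in> set ls \<and> loc ?z \<in> set ls)
        \<or> [loc ?x, loc ?y, loc ?z] \<in> Exc"
      using noskip mem ne by blast
    moreover have False if "(c, hs) \<in> set Hs" "loc ?x \<in> set hs \<and> loc ?y \<in> set hs \<and> loc ?z \<in> set hs" for c hs
    proof -
      have c: "check_hole ?E c" using Hs that by blast
      have "?x \<in> set (real_cycle f I c)" "?y \<in> set (real_cycle f I c)" "?z \<in> set (real_cycle f I c)"
        using on_cyc_loc[OF emb c _ loc] mem Hs that by blast+
      then have "card {?x, ?y, ?z} \<le> 2"
        using hole_nbrs[OF emb_hole(1)[OF emb c] emb_hole(2)[OF emb c], of w "{?x, ?y, ?z}"]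
          emb_hole(3)[OF emb c] w TW mem by blast
      then show False using ne by simp
    qed
    ultimately show ?thesis unfolding l by blast
  qed
  have len3: "3 \<le> length ts" using lenT T(2) by simp
  have le: "ls ! i \<le> ls ! j" if "i < j" "j < length ts" for i j
    using sorted_nth_mono[OF ts(3), of i j] that by (simp add: ls_def)
  \<comment> \<open>The closure condition of the table combines four triples into a
    quadruple.\<close>
  have q4: "[ls ! 0, ls ! 1, ls ! 2, ls ! k] \<in> Exc" if "2 < k" "k < length ts" for k
    by (rule quad) (use exc[of 0 1 2] exc[of 0 1 k] exc[of 0 2 k] exc[of 1 2 k] le[of 2 k] that in auto)
  \<comment> \<open>Five neighbours would yield two quadruples with the same first three entries and
    a triple of the last entries, a combination that the table excludes.\<close>
  have "\<not> 5 \<le> length ts"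
    using quint[OF q4[of 3] q4[of 4]] exc[of 2 3 4] by auto
  then consider "length ls = 3" | "length ls = 4" using len3 lenT by linarith
  then have "ls \<in> Exc"
  proof cases
    case 1
    then have "ls = [ls ! 0, ls ! 1, ls ! 2]" by (auto simp: numeral_3_eq_3 length_Suc_conv)
    then show ?thesis using exc[of 0 1 2] 1 lenT by simp
  next
    case 2
    then have "ls = [ls ! 0, ls ! 1, ls ! 2, ls ! 3]"
      by (auto simp: eval_nat_numeral length_Suc_conv)
    then show ?thesis using q4[of 3] 2 lenT by simp
  qed
  then obtain t where t: "(ls, t) \<in> set tab" unfolding Exc_def by auto
  obtain n' E' ps where spl: "splits n Ls n ?E ls = (n', E', ps)" by (cases "splits n Ls n ?E ls")
  have c: "distinct ls" "check G (Suc n') (star_edges n' ps E') t" using tab[OF t] spl by blast+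
  obtain f' I' where f': "emb n' E' f' I'" "img n' E' f' I' = ?W" "map f' ps = ts" "\<forall>p\<in>set ps. p < n'"
    using splits_skel[OF emb pd la c(1) spl] by blast
  have "f' ` set ps = T" using arg_cong[OF f'(3), of set] ts(1) by simp
  then have "adj w x \<longleftrightarrow> x \<in> f' ` set ps" if "x \<in> img n' E' f' I'" for x
    using that unfolding f'(2) T(1) att_def by auto
  then show ?thesis
    using emb_check[OF emb_star[OF f'(1), of w ps] c(2)] w f'(2,4) by blast
qed

text \<open>The case distinction ranges over all embeddings of the skeleton, because
  \<open>bad_component\<close> returns a rerouted one. If none has a bad connected set, the given
  embedding either covers \<open>V\<close> and yields a 2-extension or leaves a vertex to which
  \<open>unattached_cutset\<close> applies.\<close>

lemma skeleton_step:
  assumes emb: "emb n (skel Ls Us) f I" and cov: "cover_check n Ls Us Cs"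
    and ear: "ear_check n Ls Us G tab" and star: "star_check n Ls Us G Cl Hs tab'"
    and ext: "check_ext VH adjH g (halve n (skel Ls Us) Ls)"
  shows "two_extension V adj VH adjH \<or> has_1_cutset V adj \<or> has_proper_2_cutset V adj
    \<or> (\<exists>K\<in>set G. \<exists>f I. emb (fst K) (snd K) f I)"
proof (cases "\<exists>f I C. emb n (skel Ls Us) f I \<and> conn_set C \<and> C \<subseteq> V - img n (skel Ls Us) f I
    \<and> bad (skel Ls Us) f I (att (img n (skel Ls Us) f I) C)")
  case True
  let ?E = "skel Ls Us"
  note cov' = covered_skel[OF cov]
  have pd: "pairs_distinct Ls" using cov by (simp add: cover_check_def)
  from True obtain f I where emb: "emb n ?E f I"
    and cases: "(\<exists>w\<in>V - img n ?E f I. bad ?E f I (att (img n ?E f I) {w}))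
      \<or> (\<exists>ds x y. attached (img n ?E f I) ds x y \<and> x \<in> img n ?E f I \<and> y \<in> img n ?E f I \<and> bad ?E f I {x, y})"
    using bad_component[OF cov'] by blast
  let ?W = "img n ?E f I"
  have single: "\<not> bad ?E f I S" if "x \<in> ?W" "S \<subseteq> {x}" for S x by (rule img_bad_single[OF cov' that])
  have ear': ?thesis if "attached ?W ds x y" "x \<in> ?W" "y \<in> ?W" "bad ?E f I {x, y}" for ds x y
  proof -
    have "x \<noteq> y" using single[of x "{x, y}"] that by auto
    then show ?thesis using ear_step[OF emb pd ear that(1-3) _ that(4)] by blast
  qed
  from cases show ?thesis
  proof (elim disjE bexE exE conjE)
    fix w assume w: "w \<in> V - ?W" and bad: "bad ?E f I (att ?W {w})"
    let ?T = "att ?W {w}"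
    have fin: "finite ?T" using finV emb_V[OF emb] unfolding att_def by (simp add: finite_subset)
    have "f 0 \<in> ?W" using cov unfolding cover_check_def by (auto simp: img_def)
    then have "?T \<noteq> {}" using single[of "f 0" ?T] bad by auto
    moreover have "\<not> (\<exists>x. ?T = {x})"
    proof
      assume "\<exists>x. ?T = {x}"
      then obtain x where x: "?T = {x}" by blast
      then have "x \<in> ?W" unfolding att_def by auto
      then show False using single[of x ?T] bad x by simp
    qed
    ultimately have "card ?T \<noteq> 0" "card ?T \<noteq> 1" using fin by (auto simp: card_1_singleton_iff)
    then consider "card ?T = 2" | "3 \<le> card ?T" by linarith
    then show ?thesis
    proof cases
      \<comment> \<open>A vertex with exactly two attachments is an ear and belongs to the ear
        table.\<close>
      case 1
      then obtain x y where xy: "?T = {x, y}" "x \<noteq> y" by (auto simp: card_2_iff)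
      then have "x \<in> ?W" "y \<in> ?W" unfolding att_def by auto
      moreover have "attached ?W [w] x y"
        unfolding attached_def ipath_def using w xy unfolding att_def by auto
      ultimately show ?thesis using ear' bad xy by metis
    next
      case 2
      then show ?thesis using star_step[OF emb pd star w refl] by blast
    qed
  next
    fix ds x y assume "attached ?W ds x y" "x \<in> ?W" "y \<in> ?W" "bad ?E f I {x, y}"
    then show ?thesis by (rule ear')
  qed
next
  case False
  let ?E = "skel Ls Us"
  show ?thesis
  proof (cases "img n ?E f I = V")
    case True
    have "pairs_distinct Ls" "\<forall>(u, v)\<in>set Ls. (u, v, Long) \<in> set ?E"
      using cov by (auto simp: cover_check_def mem_skel)
    then obtain f' I' where "emb (fst (halve n ?E Ls)) (snd (halve n ?E Ls)) f' I'"
      "img (fst (halve n ?E Ls)) (snd (halve n ?E Ls)) f' I' = V"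
      using emb_halve[OF True emb] by blast
    then show ?thesis using emb_two_extension ext by (metis prod.collapse)
  next
    case F: False
    then obtain w where "w \<in> V - img n ?E f I" using emb_V[OF emb] by blast
    then show ?thesis using unattached_cutset[OF covered_skel[OF cov] emb] False emb by blast
  qed
qed

end

subsection \<open>Triangles and squares\<close>

context graph
begin

lemma no_cutvertex_walk:
  assumes "\<not> has_1_cutset V adj" "u \<in> V" "x \<in> V - {u}" "y \<in> V - {u}"
  shows "\<exists>p. walk (V - {u}) p \<and> hd p = x \<and> last p = y"
proof (rule ccontr)
  assume no: "\<not> ?thesis"
  let ?X = "comp (V - {u}) x"
  have "has_1_cutset V adj"
    unfolding has_1_cutset_def
  proof (intro exI conjI)
    show "u \<in> V" by fact
    show "?X \<union> (V - {u} - ?X) = V - {u}" using comp_subset by blast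
    show "?X \<inter> (V - {u} - ?X) = {}" by blast
    show "?X \<noteq> {}" using comp_self[OF assms(3)] by blast
    have "y \<notin> ?X" using no unfolding comp_def by blast
    then show "V - {u} - ?X \<noteq> {}" using assms(4) by blast
    show "\<forall>a\<in>?X. \<forall>b\<in>V - {u} - ?X. \<not> adj a b"
    proof (intro ballI notI)
      fix a b assume "a \<in> ?X" "b \<in> V - {u} - ?X" "adj a b"
      then show False using comp_closed[of a "V - {u}" x b] by simp
    qed
  qed
  then show False using assms(1) by blast
qed

end

context unichord_free_graph
begin

text \<open>Take a largest clique containing the triangle and a component outside it with two
  attachments. A vertex that sees \<open>x\<close> and \<open>y\<close> but misses \<open>z\<close>
  in the clique gives the cycle \<open>d x z y\<close>, and an ear at \<open>x\<close> and
  \<open>y\<close> extends the triangle \<open>x z y\<close>. Either way \<open>xy\<close> is the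
  only chord.\<close>

lemma triangle_case:
  assumes no1: "\<not> has_1_cutset V adj" and tri: "adj a b" "adj b c" "adj c a"
  shows "complete_graph V adj"
proof (rule ccontr)
  assume nc: "\<not> complete_graph V adj"
  define Q where "Q K \<longleftrightarrow> K \<subseteq> V \<and> {a, b, c} \<subseteq> K \<and> (\<forall>x\<in>K. \<forall>y\<in>K. x \<noteq> y \<longrightarrow> adj x y)" for K
  have "Q {a, b, c}" using tri adj_sym adjV unfolding Q_def by auto
  moreover have "\<forall>K. Q K \<longrightarrow> card K < Suc (card V)"
    unfolding Q_def using card_mono[OF finV] by (auto simp: less_Suc_eq_le)
  ultimately obtain K where K: "Q K" and max: "\<And>L. Q L \<Longrightarrow> card L \<le> card K"
    using ex_has_greatest_nat[of Q "{a, b, c}" card "Suc (card V)"] by blast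
  have KV: "K \<subseteq> V" and abc: "a \<in> K" "b \<in> K" "c \<in> K" and cl: "\<And>x y. x \<in> K \<Longrightarrow> y \<in> K \<Longrightarrow> x \<noteq> y \<Longrightarrow> adj x y"
    using K unfolding Q_def by auto
  have ne: "a \<noteq> b" "b \<noteq> c" "a \<noteq> c" using tri by auto
  have "K \<noteq> V" using nc cl unfolding complete_graph_def by blast
  then obtain w where w: "w \<in> V - K" using KV by blast
  obtain x0 y0 where xy0: "x0 \<in> att K (comp (V - K) w)" "y0 \<in> att K (comp (V - K) w)" "x0 \<noteq> y0"
    using two_attachments[OF no1 KV abc(1,2) ne(1) w] .
  have third: "\<exists>z\<in>K. z \<noteq> x \<and> z \<noteq> y" for x y using abc ne by metis
  have nx: "\<exists>z\<in>K. \<not> adj d z" if d: "d \<in> V - K" for d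
  proof (rule ccontr)
    assume "\<not> ?thesis"
    then have "Q (insert d K)" using d K adj_sym unfolding Q_def by auto
    then have "card (insert d K) \<le> card K" by (rule max)
    then show False using d finite_subset[OF KV finV] by simp
  qed
  show False
  proof (rule attached_walk[OF conn_set_comp comp_subset xy0])
    fix d x y assume d: "d \<in> comp (V - K) w" "x \<noteq> y" "{x, y} \<subseteq> att K {d}"
    have dV: "d \<in> V - K" using d(1) comp_subset by blast
    have xy: "x \<in> K" "y \<in> K" "adj d x" "adj d y" using d(3) unfolding att_def by auto
    obtain z where z: "z \<in> K" "\<not> adj d z" using nx[OF dV] by blast
    have zxy: "z \<noteq> x" "z \<noteq> y" using z xy by auto
    show False
    proof (rule no_unichord[of "[d, x, z, y]" x y])
      show "is_cycle V adj [d, x, z, y]"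
        unfolding is_cycle_eq using dV xy z zxy d(2) KV cl adj_sym by auto
      show "x \<in> set [d, x, z, y]" "y \<in> set [d, x, z, y]" "adj x y" using cl xy d(2) by auto
      show "\<not> consec ([d, x, z, y] @ [hd [d, x, z, y]]) x y"
        using dV xy zxy d(2) by (auto simp: consec_Cons doubleton_eq_iff)
      show "consec ([d, x, z, y] @ [hd [d, x, z, y]]) s t \<or> {s, t} = {x, y}"
        if "s \<in> set [d, x, z, y]" "t \<in> set [d, x, z, y]" "adj s t" for s t
        using that z(2) adj_sym[OF that(3)] by (auto simp: consec_Cons)
    qed
  next
    fix ds x y assume ds: "set ds \<subseteq> comp (V - K) w" "attached K ds x y" "x \<noteq> y" "x \<in> K" "y \<in> K"
    obtain z where z: "z \<in> K" "z \<noteq> x" "z \<noteq> y" using third by blast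
    have hole: "consec ([x, z, y] @ [hd [x, z, y]]) s t" if "s \<in> set [x, z, y]" "t \<in> set [x, z, y]" "adj s t" for s t
      using that by (auto simp: consec_Cons)
    show False
    proof (rule hole_ear[of "[x, z, y]" x y ds])
      show "is_cycle V adj [x, z, y]"
        unfolding is_cycle_eq using ds z KV cl by auto
      show "consec ([x, z, y] @ [hd [x, z, y]]) x y" by (auto simp: consec_Cons)
      show "attached (set [x, z, y]) ds x y" using attached_mono[OF ds(2)] ds z by auto
    qed (rule hole)
  qed
qed

text \<open>Size is measured by the sum of both sides of the complete bipartite subgraph. If no
  outside walk leads from a neighbour of \<open>A\<close> to one of \<open>B\<close>, then
  \<open>A\<close> and all that it reaches form one side of the 1-join. Otherwise a shortest such
  walk closes to a cycle with one chord.\<close>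

lemma square_case:
  assumes tf: "\<And>x y z. adj x y \<Longrightarrow> adj y z \<Longrightarrow> \<not> adj z x"
    and sq: "adj a b" "adj b c" "adj c d" "adj d a" "a \<noteq> c" "b \<noteq> d"
  shows "has_proper_1_join V adj"
proof (rule ccontr)
  assume nj: "\<not> has_proper_1_join V adj"
  define Q where "Q P \<longleftrightarrow> fst P \<subseteq> V \<and> snd P \<subseteq> V \<and> {a, c} \<subseteq> fst P \<and> {b, d} \<subseteq> snd P
     \<and> (\<forall>x\<in>fst P. \<forall>y\<in>snd P. adj x y)" for P
  have "Q ({a, c}, {b, d})" using sq adj_sym adjV unfolding Q_def by auto
  moreover have "\<forall>P. Q P \<longrightarrow> card (fst P) + card (snd P) < Suc (card V + card V)"
    unfolding Q_def using card_mono[OF finV] by (metis add_mono less_Suc_eq_le)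
  ultimately obtain P where P: "Q P" and max: "\<And>L. Q L \<Longrightarrow> card (fst L) + card (snd L) \<le> card (fst P) + card (snd P)"
    using ex_has_greatest_nat[of Q "({a, c}, {b, d})" "\<lambda>P. card (fst P) + card (snd P)" "Suc (card V + card V)"] by blast
  obtain A B where AB: "P = (A, B)" by (cases P)
  have AV: "A \<subseteq> V" and BV: "B \<subseteq> V" and ac: "a \<in> A" "c \<in> A" and bd: "b \<in> B" "d \<in> B"
    and join: "\<And>x y. x \<in> A \<Longrightarrow> y \<in> B \<Longrightarrow> adj x y"
    using P unfolding Q_def AB by auto
  have stA: "\<not> adj x y" if "x \<in> A" "y \<in> A" for x y using tf[of x y b] join[OF that(2) bd(1)] join[OF that(1) bd(1)] adj_sym by blast
  have stB: "\<not> adj x y" if "x \<in> B" "y \<in> B" for x y using tf[of x y a] join[OF ac(1) that(1)] join[OF ac(1) that(2)] adj_sym by blast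
  have disj: "A \<inter> B = {}" using stA join by blast
  have finA: "finite A" and finB: "finite B" using AV BV finV finite_subset by blast+
  \<comment> \<open>A vertex complete to \<open>A\<close> could be moved into \<open>B\<close>,
    contrary to maximality.\<close>
  have missA: "\<exists>x\<in>A. \<not> adj z x" if z: "z \<in> V - B" for z
  proof (rule ccontr)
    assume "\<not> ?thesis"
    then have "Q (A, insert z B)" using z P adj_sym unfolding Q_def AB by auto
    then have "card A + card (insert z B) \<le> card A + card B" using max AB by fastforce
    then show False using z finB by simp
  qed
  have missB: "\<exists>x\<in>B. \<not> adj z x" if z: "z \<in> V - A" for z
  proof (rule ccontr)
    assume "\<not> ?thesis"
    then have "Q (insert z A, B)" using z P adj_sym unfolding Q_def AB by auto
    then have "card (insert z A) + card B \<le> card A + card B" using max AB by fastforce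
    then show False using z finA by simp
  qed
  define U where "U = V - (A \<union> B)"
  define R where "R s t \<longleftrightarrow> (\<exists>x\<in>A. adj s x) \<and> (\<exists>y\<in>B. adj t y)" for s t
  have "\<exists>q. walk U q \<and> R (hd q) (last q)"
  proof (rule ccontr)
    assume no: "\<not> ?thesis"
    define X where "X = A \<union> {z. \<exists>q. walk U q \<and> (\<exists>x\<in>A. adj (hd q) x) \<and> last q = z}"
    have XU: "z \<in> U" if "z \<in> X" "z \<notin> A" for z
      using that unfolding X_def walk_def by auto
    have closed: "y \<in> X" if x: "x \<in> X" and y: "adj x y" "y \<in> U" for x y
    proof (cases "x \<in> A")
      case True
      then have "\<exists>x\<in>A. adj y x" using adj_sym[OF y(1)] by blast
      then show ?thesis using y(2) unfolding X_def by (auto intro!: exI[of _ "[y]"])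
    next
      case False
      then obtain q where q: "walk U q" "\<exists>x\<in>A. adj (hd q) x" "last q = x" using x unfolding X_def by blast
      have "walk U (q @ [y])" using walk_append[OF q(1), of "[y]"] y q(3) by simp
      moreover have "hd (q @ [y]) = hd q" using q(1) by (cases q) (auto simp: walk_def)
      ultimately show ?thesis using q(2) unfolding X_def by (auto intro!: exI[of _ "q @ [y]"])
    qed
    have "has_proper_1_join V adj"
      unfolding has_proper_1_join_def
    proof (intro exI conjI)
      show "X \<union> (V - X) = V" using XU AV unfolding U_def by blast
      show "X \<inter> (V - X) = {}" by blast
      show "A \<subseteq> X" unfolding X_def by blast
      show "B \<subseteq> V - X" using BV XU disj unfolding U_def by blast
      show "stable adj A" "stable adj B" using stA stB unfolding stable_def by blast+
      have "card {a, c} \<le> card A" "card {b, d} \<le> card B"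
        using ac bd finA finB by (auto intro!: card_mono)
      then show "2 \<le> card A" "2 \<le> card B" using sq by auto
      show "\<forall>x\<in>X. \<forall>y\<in>V - X. adj x y \<longleftrightarrow> x \<in> A \<and> y \<in> B"
      proof (intro ballI iffI)
        fix x y assume xy: "x \<in> X" "y \<in> V - X" "adj x y"
        have yB: "y \<in> B"
        proof (rule ccontr)
          assume "y \<notin> B"
          then have "y \<in> U" using xy(2) unfolding U_def X_def by blast
          then show False using closed[OF xy(1,3)] xy(2) by blast
        qed
        moreover have "x \<in> A"
        proof (rule ccontr)
          assume "x \<notin> A"
          then obtain q where q: "walk U q" "\<exists>x\<in>A. adj (hd q) x" "last q = x" using xy(1) unfolding X_def by blast
          then have "R (hd q) (last q)" using yB xy(3) unfolding R_def by blast
          then show False using no q(1) by blast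
        qed
        ultimately show "x \<in> A \<and> y \<in> B" by blast
      qed (use join in blast)
    qed
    then show False using nj by blast
  qed
  then obtain q where q: "walk U q" "R (hd q) (last q)" by blast
  obtain p where p: "walk U p" "R (hd p) (last p)" "ipath p"
    and min: "\<And>p'. walk U p' \<Longrightarrow> R (hd p') (last p') \<Longrightarrow> length p \<le> length p'"
    using minimal_walk[of U q R, OF q(1) q(2)] by metis
  obtain x y where x: "x \<in> A" "adj (hd p) x" and y: "y \<in> B" "adj (last p) y"
    using p(2) unfolding R_def by blast
  have pne: "p \<noteq> []" "set p \<subseteq> U" using p(1) by (auto simp: walk_def)
  then have ends: "hd p \<in> set p" "last p \<in> set p" by auto
  have onlyA: "e = hd p" if e: "e \<in> set p" "z \<in> A" "adj e z" for e z
  proof -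
    obtain s t where st: "p = s @ e # t" using e by (meson split_list)
    have "walk U (e # t)" using p(1) walk_appendD2[of U s "e # t"] st by simp
    moreover have "R (hd (e # t)) (last (e # t))" unfolding R_def using e y st by auto
    ultimately have "length p \<le> length (e # t)" by (rule min)
    then show ?thesis using st by simp
  qed
  have onlyB: "e = last p" if e: "e \<in> set p" "z \<in> B" "adj e z" for e z
  proof -
    obtain s t where st: "p = s @ e # t" using e by (meson split_list)
    have "walk U (s @ [e])" using p(1) walk_appendD1[of U "s @ [e]" t] st by simp
    moreover have "R (hd (s @ [e])) (last (s @ [e]))"
      unfolding R_def using e x st by (cases s) auto
    ultimately have "length p \<le> length (s @ [e])" by (rule min)
    then show ?thesis using st by simp
  qed
  have pV: "hd p \<in> V - B" "last p \<in> V - A" using ends pne(2) unfolding U_def by auto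
  \<comment> \<open>The cycle returns from \<open>y\<close> to \<open>x\<close> through
    \<open>x'\<close> and \<open>y'\<close>. As these are not adjacent to the ends of the walk,
    \<open>xy\<close> is the only chord.\<close>
  obtain x' where x': "x' \<in> A" "\<not> adj (hd p) x'" using missA[OF pV(1)] by blast
  obtain y' where y': "y' \<in> B" "\<not> adj (last p) y'" using missB[OF pV(2)] by blast
  have neq: "x \<noteq> x'" "y \<noteq> y'" using x x' y y' by auto
  have noA: "z \<notin> set p" if "z \<in> A \<union> B" for z using that pne(2) unfolding U_def by blast
  have AB': "s \<noteq> t" if "s \<in> A" "t \<in> B" for s t using that disj by blast
  let ?c = "x # p @ [y, x', y']"
  have cc: "consec (?c @ [hd ?c]) s t \<longleftrightarrow> consec p s t \<or> {s, t} = {x, hd p} \<or> {s, t} = {last p, y}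
    \<or> {s, t} = {y, x'} \<or> {s, t} = {x', y'} \<or> {s, t} = {y', x}" for s t
  proof -
    have "consec (?c @ [hd ?c]) s t \<longleftrightarrow> consec (x # p @ [y]) s t \<or> consec [y, x', y', x] s t"
      using consec_glue[of x p y "[x', y', x]" s t] by simp
    moreover have "consec [y, x', y', x] s t \<longleftrightarrow> {s, t} = {y, x'} \<or> {s, t} = {x', y'} \<or> {s, t} = {y', x}"
      by (simp add: consec_Cons)
    ultimately show ?thesis using consec_capped[OF pne(1), of x y s t] by (simp only: disj_assoc)
  qed
  have no: "\<not> consec p s t" if "s \<in> A \<union> B \<or> t \<in> A \<union> B" for s t
    using that noA consec_in_set[of p s t] by blast
  show False
  proof (rule no_unichord[of ?c x y])
    show "is_cycle V adj ?c"
      unfolding is_cycle_eq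
    proof (intro conjI)
      show "distinct ?c"
        using p(3) noA x(1) y(1) x'(1) y'(1) neq AB' unfolding ipath_def by auto
      show "set ?c \<subseteq> V" using x y x' y' AV BV pne(2) unfolding U_def by auto
      show "successively adj (?c @ [hd ?c])"
        unfolding successively_iff_consec cc
      proof (intro allI impI)
        fix s t assume st: "consec p s t \<or> {s, t} = {x, hd p} \<or> {s, t} = {last p, y}
          \<or> {s, t} = {y, x'} \<or> {s, t} = {x', y'} \<or> {s, t} = {y', x}"
        have "successively adj p" using p(3) by (simp add: ipath_def)
        then have "consec p s t \<Longrightarrow> adj s t" unfolding successively_iff_consec by blast
        then show "adj s t"
          using st x y join[OF x'(1) y(1)] join[OF x'(1) y'(1)] join[OF x(1) y'(1)] adj_sym
          by (auto simp: doubleton_eq_iff)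
      qed
    qed (use pne in \<open>cases p; simp\<close>)
    show "x \<in> set ?c" "y \<in> set ?c" "adj x y" using join x y by auto
    show "\<not> consec (?c @ [hd ?c]) x y"
    proof -
      have "x \<noteq> y" "x \<noteq> y'" "x' \<noteq> y" "x' \<noteq> y'" using AB' x(1) y(1) x'(1) y'(1) by auto
      moreover have "hd p \<noteq> x" "hd p \<noteq> y" "last p \<noteq> x" "last p \<noteq> y"
        using noA[of x] noA[of y] ends x(1) y(1) by auto
      moreover have "\<not> consec p x y" using no x(1) by blast
      ultimately show ?thesis unfolding cc using neq by (auto simp: doubleton_eq_iff)
    qed
    fix s t assume st: "s \<in> set ?c" "t \<in> set ?c" "adj s t"
    have pp: "consec p s t" if "s \<in> set p" "t \<in> set p" "adj s t" for s t
      using p(3) that unfolding ipath_def by blast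
    have mixed: "{s, t} = {x, hd p} \<or> {s, t} = {last p, y}" if "s \<in> set p" "t \<in> {x, y, x', y'}" "adj s t" for s t
      using that onlyA[of s t] onlyB[of s t] x(1) y(1) x' y' by auto
    show "consec (?c @ [hd ?c]) s t \<or> {s, t} = {x, y}"
    proof (cases "s \<in> set p")
      case True
      show ?thesis
      proof (cases "t \<in> set p")
        case t: True
        then show ?thesis using pp[OF True t st(3)] unfolding cc by blast
      next
        case False
        then have "t \<in> {x, y, x', y'}" using st(2) by auto
        then have "{s, t} = {x, hd p} \<or> {s, t} = {last p, y}" by (rule mixed[OF True _ st(3)])
        then show ?thesis unfolding cc by (elim disjE) simp_all
      qed
    next
      case False
      then have s: "s \<in> {x, y, x', y'}" using st(1) by auto
      show ?thesis
      proof (cases "t \<in> set p")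
        case True
        then have "{t, s} = {x, hd p} \<or> {t, s} = {last p, y}" using mixed[OF True s adj_sym[OF st(3)]] by blast
        then have "{s, t} = {x, hd p} \<or> {s, t} = {last p, y}" by (simp add: insert_commute)
        then show ?thesis unfolding cc by (elim disjE) simp_all
      next
        case False
        then have t: "t \<in> {x, y, x', y'}" using st(2) by auto
        have "\<not> (s \<in> A \<and> t \<in> A)" "\<not> (s \<in> B \<and> t \<in> B)" using stA stB st(3) by blast+
        then have "s \<in> {x, x'} \<and> t \<in> {y, y'} \<or> s \<in> {y, y'} \<and> t \<in> {x, x'}"
          using s t x(1) x'(1) y(1) y'(1) by blast
        then have "{s, t} = {x, y} \<or> {s, t} = {y, x'} \<or> {s, t} = {x', y'} \<or> {s, t} = {y', x}"
          by (elim disjE conjE insertE emptyE) (simp_all add: insert_commute)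
        then show ?thesis unfolding cc by (elim disjE) simp_all
      qed
    qed
  qed
qed

end

subsection \<open>Chorded cycles\<close>

context graph
begin

text \<open>In a shortest chorded cycle any two chords cross, as otherwise one of them is a shortcut that keeps
  the other. A third chord would give a shorter chorded cycle through two crossing ones.\<close>

definition crossing :: "'a \<Rightarrow> 'a list \<Rightarrow> 'a \<Rightarrow> 'a list \<Rightarrow> 'a \<Rightarrow> 'a list \<Rightarrow> 'a \<Rightarrow> 'a list \<Rightarrow> bool" where
  "crossing x A z B y C z' D \<longleftrightarrow> is_cycle V adj (x # A @ z # B @ y # C @ z' # D) \<and> adj x y \<and> adj z z'"

definition chorded :: "'a list \<Rightarrow> bool" where
  "chorded c \<longleftrightarrow> is_cycle V adj c \<and>
     (\<exists>x\<in>set c. \<exists>y\<in>set c. adj x y \<and> \<not> consec (c @ [hd c]) x y)"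

lemma crossing_rotate: "crossing x A z B y C z' D \<Longrightarrow> crossing z B y C z' D x A"
  unfolding crossing_def using cycle_rotate[of "x # A" z "B @ y # C @ z' # D"] adj_sym by auto

lemma successively_arc:
  assumes "is_cycle V adj (x # L @ y # R)"
  shows "successively adj (x # L @ [y])" "successively adj (y # R @ [x])"
proof -
  have "consec ((x # L @ y # R) @ [x]) s t \<longleftrightarrow> consec (x # L @ [y]) s t \<or> consec (y # R @ [x]) s t" for s t
    using consec_glue[of x L y "R @ [x]" s t] by simp
  then show "successively adj (x # L @ [y])" "successively adj (y # R @ [x])"
    using assms unfolding is_cycle_eq successively_iff_consec by auto
qed

lemma consec_arcs:
  "consec ((x # A @ z # B @ y # C @ z' # D) @ [x]) s t \<longleftrightarrow> consec (x # A @ [z]) s t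
     \<or> consec (z # B @ [y]) s t \<or> consec (y # C @ [z']) s t \<or> consec (z' # D @ [x]) s t"
  using consec_glue[of x A z "B @ y # C @ z' # D @ [x]" s t] consec_glue[of z B y "C @ z' # D @ [x]" s t]
    consec_glue[of y C z' "D @ [x]" s t] by simp

lemma not_consec_apart:
  assumes "distinct (x # L @ y # R)" "L \<noteq> []" "R \<noteq> []"
  shows "\<not> consec ((x # L @ y # R) @ [x]) x y"
proof -
  have e: "consec ((x # L @ y # R) @ [x]) x y \<longleftrightarrow> consec (x # L @ [y]) x y \<or> consec (y # R @ [x]) x y"
    using consec_glue[of x L y "R @ [x]" x y] by simp
  have "\<not> consec (x # L @ [y]) x y" using consec_inner[of x L y x y] assms by auto
  moreover have "\<not> consec (y # R @ [x]) x y" using consec_inner[of y R x x y] assms by auto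
  ultimately show ?thesis using e by blast
qed

lemma chordedI:
  assumes d: "distinct (x # L @ y # R)" and V: "set (x # L @ y # R) \<subseteq> V"
    and s: "successively adj (x # L @ [y])" "successively adj (y # R @ [x])"
    and ne: "L \<noteq> []" "R \<noteq> []" and xy: "adj x y"
  shows "chorded (x # L @ y # R)"
proof -
  have "consec ((x # L @ y # R) @ [x]) s t \<longleftrightarrow> consec (x # L @ [y]) s t \<or> consec (y # R @ [x]) s t" for s t
    using consec_glue[of x L y "R @ [x]" s t] by simp
  then have "successively adj ((x # L @ y # R) @ [x])"
    using s unfolding successively_iff_consec by auto
  moreover have "3 \<le> length (x # L @ y # R)" using ne by (cases L) auto
  ultimately have "is_cycle V adj (x # L @ y # R)"
    unfolding is_cycle_eq using d V by simp
  then show ?thesis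
    unfolding chorded_def using not_consec_apart[OF d ne] xy by auto
qed

end

context tsf_graph
begin

text \<open>Both claims exhibit a shorter chorded cycle that uses the two crossing chords as edges.
  It fails to be shorter only if two opposite arcs are empty, and then there is a square.\<close>

lemma crossing_arcs:
  assumes cr: "crossing x A z B y C z' D"
    and min: "\<And>c'. chorded c' \<Longrightarrow> length (x # A @ z # B @ y # C @ z' # D) \<le> length c'"
  shows "A \<noteq> []" and "s \<in> set A \<Longrightarrow> t \<in> set C \<Longrightarrow> \<not> adj s t"
proof -
  let ?c = "x # A @ z # B @ y # C @ z' # D"
  have cyc: "is_cycle V adj ?c" and xy: "adj x y" and zz: "adj z z'" using cr by (auto simp: crossing_def)
  have d: "distinct ?c" and V: "set ?c \<subseteq> V" and suc: "successively adj (?c @ [x])"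
    using cyc by (auto simp: is_cycle_eq)
  have sA: "successively adj (x # A @ [z])" and sB: "successively adj (z # B @ [y])"
    and sC: "successively adj (y # C @ [z'])" and sD: "successively adj (z' # D @ [x])"
    using suc unfolding successively_iff_consec consec_arcs by blast+
  have rev: "successively adj (b # rev L @ [a])" if "successively adj (a # L @ [b])" for a b L
    using that successively_adj_rev[of "a # L @ [b]"] by simp
  have square: False if "A = []" "C = []"
    using that sA sC no_square[of x z z' y] zz xy d adj_sym by (auto simp: successively_Cons)
  have square': False if "B = []" "D = []"
    using that sB sD no_square[of x z' z y] zz xy d adj_sym by (auto simp: successively_Cons)
  show "A \<noteq> []"
  proof
    assume A: "A = []"
    then have C: "C \<noteq> []" using square by blast
    \<comment> \<open>This cycle skips the nonempty arc \<open>C\<close>, and the former cycle edge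
      \<open>xz\<close> is its chord.\<close>
    let ?e = "x # (y # rev B) @ z # (z' # D)"
    have "successively adj (x # (y # rev B) @ [z])" using rev[OF sB] xy by simp
    moreover have "successively adj (z # (z' # D) @ [x])" using sD zz by simp
    moreover have "adj x z" using sA A by (simp add: successively_Cons)
    moreover have "distinct ?e" "set ?e \<subseteq> V" using d V by auto
    ultimately have "chorded ?e" by (intro chordedI) auto
    then have "length ?c \<le> length ?e" by (rule min)
    then show False using C A by simp
  qed
  show "\<not> adj s t" if st: "s \<in> set A" "t \<in> set C"
  proof
    assume a: "adj s t"
    obtain A1 A2 where A: "A = A1 @ s # A2" using st(1) by (meson split_list)
    obtain C1 C2 where C: "C = C1 @ t # C2" using st(2) by (meson split_list)
    have bd: "B \<noteq> [] \<or> D \<noteq> []" using square' by blast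
    \<comment> \<open>This cycle skips the arcs \<open>B\<close> and \<open>D\<close>, which are not
      both empty, and has the chord \<open>st\<close>.\<close>
    let ?e = "s # (A2 @ z # z' # rev C2) @ t # (rev C1 @ y # x # A1)"
    have rC: "successively adj (z' # rev C @ [y])" by (rule rev[OF sC])
    have "successively adj ((s # A2 @ [z]) @ (z' # rev C2 @ [t]))"
    proof -
      have "successively adj (s # A2 @ [z])" using sA unfolding A by (auto simp: successively_append_iff successively_Cons)
      moreover have "successively adj (z' # rev C2 @ [t])"
      proof -
        have "successively adj ((z' # rev C2 @ [t]) @ (rev C1 @ [y]))" using rC unfolding C by simp
        then show ?thesis using successively_append_iff by blast
      qed
      ultimately show ?thesis
        using zz successively_append_iff[of adj "s # A2 @ [z]" "z' # rev C2 @ [t]"] by simp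
    qed
    then have 1: "successively adj (s # (A2 @ z # z' # rev C2) @ [t])" by simp
    have "successively adj ((t # rev C1 @ [y]) @ (x # A1 @ [s]))"
    proof -
      have "successively adj (t # rev C1 @ [y])"
      proof -
        have "successively adj ((z' # rev C2) @ (t # rev C1 @ [y]))" using rC unfolding C by simp
        then show ?thesis using successively_append_iff by blast
      qed
      moreover have "successively adj (x # A1 @ [s])"
      proof -
        have "successively adj ((x # A1 @ [s]) @ (A2 @ [z]))" using sA unfolding A by simp
        then show ?thesis using successively_append_iff by blast
      qed
      ultimately show ?thesis
        using adj_sym[OF xy] successively_append_iff[of adj "t # rev C1 @ [y]" "x # A1 @ [s]"] by simp
    qed
    then have 2: "successively adj (t # (rev C1 @ y # x # A1) @ [s])" by simp
    have "distinct ?e" "set ?e \<subseteq> V" using d V unfolding A C by auto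
    then have "chorded ?e" using 1 2 a by (intro chordedI) auto
    then have "length ?c \<le> length ?e" by (rule min)
    then show False using bd unfolding A C by (cases B; cases D) auto
  qed
qed

text \<open>A chord inside one side of \<open>xy\<close> would shorten that side, while
  \<open>xy\<close> remains a chord of the shorter cycle.\<close>

lemma minimal_chord_crosses:
  assumes cyc: "is_cycle V adj (x # L @ y # R)" and xy: "adj x y" and R: "R \<noteq> []"
    and min: "\<And>c'. chorded c' \<Longrightarrow> length (x # L @ y # R) \<le> length c'"
    and st: "s \<in> set (x # L @ [y])" "t \<in> set (x # L @ [y])" "adj s t" "{s, t} \<noteq> {x, y}"
  shows "consec (x # L @ [y]) s t"
proof -
  have main: "consec (x # L @ [y]) s t"
    if h: "x # L @ [y] = P @ s # Q @ t # S" and st: "adj s t" "{s, t} \<noteq> {x, y}" for s t P Q S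
  proof (rule ccontr)
    assume nc: "\<not> ?thesis"
    have Q: "Q \<noteq> []"
      using nc unfolding h by (auto simp: consec_append consec_Cons)
    let ?h = "P @ s # t # S"
    have d: "distinct (x # L @ y # R)" and V: "set (x # L @ y # R) \<subseteq> V" using cyc by (auto simp: is_cycle_eq)
    have hd: "hd ?h = x" using arg_cong[OF h, of hd] by (cases P) auto
    have la: "last ?h = y" using arg_cong[OF h, of last] by (cases S rule: rev_cases) auto
    \<comment> \<open>Some vertex remains between \<open>x\<close> and \<open>y\<close>, because
      \<open>st\<close> is not the chord \<open>xy\<close> itself.\<close>
    have len: "3 \<le> length ?h"
    proof (rule ccontr)
      assume "\<not> ?thesis"
      then have "P = []" "S = []" by (cases P; cases S; auto)+
      then show False using hd la st(2) by simp
    qed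
    obtain L' where L': "?h = x # L' @ [y]" "L' \<noteq> []"
      using ends_butlast_tl[OF len] hd la that by metis
    have arcs: "successively adj (x # L @ [y])" "successively adj (y # R @ [x])"
      using successively_arc[OF cyc] by blast+
    have "successively adj ?h"
      using arcs(1) st(1) unfolding h by (auto simp: successively_append_iff successively_Cons)
    then have "successively adj (x # L' @ [y])" unfolding L' .
    moreover have sub: "set (x # L' @ [y]) \<subseteq> set (x # L @ [y])" "distinct (x # L' @ [y])"
    proof -
      have "distinct (x # L @ [y])" using d by auto
      then show "set (x # L' @ [y]) \<subseteq> set (x # L @ [y])" "distinct (x # L' @ [y])"
        unfolding h L'(1)[symmetric] by auto
    qed
    moreover have "distinct (x # L' @ y # R)" "set (x # L' @ y # R) \<subseteq> V"
      using sub d V by auto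
    ultimately have "chorded (x # L' @ y # R)" using arcs(2) L'(2) R xy by (intro chordedI) auto
    then have "length (x # L @ y # R) \<le> length (x # L' @ y # R)" by (rule min)
    moreover have "length (x # L' @ [y]) < length (x # L @ [y])" unfolding h L'(1)[symmetric] using Q by simp
    ultimately show False by simp
  qed
  have "s \<noteq> t" using st(3) by auto
  obtain P Q where PQ: "x # L @ [y] = P @ s # Q" using st(1) by (meson split_list)
  then have "t \<in> set P \<or> t \<in> set Q" using st(2) \<open>s \<noteq> t\<close> by auto
  then show ?thesis
  proof
    assume "t \<in> set Q"
    then obtain Q1 S where "Q = Q1 @ t # S" by (meson split_list)
    then show ?thesis using main[of P s Q1 t S] PQ st by simp
  next
    assume "t \<in> set P"
    then obtain P1 P2 where "P = P1 @ t # P2" by (meson split_list)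
    then have "consec (x # L @ [y]) t s"
      using main[of P1 t P2 s Q] PQ st adj_sym by (simp add: insert_commute)
    then show ?thesis using consec_commute[of "x # L @ [y]" t s] by simp
  qed
qed

text \<open>A single chord would be a unichord, so a second one exists and crosses the first. A
  third chord would cross both, hence join \<open>A\<close> to \<open>C\<close> or \<open>B\<close>
  to \<open>D\<close>, which \<open>crossing_arcs\<close> excludes.\<close>

lemma chorded_crossing:
  assumes ch: "chorded c0"
  obtains x A z B y C z' D where "crossing x A z B y C z' D"
    "A \<noteq> []" "B \<noteq> []" "C \<noteq> []" "D \<noteq> []"
    "\<And>s t. s \<in> set (x # A @ z # B @ y # C @ z' # D) \<Longrightarrow> t \<in> set (x # A @ z # B @ y # C @ z' # D) \<Longrightarrow> adj s t \<Longrightarrow>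
      consec ((x # A @ z # B @ y # C @ z' # D) @ [x]) s t \<or> {s, t} = {x, y} \<or> {s, t} = {z, z'}"
proof -
  define c where "c = arg_min length chorded"
  have c: "chorded c" and min: "\<And>c'. chorded c' \<Longrightarrow> length c \<le> length c'"
    using arg_min_nat_lemma[of chorded c0 length] ch unfolding c_def by auto
  obtain x y where xy: "x \<in> set c" "y \<in> set c" "adj x y" "\<not> consec (c @ [hd c]) x y"
    and cyc: "is_cycle V adj c" using c unfolding chorded_def by blast
  obtain P Q where PQ: "c = P @ x # Q" using xy(1) by (meson split_list)
  have "y \<in> set (Q @ P)" using xy(2,3) PQ by auto
  then obtain L R where LR: "Q @ P = L @ y # R" by (meson split_list)
  let ?c = "x # L @ y # R"
  have cyc': "is_cycle V adj ?c" using cycle_rotate[of P x Q] cyc PQ LR by simp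
  have con: "consec (?c @ [x]) s t \<longleftrightarrow> consec (c @ [hd c]) s t" for s t
    using consec_rotate[of x Q P s t] unfolding PQ LR[symmetric] by simp
  have min': "length ?c \<le> length c'" if "chorded c'" for c'
  proof -
    have "length ?c = length c" using PQ arg_cong[OF LR, of length] by simp
    then show ?thesis using min[OF that] by simp
  qed
  have nc: "\<not> consec (?c @ [x]) x y" using xy(4) con by blast
  have R: "R \<noteq> []" using nc by (auto simp: consec_append consec_Cons insert_commute)
  have L: "L \<noteq> []" using nc by (auto simp: consec_Cons)
  have d: "distinct ?c" using cyc' by (auto simp: is_cycle_eq)
  have glue: "consec (?c @ [x]) s t \<longleftrightarrow> consec (x # L @ [y]) s t \<or> consec (y # R @ [x]) s t" for s t
    using consec_glue[of x L y "R @ [x]" s t] by simp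
  have cycR: "is_cycle V adj (y # R @ x # L)" using cycle_rotate[of "x # L" y R] cyc' by simp
  have side1: "consec (?c @ [x]) s t"
    if "s \<in> set (x # L @ [y])" "t \<in> set (x # L @ [y])" "adj s t" "{s, t} \<noteq> {x, y}" for s t
    unfolding glue using minimal_chord_crosses[OF cyc' xy(3) R min' that] by blast
  have side2: "consec (?c @ [x]) s t"
    if "s \<in> set (y # R @ [x])" "t \<in> set (y # R @ [x])" "adj s t" "{s, t} \<noteq> {x, y}" for s t
  proof -
    have len: "length (y # R @ x # L) = length ?c" by simp
    have "{s, t} \<noteq> {y, x}" using that(4) by (simp add: insert_commute)
    then show ?thesis
      unfolding glue using minimal_chord_crosses[OF cycR adj_sym[OF xy(3)] L _ that(1-3)] min' len by metis
  qed
  have cross: "s \<in> set L \<and> t \<in> set R \<or> s \<in> set R \<and> t \<in> set L"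
    if "s \<in> set ?c" "t \<in> set ?c" "adj s t" "\<not> consec (?c @ [x]) s t" "{s, t} \<noteq> {x, y}" for s t
    using side1[of s t] side2[of s t] that by auto
  have "\<exists>s t. s \<in> set ?c \<and> t \<in> set ?c \<and> adj s t \<and> \<not> consec (?c @ [x]) s t \<and> {s, t} \<noteq> {x, y}"
  proof (rule ccontr)
    assume "\<not> ?thesis"
    then show False using no_unichord[OF cyc', of x y] xy(3) nc by auto
  qed
  then obtain z z' where z: "z \<in> set L" "z' \<in> set R" "adj z z'"
    using cross adj_sym by metis
  obtain A B where AB: "L = A @ z # B" using z(1) by (meson split_list)
  obtain C D where CD: "R = C @ z' # D" using z(2) by (meson split_list)
  have cr: "crossing x A z B y C z' D" unfolding crossing_def using cyc' xy(3) z(3) AB CD by simp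
  have lenc: "length ?c = length A + length B + length C + length D + 4" unfolding AB CD by simp
  have mincr: "length (x # A @ z # B @ y # C @ z' # D) \<le> length c'" if "chorded c'" for c'
    using min'[OF that] lenc by simp
  \<comment> \<open>Rotation carries the statements about \<open>A\<close> and \<open>C\<close> over
    to the other arcs.\<close>
  note cr1 = crossing_rotate[OF cr]
  note cr2 = crossing_rotate[OF cr1]
  note cr3 = crossing_rotate[OF cr2]
  have min1: "length (z # B @ y # C @ z' # D @ x # A) \<le> length c'" if "chorded c'" for c'
    using mincr[OF that] by simp
  have min2: "length (y # C @ z' # D @ x # A @ z # B) \<le> length c'" if "chorded c'" for c'
    using mincr[OF that] by simp
  have min3: "length (z' # D @ x # A @ z # B @ y # C) \<le> length c'" if "chorded c'" for c'
    using mincr[OF that] by simp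
  have ne: "A \<noteq> []" "B \<noteq> []" "C \<noteq> []" "D \<noteq> []"
    using crossing_arcs(1)[OF cr mincr] crossing_arcs(1)[OF cr1 min1]
      crossing_arcs(1)[OF cr2 min2] crossing_arcs(1)[OF cr3 min3] by blast+
  have AC: "\<not> adj s t" if "s \<in> set A" "t \<in> set C" for s t using crossing_arcs(2)[OF cr mincr that] by blast
  have BD: "\<not> adj s t" if "s \<in> set B" "t \<in> set D" for s t using crossing_arcs(2)[OF cr1 min1 that] by blast
  define c1 where "c1 = z # B @ y # C @ z' # D @ x # A"
  have cyc1: "is_cycle V adj (z # (B @ y # C) @ z' # (D @ x # A))" using cr1 by (simp add: crossing_def)
  have cyc2: "is_cycle V adj (z' # (D @ x # A) @ z # (B @ y # C))" using cr3 by (simp add: crossing_def)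
  have con1: "consec (?c @ [x]) s t \<longleftrightarrow> consec (z # (B @ y # C) @ [z']) s t \<or> consec (z' # (D @ x # A) @ [z]) s t" for s t
  proof -
    have "consec ((z # (B @ y # C @ z' # D) @ (x # A)) @ [z]) s t \<longleftrightarrow> consec (?c @ [x]) s t"
      using consec_rotate[of z "B @ y # C @ z' # D" "x # A" s t] unfolding AB CD by simp
    moreover have "consec (z # (B @ y # C) @ z' # (D @ x # A @ [z])) s t \<longleftrightarrow>
        consec (z # (B @ y # C) @ [z']) s t \<or> consec (z' # (D @ x # A @ [z])) s t"
      by (rule consec_glue)
    ultimately show ?thesis by simp
  qed
  have s1: "consec (?c @ [x]) s t"
    if "s \<in> set (z # (B @ y # C) @ [z'])" "t \<in> set (z # (B @ y # C) @ [z'])" "adj s t" "{s, t} \<noteq> {z, z'}" for s t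
    unfolding con1 using minimal_chord_crosses[OF cyc1 z(3) _ _ that] min1 by auto
  have s2: "consec (?c @ [x]) s t"
    if "s \<in> set (z' # (D @ x # A) @ [z])" "t \<in> set (z' # (D @ x # A) @ [z])" "adj s t" "{s, t} \<noteq> {z, z'}" for s t
  proof -
    have "{s, t} \<noteq> {z', z}" using that(4) by (simp add: insert_commute)
    then show ?thesis
      unfolding con1 using minimal_chord_crosses[OF cyc2 adj_sym[OF z(3)] _ _ that(1-3)] min3 by auto
  qed
  have only: "consec (?c @ [x]) s t \<or> {s, t} = {z, z'}" if st: "s \<in> set L" "t \<in> set R" "adj s t" for s t
  proof (rule ccontr)
    assume n: "\<not> ?thesis"
    have "s \<in> set A \<union> set B \<union> {z}" "t \<in> set C \<union> set D \<union> {z'}" using st unfolding AB CD by auto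
    then show False
      using n AC[of s t] BD[of s t] st(3) s1[of s t] s2[of s t] by auto
  qed
  have "consec (?c @ [x]) s t \<or> {s, t} = {x, y} \<or> {s, t} = {z, z'}"
    if st: "s \<in> set ?c" "t \<in> set ?c" "adj s t" for s t
  proof (rule ccontr)
    assume n: "\<not> ?thesis"
    then have "s \<in> set L \<and> t \<in> set R \<or> s \<in> set R \<and> t \<in> set L" using cross[OF st] by blast
    then show False
      using only[of s t] only[of t s] n st(3) adj_sym[OF st(3)] consec_commute[of "?c @ [x]" s t]
      by (auto simp: insert_commute)
  qed
  then show thesis using that[OF cr ne] unfolding AB CD by simp
qed

end

subsection \<open>The seven skeletons\<close>

text \<open>P0 and H0 are the Petersen and Heawood graphs, P1 and H1 lack a vertex, H2 lacks two adjacent vertices and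
  H3 a path on three vertices, with paths through vertices of degree 2 turned into long edges. K4 is the
  Petersen graph without two adjacent vertices.\<close>

definition K4_long :: "(nat \<times> nat) list" where
  "K4_long = [(0,1),(0,3),(1,2),(2,3)]"

definition K4_unit :: "(nat \<times> nat) list" where
  "K4_unit = [(0,2),(1,3)]"

definition P1_long :: "(nat \<times> nat) list" where
  "P1_long = [(0,4),(1,3),(2,5)]"

definition P1_unit :: "(nat \<times> nat) list" where
  "P1_unit = [(0,1),(0,2),(1,5),(2,3),(3,4),(4,5)]"

definition P0_long :: "(nat \<times> nat) list" where
  "P0_long = []"

definition P0_unit :: "(nat \<times> nat) list" where
  "P0_unit = [(0,1),(0,4),(0,5),(1,2),(1,8),(2,3),(2,6),(3,4),(3,9),(4,7),(5,6),(5,9),(6,7),(7,8),(8,9)]"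

definition H3_long :: "(nat \<times> nat) list" where
  "H3_long = [(0,3),(0,5),(1,2),(3,4),(4,5)]"

definition H3_unit :: "(nat \<times> nat) list" where
  "H3_unit = [(0,1),(1,4),(2,3),(2,5)]"

definition H2_long :: "(nat \<times> nat) list" where
  "H2_long = [(0,6),(1,7),(2,3),(4,5)]"

definition H2_unit :: "(nat \<times> nat) list" where
  "H2_unit = [(0,1),(0,4),(1,2),(2,5),(3,4),(3,7),(5,6),(6,7)]"

definition H1_long :: "(nat \<times> nat) list" where
  "H1_long = [(0,4),(2,9),(6,7)]"

definition H1_unit :: "(nat \<times> nat) list" where
  "H1_unit = [(0,1),(0,8),(1,2),(1,6),(2,3),(3,4),(3,7),(4,5),(5,6),(5,9),(7,8),(8,9)]"

definition H0_long :: "(nat \<times> nat) list" where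
  "H0_long = []"

definition H0_unit :: "(nat \<times> nat) list" where
  "H0_unit = [(0,1),(0,9),(0,13),(1,2),(1,6),(2,3),(2,11),(3,4),(3,8),(4,5),(4,13),(5,6),(5,10),(6,7),(7,8),(7,12),(8,9),(9,10),(10,11),(11,12),(12,13)]"

section \<open>From an edge between branch vertices to a chorded cycle\<close>

context graph
begin

lemma cycle_rev: "is_cycle V adj (s # Q) \<Longrightarrow> is_cycle V adj (s # rev Q)"
proof -
  assume c: "is_cycle V adj (s # Q)"
  have "(s # rev Q) @ [s] = rev ((s # Q) @ [s])" by simp
  then have "consec ((s # rev Q) @ [s]) x y \<longleftrightarrow> consec ((s # Q) @ [s]) x y" for x y
    by (metis consec_rev)
  then show ?thesis using c unfolding is_cycle_eq successively_iff_consec by simp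
qed

text \<open>Menger's theorem for two paths, by Whitney's argument: among the vertices that lie on a common cycle
  with s or are adjacent to s, one closest to t must be t itself.\<close>

lemma cycle_through_two:
  assumes s: "s \<in> V" and t: "t \<in> V" and st: "s \<noteq> t" "\<not> adj s t"
    and con: "\<exists>q. walk V q \<and> hd q = s \<and> last q = t"
    and sep: "\<And>w. w \<noteq> s \<Longrightarrow> w \<noteq> t \<Longrightarrow> \<exists>q. walk (V - {w}) q \<and> hd q = s \<and> last q = t"
  shows "\<exists>c. is_cycle V adj c \<and> s \<in> set c \<and> t \<in> set c"
proof -
  define Q where "Q z \<longleftrightarrow> z \<noteq> s \<and> (adj s z \<or> (\<exists>c. is_cycle V adj c \<and> s \<in> set c \<and> z \<in> set c))" for z
  define R where "R a b \<longleftrightarrow> Q a \<and> b = t" for a b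
  obtain q where q: "walk V q" "hd q = s" "last q = t" using con by blast
  obtain q' where q': "q = s # q'" using q by (cases q) (auto simp: walk_def)
  have q'ne: "q' \<noteq> []" using q q' st by auto
  have "walk V q'" using q(1) q'ne walk_appendD2[of V "[s]" q'] q' by simp
  moreover have "adj s (hd q')" using q(1) q' q'ne by (auto simp: walk_def successively_Cons)
  then have "Q (hd q')" unfolding Q_def by auto
  then have "R (hd q') (last q')" using q q' q'ne unfolding R_def by simp
  ultimately obtain M where M: "walk V M" "R (hd M) (last M)" "ipath M"
    and min: "\<And>p. walk V p \<Longrightarrow> R (hd p) (last p) \<Longrightarrow> length M \<le> length p"
    using minimal_walk[of V q' R] by metis
  obtain z M' where zM: "M = z # M'" using M(1) by (cases M) (auto simp: walk_def)
  have Qz: "Q z" and lastM: "last M = t" using M(2) zM unfolding R_def by auto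
  show ?thesis
  proof (cases "M' = []")
    case True
    then have "z = t" using lastM zM by simp
    then show ?thesis using Qz st(2) unfolding Q_def by blast
  next
    case False
    have tM': "t \<in> set M'" using lastM zM False by auto
    have dM: "distinct M" "successively adj M" "set M \<subseteq> V" using M by (auto simp: ipath_def walk_def)
    have noQ: "\<not> Q m" if "m \<in> set M'" for m
    proof
      assume Qm: "Q m"
      obtain a b where ab: "M' = a @ m # b" using \<open>m \<in> set M'\<close> by (meson split_list)
      have "walk V (m # b)" using M(1) walk_appendD2[of V "z # a" "m # b"] zM ab by simp
      moreover have "R (hd (m # b)) (last (m # b))" using Qm lastM zM ab unfolding R_def by simp
      ultimately have "length M \<le> length (m # b)" by (rule min)
      then show False using zM ab by simp
    qed
    have sM': "s \<notin> set M'"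
    proof
      assume "s \<in> set M'"
      then obtain a b where ab: "M' = a @ s # b" by (meson split_list)
      then have "b \<noteq> []" using lastM zM st by auto
      then obtain m b' where b: "b = m # b'" by (cases b) auto
      have "adj s m" using dM(2) zM ab b by (auto simp: successively_append_iff successively_Cons)
      then have "Q m" unfolding Q_def by auto
      then show False using noQ[of m] ab b by simp
    qed
    have zs: "z \<noteq> s" using Qz unfolding Q_def by blast
    have zt: "z \<noteq> t" using tM' dM(1) zM by auto
    \<comment> \<open>As \<open>z\<close> does not separate \<open>s\<close> from \<open>t\<close>,
      there is a bypass that avoids \<open>z\<close>.\<close>
    obtain r0 where r0: "walk (V - {z}) r0" "hd r0 = s" "last r0 = t" using sep[OF zs zt] by blast
    define S where "S a b \<longleftrightarrow> a = s \<and> b = t" for a b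
    obtain r where r: "walk (V - {z}) r" "hd r = s" "last r = t" "ipath r"
      using minimal_walk[of "V - {z}" r0 S] r0 unfolding S_def by metis
    have dr: "distinct r" "successively adj r" "set r \<subseteq> V - {z}" using r by (auto simp: ipath_def walk_def)
    \<comment> \<open>\<open>Z\<close> is the edge \<open>sz\<close> or the cycle through
      \<open>s\<close> and \<open>z\<close>, and \<open>x\<close> is the vertex where the bypass
      \<open>r\<close> leaves \<open>Z\<close> for good. The assumption \<open>arc\<close> provides
      a path in \<open>Z\<close> from \<open>s\<close> to \<open>z\<close> and, disjoint from it,
      the way \<open>D\<close> from \<open>x\<close> back to \<open>s\<close>, which is empty if
      \<open>x = s\<close>.\<close>
    have final: ?thesis
      if Z: "z \<in> Z" "s \<in> Z" "Z \<inter> set M' = {}" "Z \<subseteq> V"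
        and arc: "\<And>x. x \<in> Z \<Longrightarrow> x \<noteq> z \<Longrightarrow>
          \<exists>U D. set U \<subseteq> Z \<and> set D \<subseteq> Z \<and> distinct (s # U @ z # D) \<and> successively adj (s # U @ [z])
            \<and> successively adj (D @ [s]) \<and> hd (D @ [s]) = x" for Z
    proof -
      have "s \<in> set r" using r by (metis hd_in_set walk_def)
      then obtain r1 x r2 where rx: "r = r1 @ x # r2" "x \<in> Z" "\<forall>y\<in>set r2. y \<notin> Z"
        using split_list_last_prop[of r "\<lambda>y. y \<in> Z"] Z(2) by blast
      have xz: "x \<noteq> z" using rx(1) dr(3) by auto
      have "t \<notin> Z" using Z(3) tM' by blast
      then have "r2 \<noteq> []" using rx r(3) by auto
      then have "t \<in> set r2" using rx(1) r(3) by auto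
      then obtain r3 m r4 where rm: "r2 = r3 @ m # r4" "m \<in> set M'" "\<forall>y\<in>set r3. y \<notin> set M'"
        using split_list_first_prop[of r2 "\<lambda>y. y \<in> set M'"] tM' by blast
      obtain M1 M2 where M12: "M' = M1 @ m # M2" using rm(2) by (meson split_list)
      obtain U D where UD: "set U \<subseteq> Z" "set D \<subseteq> Z" "distinct (s # U @ z # D)" "successively adj (s # U @ [z])"
        "successively adj (D @ [s])" "hd (D @ [s]) = x"
        using arc[OF rx(2) xz] by blast
      \<comment> \<open>The new cycle goes from \<open>s\<close> to \<open>z\<close>, along
        \<open>M\<close> to the vertex \<open>m\<close> where \<open>r\<close> first meets it after
        \<open>x\<close>, back along \<open>r\<close> to \<open>x\<close>, and home. So
        \<open>m\<close> satisfies \<open>Q\<close> although it is closer to \<open>t\<close> than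
        \<open>z\<close>.\<close>
      let ?c = "s # U @ z # M1 @ m # rev r3 @ D"
      have r3: "set r3 \<inter> Z = {}" "set r3 \<inter> set M' = {}" "distinct r3" "m \<notin> set r3" "set r3 \<subseteq> V"
        using rx rm dr by auto
      have M1d: "distinct M1" "m \<notin> set M1" "set M1 \<inter> Z = {}" "m \<notin> Z" "set M1 \<inter> set r3 = {}" "set M1 \<subseteq> V" "m \<in> V"
        using M12 dM zM Z(3) r3(2) by auto
      have sucr: "successively adj (x # r3 @ [m])"
      proof -
        have "successively adj (r1 @ (x # r3 @ [m]) @ r4)" using dr(2) unfolding rx(1) rm(1) by simp
        then show ?thesis using successively_append_iff by blast
      qed
      have sucM: "successively adj (z # M1 @ [m])"
      proof -
        have "successively adj ((z # M1 @ [m]) @ M2)" using dM(2) unfolding zM M12 by simp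
        then show ?thesis using successively_append_iff by blast
      qed
      have "successively adj (?c @ [s])"
      proof -
        have 1: "successively adj (m # rev r3 @ [x])" using sucr successively_adj_rev[of "x # r3 @ [m]"] by simp
        obtain D' where D': "D @ [s] = x # D'" using UD(6) by (cases "D @ [s]") auto
        have "successively adj (m # rev r3 @ x # D')"
          by (rule successively_glue[OF 1]) (use UD(5) D' in simp)
        then have "successively adj (z # M1 @ m # (rev r3 @ x # D'))"
          by (rule successively_glue[OF sucM])
        then have "successively adj (s # U @ z # (M1 @ m # (rev r3 @ x # D')))"
          by (rule successively_glue[OF UD(4)])
        then show ?thesis using D' by simp
      qed
      moreover have "distinct ?c"
        using UD(1-3) r3 M1d Z(1,2) by auto
      moreover have "set ?c \<subseteq> V" using UD(1,2) Z r3(5) M1d(6,7) by auto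
      moreover have "3 \<le> length ?c" by simp
      ultimately have "is_cycle V adj ?c" unfolding is_cycle_eq by simp
      moreover have "m \<noteq> s" using rm(2) sM' by blast
      ultimately have "Q m" unfolding Q_def by (intro conjI disjI2 exI[of _ ?c]) auto
      then show ?thesis using noQ[OF rm(2)] by blast
    qed
    from Qz have "adj s z \<or> (\<exists>c. is_cycle V adj c \<and> s \<in> set c \<and> z \<in> set c)" unfolding Q_def by blast
    then show ?thesis
    proof (elim disjE exE conjE)
      assume sz: "adj s z"
      show ?thesis
      proof (rule final[of "{s, z}"])
        show "{s, z} \<inter> set M' = {}" using sM' dM(1) zM by auto
        show "{s, z} \<subseteq> V" using s dM(3) zM by auto
        fix x assume "x \<in> {s, z}" "x \<noteq> z"
        then show "\<exists>U D. set U \<subseteq> {s, z} \<and> set D \<subseteq> {s, z} \<and> distinct (s # U @ z # D) \<and> successively adj (s # U @ [z])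
            \<and> successively adj (D @ [s]) \<and> hd (D @ [s]) = x"
          using sz zs by (intro exI[of _ "[]"]) auto
      qed auto
    next
      fix c assume c: "is_cycle V adj c" "s \<in> set c" "z \<in> set c"
      obtain P0 S0 where PS: "c = P0 @ s # S0" using c(2) by (meson split_list)
      have cyc: "is_cycle V adj (s # (S0 @ P0))" using cycle_rotate[of P0 s S0] c(1) PS by simp
      have zin: "z \<in> set (S0 @ P0)" using c(3) PS zs by auto
      have oneway: "\<exists>U D. set U \<subseteq> set c \<and> set D \<subseteq> set c \<and> distinct (s # U @ z # D) \<and> successively adj (s # U @ [z])
            \<and> successively adj (D @ [s]) \<and> hd (D @ [s]) = x"
        if cy: "is_cycle V adj (s # U @ z # W)" and sub: "set (s # U @ z # W) = set c" and x: "x = s \<or> x \<in> set W" for U W x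
      proof -
        have d: "distinct (s # U @ z # W)" and su: "successively adj (s # U @ [z])" and sw: "successively adj (z # W @ [s])"
          using cy successively_arc[OF cy] by (auto simp: is_cycle_eq)
        show ?thesis
        proof (cases "x = s")
          case True
          then show ?thesis using d su sub by (intro exI[of _ U] exI[of _ "[]"]) auto
        next
          case False
          then obtain W1 W2 where W: "W = W1 @ x # W2" using x by (meson split_list)
          have "successively adj ((z # W1) @ (x # W2 @ [s]))" using sw W by simp
          then have "successively adj (x # W2 @ [s])" using successively_append_iff by blast
          moreover have "distinct (s # U @ z # x # W2)" using d unfolding W by auto
          moreover have "set U \<subseteq> set c" "set (x # W2) \<subseteq> set c" unfolding sub[symmetric] W by auto
          ultimately show ?thesis using su by (intro exI[of _ U] exI[of _ "x # W2"]) simp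
        qed
      qed
      obtain U W where UW: "S0 @ P0 = U @ z # W" using zin by (meson split_list)
      have cy1: "is_cycle V adj (s # U @ z # W)" using cyc UW by simp
      \<comment> \<open>The vertex \<open>x\<close> may lie on either arc between \<open>s\<close>
        and \<open>z\<close>; reversing the cycle treats the second one.\<close>
      have cy2: "is_cycle V adj (s # rev W @ z # rev U)" using cycle_rev[OF cy1] by simp
      have setc: "set (s # U @ z # W) = set c" using PS UW[symmetric] by auto
      have setc2: "set (s # rev W @ z # rev U) = set c" using setc by auto
      show ?thesis
      proof (rule final[of "set c"])
        show "set c \<inter> set M' = {}"
        proof (rule ccontr)
          assume "set c \<inter> set M' \<noteq> {}"
          then obtain m where m: "m \<in> set c" "m \<in> set M'" by blast
          then have "Q m" using c sM' unfolding Q_def by blast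
          then show False using noQ m by blast
        qed
        show "set c \<subseteq> V" using c(1) by (simp add: is_cycle_def)
        fix x assume x: "x \<in> set c" "x \<noteq> z"
        then consider "x = s \<or> x \<in> set W" | "x \<in> set (rev U)" using setc by auto
        then show "\<exists>U D. set U \<subseteq> set c \<and> set D \<subseteq> set c \<and> distinct (s # U @ z # D) \<and> successively adj (s # U @ [z])
            \<and> successively adj (D @ [s]) \<and> hd (D @ [s]) = x"
          using oneway[OF cy1 setc, of x] oneway[OF cy2 setc2, of x] by cases blast+
      qed (use c in auto)
    qed
  qed
qed

lemma consec_hd_unique: "distinct p \<Longrightarrow> consec p (hd p) x \<Longrightarrow> consec p (hd p) y \<Longrightarrow> x = y"
  by (cases p) (auto simp: consec_Cons doubleton_eq_iff dest: consec_in_set)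

lemma consec_three:
  assumes "distinct p" "consec p v a" "consec p v b" "consec p v c"
  shows "a = b \<or> a = c \<or> b = c"
proof -
  have *: "\<exists>i. Suc i < length p \<and> (p ! i = v \<and> p ! Suc i = x \<or> p ! i = x \<and> p ! Suc i = v)" if "consec p v x" for x
    using that unfolding consec_def by blast
  obtain k where k: "k < length p" "p ! k = v" using consec_in_set[OF assms(2)] by (metis in_set_conv_nth)
  have "x = p ! Suc k \<or> (0 < k \<and> x = p ! (k - 1))" if vx: "consec p v x" for x
  proof -
    obtain i where i: "Suc i < length p" "p ! i = v \<and> p ! Suc i = x \<or> p ! i = x \<and> p ! Suc i = v"
      using *[OF vx] by blast
    then have "i = k \<and> p ! Suc i = x \<or> Suc i = k \<and> p ! i = x"
      using k assms(1) by (metis Suc_lessD nth_eq_iff_index_eq)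
    then show ?thesis by auto
  qed
  then show ?thesis using assms(2-4) by metis
qed

lemma degree_nbrs:
  assumes "3 \<le> degree V adj v"
  obtains a b c where "adj v a" "adj v b" "adj v c" "a \<noteq> b" "a \<noteq> c" "b \<noteq> c" "a \<noteq> u" "b \<noteq> u"
proof -
  have "3 \<le> card {y \<in> V. adj v y}" using assms by (simp add: degree_def)
  then obtain S where S: "S \<subseteq> {y \<in> V. adj v y}" "card S = 3" by (meson obtain_subset_with_card_n)
  then obtain a b c where abc: "S = {a, b, c}" "a \<noteq> b" "b \<noteq> c" "a \<noteq> c" by (auto simp: card_3_iff)
  then have adj: "adj v a" "adj v b" "adj v c" using S(1) by auto
  consider "a = u" | "a \<noteq> u" "b = u" | "a \<noteq> u" "b \<noteq> u" by blast
  then show ?thesis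
  proof cases
    case 1
    then have "b \<noteq> u" "c \<noteq> u" using abc by auto
    then show ?thesis using that[of b c a] adj abc by simp
  next
    case 2
    then have "c \<noteq> u" using abc by auto
    then show ?thesis using that[of a c b] adj abc 2 by simp
  next
    case 3
    then show ?thesis using that[of a b c] adj abc by simp
  qed
qed

lemma is_path_of_walk:
  assumes "walk W p"
  shows "contains_path adj W (hd p) (last p)"
proof -
  define R where "R a b \<longleftrightarrow> a = hd p \<and> b = last p" for a b
  obtain q where q: "walk W q" "R (hd q) (last q)" "ipath q"
    using minimal_walk[of W p R] assms unfolding R_def by metis
  then have "is_path_in adj W (hd q) (last q) q"
    by (intro is_path_inI) (auto simp: ipath_def walk_def)
  then show ?thesis using q(2) unfolding contains_path_def R_def by auto
qed

text \<open>Only the edge \<open>uv\<close> and the vertex \<open>w\<close> link \<open>X\<close> to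
  the rest, so \<open>u\<close> and \<open>w\<close> separate. The degree conditions make neither
  side a path: \<open>u\<close> has two neighbours on its side besides \<open>w\<close>, and all
  neighbours of \<open>v\<close>, at least three, lie on the other side together with
  \<open>u\<close> and \<open>w\<close>.\<close>

lemma edge_separator_cutset:
  assumes no1: "\<not> has_1_cutset V adj" and uv: "adj u v" and w: "w \<in> V" "w \<noteq> u" "w \<noteq> v" "\<not> adj u w"
    and X: "u \<in> X" "v \<notin> X" "w \<notin> X" "X \<subseteq> V"
    and sep: "\<And>x y. x \<in> X \<Longrightarrow> y \<in> V - X - {w} \<Longrightarrow> adj x y \<Longrightarrow> x = u \<and> y = v"
    and deg: "3 \<le> degree V adj u" "3 \<le> degree V adj v"
  shows "has_proper_2_cutset V adj"
proof -
  define X' where "X' = X - {u}"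
  define Y where "Y = V - X - {w}"
  have V: "u \<in> V" "v \<in> V" using adjV[OF uv] by auto
  have vY: "v \<in> Y" using X V w unfolding Y_def by auto
  obtain a b where ab: "adj u a" "adj u b" "a \<noteq> b" "a \<noteq> v" "b \<noteq> v"
    using degree_nbrs[OF deg(1), of v] by metis
  have inX: "x \<in> X'" if "adj u x" "x \<noteq> v" for x
  proof -
    have "x \<noteq> u" "x \<noteq> w" "x \<in> V" using that w adjV[OF that(1)] by auto
    then show ?thesis using sep[OF X(1), of x] that unfolding X'_def by auto
  qed
  obtain c d e where cd: "adj v c" "adj v d" "adj v e" "c \<noteq> d" "c \<noteq> e" "d \<noteq> e" "c \<noteq> u" "d \<noteq> u"
    using degree_nbrs[OF deg(2), of u] .
  have inY: "y \<in> Y \<union> {u, w}" if "adj v y" for y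
  proof -
    have "y \<in> V" using adjV[OF that] by blast
    then show ?thesis using sep[of y v] vY that adj_sym unfolding Y_def by blast
  qed
  have fin: "finite X'" "finite Y" using X finV unfolding X'_def Y_def by (auto intro: finite_subset)
  have nadj: "\<not> adj x y" if "x \<in> X'" "y \<in> Y" for x y
    using sep[of x y] that unfolding X'_def Y_def by blast
  \<comment> \<open>A walk that avoids \<open>u\<close> can leave a side only through
    \<open>w\<close>, so its initial part leads to \<open>w\<close>. Such walks exist because
    \<open>u\<close> is not a cutvertex.\<close>
  have split: "\<exists>q. walk (W \<union> {w}) q \<and> hd q = x \<and> last q = w"
    if p: "walk (V - {u}) p" "hd p = x" "last p = y" "x \<in> W" "y \<notin> W"
      and W: "\<And>s t. s \<in> W \<Longrightarrow> t \<in> V - W - {u, w} \<Longrightarrow> \<not> adj s t" "w \<notin> W" for p x y W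
  proof -
    have "p \<noteq> []" "last p \<in> set p" using p(1) by (auto simp: walk_def)
    then obtain q1 z q2 where z: "p = q1 @ z # q2" "z \<notin> W" "\<forall>s\<in>set q1. \<not> s \<notin> W"
      using split_list_first_prop[of p "\<lambda>z. z \<notin> W"] p(3,5) by blast
    have q1: "q1 \<noteq> []" using z p(2,4) by auto
    then have "adj (last q1) z" using p(1) z(1) by (auto simp: walk_def successively_append_iff)
    moreover have "last q1 \<in> W" using q1 z(3) by auto
    moreover have "z \<in> V - {u}" using p(1) z(1) by (auto simp: walk_def)
    ultimately have "z = w" using W(1)[of "last q1" z] z(2) by blast
    have "walk (W \<union> {w}) (q1 @ [w])"
      using p(1) z q1 \<open>z = w\<close> by (auto simp: walk_def successively_append_iff successively_Cons)
    then show ?thesis using p(2) z(1) q1 by (intro exI[of _ "q1 @ [w]"]) auto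
  qed
  obtain p where p: "walk (V - {u}) p" "hd p = a" "last p = v"
    using no_cutvertex_walk[OF no1 V(1), of a v] inX[OF ab(1,4)] X V uv unfolding X'_def by auto
  have "walk (V - {u}) (rev p)" using p(1) by simp
  moreover have "hd (rev p) = v" "last (rev p) = a" using p by (auto simp: walk_def hd_rev last_rev)
  moreover have "a \<notin> Y" using inX[OF ab(1,4)] unfolding X'_def Y_def by blast
  ultimately obtain qY where qY: "walk (Y \<union> {w}) qY" "hd qY = v" "last qY = w"
    using split[of "rev p" v a Y] vY nadj adj_sym unfolding Y_def X'_def by blast
  have "v \<notin> X'" using X unfolding X'_def by blast
  then obtain qX where qX: "walk (X' \<union> {w}) qX" "hd qX = a" "last qX = w"
    using split[OF p, of X'] inX[OF ab(1,4)] nadj X(3) unfolding Y_def X'_def by blast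
  have cons: "contains_path adj (Z \<union> {u, w}) u w"
    if q: "walk (Z \<union> {w}) q" "adj u (hd q)" "last q = w" for Z q
  proof -
    have "walk (Z \<union> {u, w}) ([u] @ q)"
      by (rule walk_append) (use q walk_mono[OF q(1), of "Z \<union> {u, w}"] in auto)
    moreover have "q \<noteq> []" using q(1) by (simp add: walk_def)
    ultimately show ?thesis using is_path_of_walk[of "Z \<union> {u, w}" "[u] @ q"] q(3) by simp
  qed
  show ?thesis
    unfolding has_proper_2_cutset_def
  proof (intro exI conjI)
    show "u \<in> V" "w \<in> V" "u \<noteq> w" "\<not> adj u w" using V w by auto
    show "X' \<union> Y \<union> {u, w} = V" using X V w unfolding X'_def Y_def by auto
    show "X' \<inter> Y = {}" "u \<notin> X' \<union> Y" "w \<notin> X' \<union> Y" using X unfolding X'_def Y_def by auto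
    have "card {a, b} \<le> card X'" using inX ab fin by (intro card_mono) auto
    then show "2 \<le> card X'" using ab(3) by simp
    have "\<exists>y\<in>Y. y \<noteq> v"
    proof (cases "c = w")
      case True
      then have "d \<in> Y" using inY[OF cd(2)] cd by auto
      then show ?thesis using cd(2) by (metis adj_irrefl)
    next
      case False
      then have "c \<in> Y" using inY[OF cd(1)] cd by auto
      then show ?thesis using cd(1) by (metis adj_irrefl)
    qed
    then obtain y where "y \<in> Y" "y \<noteq> v" by blast
    then have "card {v, y} \<le> card Y" using vY fin by (intro card_mono) auto
    then show "2 \<le> card Y" using \<open>y \<noteq> v\<close> by simp
    show "\<forall>x\<in>X'. \<forall>y\<in>Y. \<not> adj x y" using nadj by blast
    show "contains_path adj (X' \<union> {u, w}) u w" using cons[OF qX(1)] qX ab by simp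
    show "contains_path adj (Y \<union> {u, w}) u w" using cons[OF qY(1)] qY uv by simp
    show "\<not> induces_path adj (X' \<union> {u, w}) u w"
    proof
      assume "induces_path adj (X' \<union> {u, w}) u w"
      then obtain p where p: "distinct p" "hd p = u"
        "\<And>x y. x \<in> X' \<union> {u, w} \<Longrightarrow> y \<in> X' \<union> {u, w} \<Longrightarrow> adj x y \<Longrightarrow> consec p x y"
        by (rule induces_pathD) blast
      have "consec p u a" "consec p u b" using p(3) inX ab by auto
      then show False using consec_hd_unique[OF p(1)] p(2) ab(3) by blast
    qed
    show "\<not> induces_path adj (Y \<union> {u, w}) u w"
    proof
      assume "induces_path adj (Y \<union> {u, w}) u w"
      then obtain p where p: "distinct p"
        "\<And>x y. x \<in> Y \<union> {u, w} \<Longrightarrow> y \<in> Y \<union> {u, w} \<Longrightarrow> adj x y \<Longrightarrow> consec p x y"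
        by (rule induces_pathD) blast
      have "consec p v x" if "adj v x" for x using p(2)[of v x] inY[OF that] vY that by blast
      then have "consec p v c" "consec p v d" "consec p v e" using cd by blast+
      then have "c = d \<or> c = e \<or> d = e" by (rule consec_three[OF p(1)])
      then show False using cd by blast
    qed
  qed
qed

end

context tsf_graph
begin

text \<open>A cycle through \<open>u\<close> and \<open>v\<close> in the graph without the edge
  \<open>uv\<close> has \<open>uv\<close> as a chord. If a vertex \<open>w\<close> prevents such a
  cycle, then \<open>w\<close> and the edge \<open>uv\<close> together separate the graph.\<close>

lemma chorded_cycle:
  assumes no1: "\<not> has_1_cutset V adj" and no2: "\<not> has_proper_2_cutset V adj"
    and uv: "adj u v" "3 \<le> degree V adj u" "3 \<le> degree V adj v"
  shows "\<exists>c. chorded c"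
proof -
  define adj' where "adj' x y \<longleftrightarrow> adj x y \<and> {x, y} \<noteq> {u, v}" for x y
  interpret G': graph V adj'
    by unfold_locales
      (use finV adjV adj_sym in \<open>auto simp: simple_graph_def adj'_def insert_commute\<close>)
  have V: "u \<in> V" "v \<in> V" using adjV[OF uv(1)] by auto
  have ne: "u \<noteq> v" using uv(1) by auto
  have sep: "\<exists>q. G'.walk (V - {w}) q \<and> hd q = u \<and> last q = v" if w: "w \<noteq> u" "w \<noteq> v" "w \<in> V" for w
  proof (rule ccontr)
    assume no: "\<not> ?thesis"
    define X where "X = G'.comp (V - {w}) u"
    have X: "u \<in> X" "v \<notin> X" "w \<notin> X" "X \<subseteq> V"
      using G'.comp_self[of u "V - {w}"] G'.comp_subset[of "V - {w}" u] no w V unfolding X_def G'.comp_def by auto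
    have sepX: "x = u \<and> y = v" if xy: "x \<in> X" "y \<in> V - X - {w}" "adj x y" for x y
    proof (rule ccontr)
      assume n: "\<not> ?thesis"
      have "{x, y} \<noteq> {u, v}" using n xy X by (auto simp: doubleton_eq_iff)
      then have "adj' x y" using xy(3) unfolding adj'_def by simp
      then have "y \<in> X" using G'.comp_closed[of x "V - {w}" u y] xy unfolding X_def by blast
      then show False using xy by blast
    qed
    show False
    proof (cases "adj u w")
      case False
      show False using edge_separator_cutset[OF no1 uv(1) w(3,1,2) False X sepX uv(2,3)] no2 by blast
    next
      \<comment> \<open>The cutset must consist of nonadjacent vertices. Without triangles
        \<open>w\<close> misses \<open>v\<close> if it sees \<open>u\<close>, so \<open>u\<close>
        and \<open>v\<close> exchange roles.\<close>
      case True
      then have vw: "\<not> adj v w" using no_triangle uv(1) adj_sym by blast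
      let ?Y = "V - X - {w}"
      have Y: "v \<in> ?Y" "u \<notin> ?Y" "w \<notin> ?Y" "?Y \<subseteq> V" using X V w by auto
      have sepY: "x = v \<and> y = u" if "x \<in> ?Y" "y \<in> V - ?Y - {w}" "adj x y" for x y
        using sepX[of y x] that adj_sym by blast
      show False using edge_separator_cutset[OF no1 adj_sym[OF uv(1)] w(3,2,1) vw Y sepY uv(3,2)] no2 by blast
    qed
  qed
  have "\<not> adj' u v" unfolding adj'_def by simp
  moreover have "\<exists>w\<in>V. w \<noteq> u \<and> w \<noteq> v"
  proof -
    obtain a where "adj u a" "a \<noteq> v" using degree_nbrs[OF uv(2), of v] by metis
    then show ?thesis using adjV by (metis adj_irrefl)
  qed
  then obtain q where "G'.walk V q" "hd q = u" "last q = v"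
    using sep G'.walk_mono[of _ _ V] by (metis Diff_subset)
  moreover have "\<exists>q. G'.walk (V - {w}) q \<and> hd q = u \<and> last q = v" if "w \<noteq> u" "w \<noteq> v" for w
    using sep[OF that] calculation by (cases "w \<in> V") auto
  ultimately obtain c where c: "is_cycle V adj' c" "u \<in> set c" "v \<in> set c"
    using G'.cycle_through_two[OF V ne] by blast
  have "is_cycle V adj c" using c(1) unfolding is_cycle_def adj'_def by blast
  moreover have "\<not> consec (c @ [hd c]) u v"
  proof
    assume "consec (c @ [hd c]) u v"
    then have "adj' u v" using c(1) unfolding G'.successively_iff_consec is_cycle_eq by blast
    then show False unfolding adj'_def by simp
  qed
  ultimately show ?thesis unfolding chorded_def using c uv(1) by blast
qed

text \<open>The chord ends in cyclic order \<open>x\<close>, \<open>z\<close>, \<open>y\<close>,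
  \<open>z'\<close> become the vertices 0 to 3; the arcs are the long edges of a 4-cycle and the
  chords its unit diagonals.\<close>

lemma crossing_emb:
  assumes cr: "crossing x A z B y C z' D" and ne: "A \<noteq> []" "B \<noteq> []" "C \<noteq> []" "D \<noteq> []"
    and only: "\<And>s t. s \<in> set (x # A @ z # B @ y # C @ z' # D) \<Longrightarrow> t \<in> set (x # A @ z # B @ y # C @ z' # D) \<Longrightarrow> adj s t \<Longrightarrow>
      consec ((x # A @ z # B @ y # C @ z' # D) @ [x]) s t \<or> {s, t} = {x, y} \<or> {s, t} = {z, z'}"
  shows "\<exists>f I. emb 4 (skel K4_long K4_unit) f I"
proof -
  note One_nat_def [simp del]
  let ?c = "x # A @ z # B @ y # C @ z' # D"
  define f where "f i = (if i = 0 then x else if i = 1 then z else if i = 2 then y else z')" for i :: nat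
  \<comment> \<open>The arc \<open>D\<close> runs from vertex 3 to vertex 0, whereas
    \<open>K4_long\<close> lists \<open>(0,3)\<close>; \<open>upd\<close> provides the reversed
    list.\<close>
  define I where "I = upd (upd (upd (upd (\<lambda>_ _. []) 0 1 A) 1 2 B) 2 3 C) 3 0 D"
  have d: "distinct ?c" and V: "set ?c \<subseteq> V" and suc: "successively adj (?c @ [x])"
    using cr by (auto simp: crossing_def is_cycle_eq)
  have f: "f 0 = x" "f 1 = z" "f 2 = y" "f 3 = z'" by (auto simp: f_def)
  have I: "I 0 1 = A" "I 1 2 = B" "I 2 3 = C" "I 0 3 = rev D" "I 0 2 = []" "I 1 3 = []"
    "I 1 0 = rev A" "I 2 1 = rev B" "I 3 2 = rev C" "I 3 0 = D" "I 2 0 = []" "I 3 1 = []"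
    by (auto simp: I_def upd_def)
  have E: "set (skel K4_long K4_unit) = {(0, 1, Long), (0, 3, Long), (1, 2, Long), (2, 3, Long), (0, 2, Unit), (1, 3, Unit)}"
    unfolding skel_def K4_long_def K4_unit_def by auto
  have n4: "{..<4::nat} = {0, 1, 2, 3}" by auto
  have f4: "f ` {..<4} = {x, z, y, z'}" unfolding n4 by (simp add: f)
  have revs: "I v u = rev (I u v)" if "(u, v, l) \<in> set (skel K4_long K4_unit)" for u v l
    using that unfolding E by (elim insertE emptyE) (simp_all add: I)
  have img: "img 4 (skel K4_long K4_unit) f I = set ?c"
  proof -
    have "img 4 (skel K4_long K4_unit) f I = f ` {..<4} \<union> (\<Union>(u, v, l)\<in>set (skel K4_long K4_unit). set (I u v))"
      by (rule img_list) (rule revs)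
    then show ?thesis unfolding E f4 by (auto simp: I)
  qed
  have "emb 4 (skel K4_long K4_unit) f I"
  proof (rule embI)
    show "inj_on f {..<4}" unfolding n4 using d by (auto simp: f inj_on_def)
    show "img 4 (skel K4_long K4_unit) f I \<subseteq> V" unfolding img by (rule V)
  next
    fix u v l assume "(u, v, l) \<in> set (skel K4_long K4_unit)"
    then show "u < 4 \<and> v < 4 \<and> u \<noteq> v \<and> I v u = rev (I u v)
         \<and> distinct (I u v) \<and> set (I u v) \<inter> f ` {..<4} = {}
         \<and> (l = Unit \<longrightarrow> I u v = []) \<and> (l = Long \<longrightarrow> I u v \<noteq> [])"
      unfolding E f4 using d ne by (elim insertE emptyE) (auto simp: I)
  next
    fix u v l u' v' l' assume "(u, v, l) \<in> set (skel K4_long K4_unit)" "(u', v', l') \<in> set (skel K4_long K4_unit)"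
      "{u, v} \<noteq> {u', v'}"
    then show "set (I u v) \<inter> set (I u' v') = {}"
      unfolding E using d by (elim insertE emptyE) (auto simp: I)
  next
    fix s t assume st: "s \<in> img 4 (skel K4_long K4_unit) f I" "t \<in> img 4 (skel K4_long K4_unit) f I"
    have "consec (x # rev D @ [z']) s t \<longleftrightarrow> consec (z' # D @ [x]) s t"
      using consec_rev[of "z' # D @ [x]" s t] by simp
    then have "(\<exists>(u, v, l)\<in>set (skel K4_long K4_unit). consec (spath f I u v) s t) \<longleftrightarrow>
        consec (?c @ [x]) s t \<or> {s, t} = {x, y} \<or> {s, t} = {z, z'}"
      unfolding E consec_arcs by (simp add: spath_def I f consec_Cons[of _ "[_]"]) blast
    moreover have "adj s t" if "consec (?c @ [x]) s t" using suc that unfolding successively_iff_consec by blast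
    moreover have "adj x y" "adj z z'" using cr by (auto simp: crossing_def)
    ultimately show "adj s t \<longleftrightarrow> (\<exists>(u, v, l)\<in>set (skel K4_long K4_unit). consec (spath f I u v) s t)"
      using only[of s t] st adj_sym unfolding img by (metis doubleton_eq_iff)
  qed
  then show ?thesis by blast
qed

end

section \<open>Tables for the seven skeletons\<close>

text \<open>There is one hole per edge, long edges first; that edge closes the listed cycle.\<close>

lemma K4_cover: "cover_check 4 K4_long K4_unit
    [[1,2,0], [0,1,3], [2,0,1], [3,0,2], [0,1,2], [3,0,1]]"
  by code_simp

text \<open>Keys are locations, where \<open>4 + k\<close> is the inside of the long edge with index
  \<open>k\<close>; certificates use the vertex numbers after the splits. Only ears between opposite
  long edges survive. All four halves single edges gives P1; inner ends next to the two ends of a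
  common other long edge, with the remaining halves long, gives H3.\<close>

lemma K4_ears: "ear_check 4 K4_long K4_unit [(6, skel P1_long P1_unit), (6, skel H3_long H3_unit)]
    [((2,4), Cyc [0,3,2,4]), ((3,4), Cyc [1,2,3,4]), ((1,5), Cyc [1,2,3,4]),
    ((2,5), Cyc [0,1,2,4]), ((4,5), Cyc [1,2,3,5,4]), ((0,6), Cyc [0,3,2,4]),
    ((3,6), Cyc [0,1,4,3]), ((4,6), Cyc [0,3,2,5,4]),
    ((5,6), Branch 1 5 (Branch 5 2 (Branch 0 4 (Branch 4 3 (Iso 0 [0,2,4,3,1,5]) (Cyc
    [0,2,3,1,5,4])) (Cyc [0,1,3,4,5,2])) (Branch 0 4 (Branch 4 3 (Cyc [0,2,3,1,5,4]) (Iso 1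
    [2,0,1,3,4,5])) (Cyc [0,1,5,4,3,2]))) (Branch 5 2 (Branch 0 4 (Cyc [0,1,3,4,5,2]) (Branch 4
    3 (Iso 1 [0,2,3,1,5,4]) (Cyc [0,1,3,2,5,4]))) (Branch 0 4 (Cyc [0,1,3,4,5,2]) (Cyc
    [0,1,5,4,3,2])))),
    ((0,7), Cyc [0,1,2,4]), ((1,7), Cyc [0,1,4,3]),
    ((4,7), Branch 2 5 (Branch 5 3 (Branch 0 4 (Branch 4 1 (Iso 0 [0,2,4,1,3,5]) (Cyc
    [0,2,1,3,5,4])) (Cyc [0,2,5,4,1,3])) (Branch 0 4 (Cyc [0,2,5,4,1,3]) (Branch 4 1 (Iso 1
    [0,2,1,3,5,4]) (Cyc [0,3,1,2,5,4])))) (Branch 5 3 (Branch 0 4 (Branch 4 1 (Cyc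
    [0,2,1,3,5,4]) (Iso 1 [1,3,0,2,5,4])) (Cyc [0,2,5,4,1,3])) (Branch 0 4 (Cyc [0,2,5,4,1,3])
    (Cyc [0,2,1,4,5,3])))),
    ((5,7), Cyc [0,1,2,5,4]), ((6,7), Cyc [0,1,4,5,3])]"
  by code_simp

text \<open>The new vertex gets the last number. There is no \<open>Iso\<close> leaf, so a vertex
  with three or more attachments never extends K4. The key \<open>[4,5,6,7]\<close> is required by
  the closure condition, as its four triples are keys.\<close>

lemma K4_stars: "star_check 4 K4_long K4_unit [(6, skel P1_long P1_unit), (6, skel H3_long H3_unit)]
    [(0,2),(1,3)]
    [([0,1,3,2], [0,1,2,3,4,7]), ([0,2,1,3], [0,1,2,3,5,6]), ([0,1,2], [0,1,2,4,6]),
    ([0,1,3], [0,1,3,4,5]), ([0,2,3], [0,2,3,5,7]), ([1,2,3], [1,2,3,6,7])]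
    [([2,4,5], Branch 0 5 (Short [0,2,6,5]) (Cyc [0,2,3,5,6,4])),
    ([3,4,6], Branch 1 5 (Short [1,3,6,5]) (Cyc [1,3,2,5,6,4])), ([4,5,6], Cyc [0,4,1,6,7,5]),
    ([1,5,7], Branch 2 5 (Branch 5 3 (Short [1,3,5,6]) (Cyc [1,2,5,6,4,3])) (Branch 5 3 (Short
    [1,3,5,6]) (Cyc [1,2,5,6,4,3]))),
    ([4,5,7], Cyc [0,4,7,6,3,5]), ([0,6,7], Branch 2 5 (Short [0,2,5,6]) (Cyc [0,2,4,6,5,3])),
    ([4,6,7], Cyc [1,4,7,6,2,5]), ([5,6,7], Cyc [2,5,7,4,3,6]), ([4,5,6,7], Cyc [0,4,8,7,3,5])]"
  by code_simp

text \<open>The last four entries are the midpoints of the long edges in the order of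
  \<open>K4_long\<close>. The vertices 9 and 10 left out are adjacent.\<close>

lemma K4_extension: "check_ext petersen_V petersen_adj [1,3,5,7,2,6,4,8]
    (halve 4 (skel K4_long K4_unit) K4_long)"
  by code_simp

lemma P1_cover: "cover_check 6 P1_long P1_unit
    [[0,1,3,4], [3,2,0,1], [2,0,1,5], [1,3,2,0], [0,1,3,2], [5,2,0,1], [2,0,1,3], [4,0,1,3],
    [4,0,1,5]]"
  by code_simp

text \<open>All ears are refuted, so P1 grows only by a single vertex.\<close>

lemma P1_ears: "ear_check 6 P1_long P1_unit [(10, skel P0_long P0_unit), (10, skel H1_long H1_unit)]
    [((1,2), Cyc [0,1,2,3,4]), ((0,3), Cyc [0,1,5,2,3]), ((1,4), Cyc [0,1,4,5,2]),
    ((2,4), Cyc [0,1,3,4,2]), ((0,5), Cyc [0,1,3,4,5]), ((3,5), Cyc [0,1,5,3,4]),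
    ((1,6), Cyc [0,2,5,1,6]), ((2,6), Cyc [0,1,3,2,6]), ((3,6), Cyc [1,3,6,4,5]),
    ((5,6), Cyc [1,3,4,6,5]), ((0,7), Cyc [0,4,5,1,6]), ((2,7), Cyc [0,2,6,3,4]),
    ((4,7), Cyc [0,2,3,6,4]), ((5,7), Cyc [0,1,6,5,2]), ((6,7), Cyc [0,2,5,1,7,6]),
    ((0,8), Cyc [0,4,3,2,6]), ((1,8), Cyc [0,1,6,5,4]), ((3,8), Cyc [0,1,3,6,2]),
    ((4,8), Cyc [0,1,5,6,4]), ((6,8), Cyc [0,1,3,2,7,6]), ((7,8), Cyc [0,1,6,7,5,4])]"
  by code_simp

text \<open>Only a vertex with a neighbour inside each of the three long edges survives. If all six
  halves are single edges, it completes the Petersen graph; in two patterns with one long half per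
  edge it yields H1.\<close>

lemma P1_stars: "star_check 6 P1_long P1_unit [(10, skel P0_long P0_unit), (10, skel H1_long
    H1_unit)]
    [(0,1),(0,2),(1,2),(0,3),(2,3),(1,4),(2,4),(3,4),(0,5),(1,5),(3,5),(4,5)]
    [([0,1,3,4], [0,1,3,4,6,7]), ([0,2,5,4], [0,2,4,5,6,8]), ([1,3,2,5], [1,2,3,5,7,8])]
    [([2,6,7], Cyc [0,1,5,2,8,6]), ([5,6,7], Cyc [0,1,7,8,5,2]), ([1,6,8], Cyc [0,1,5,7,8,6]),
    ([3,6,8], Cyc [0,1,3,8,7,2]), ([0,7,8], Cyc [0,4,3,2,7,8]), ([4,7,8], Cyc [0,1,5,7,8,4]),
    ([6,7,8], Branch 2 8 (Branch 8 5 (Branch 1 7 (Branch 7 3 (Branch 0 6 (Branch 6 4 (Iso 0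
    [0,1,5,4,6,2,8,9,7,3]) (Cyc [0,1,5,4,3,7,9,6])) (Cyc [0,1,7,9,6,4,3,2])) (Cyc
    [1,5,4,3,2,8,9,7])) (Cyc [0,1,5,8,9,7,3,2])) (Branch 1 7 (Branch 7 3 (Cyc [1,5,4,3,2,8,9,7])
    (Branch 0 6 (Cyc [0,1,7,9,6,4,3,2]) (Branch 6 4 (Iso 1 [0,1,5,4,6,9,7,3,2,8]) (Cyc
    [0,1,5,4,3,7,9,6])))) (Cyc [0,1,5,8,9,7,3,2]))) (Branch 8 5 (Branch 1 7 (Cyc
    [0,1,5,8,9,7,3,2]) (Branch 7 3 (Branch 0 6 (Branch 6 4 (Cyc [0,1,5,4,3,7,9,6]) (Iso 1
    [1,0,2,3,7,9,6,4,5,8])) (Cyc [0,1,7,9,6,4,3,2])) (Cyc [1,5,4,3,2,8,9,7]))) (Branch 1 7 (Cyc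
    [0,1,5,8,9,7,3,2]) (Cyc [0,1,5,4,3,7,9,8,2]))))]"
  by code_simp

lemma P1_extension: "check_ext petersen_V petersen_adj [1,2,5,4,10,9,6,3,8]
    (halve 6 (skel P1_long P1_unit) P1_long)"
  by code_simp

lemma P0_cover: "cover_check 10 P0_long P0_unit
    [[1,2,3,4,0], [0,1,2,3,4], [0,1,2,6,5], [2,3,4,0,1], [8,7,4,0,1], [3,4,0,1,2], [6,5,0,1,2],
    [4,0,1,2,3], [9,5,0,4,3], [4,0,1,8,7], [5,0,1,2,6], [5,0,1,8,9], [6,5,0,4,7], [7,4,0,1,8],
    [9,5,0,1,8]]"
  by code_simp

lemma P0_ears: "ear_check 10 P0_long P0_unit []
    [((0,2), Cyc [0,2,1,8,7,4]), ((0,3), Cyc [0,3,2,6,7,4]), ((1,3), Cyc [0,1,3,2,6,5]),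
    ((1,4), Cyc [0,1,4,3,9,5]), ((2,4), Cyc [0,4,2,3,9,5]), ((1,5), Cyc [0,1,5,6,7,4]),
    ((2,5), Cyc [0,4,7,6,2,5]), ((3,5), Cyc [0,1,8,9,3,5]), ((4,5), Cyc [0,1,2,3,4,5]),
    ((0,6), Cyc [0,1,8,9,5,6]), ((1,6), Cyc [0,1,6,2,3,4]), ((3,6), Cyc [0,1,2,3,6,5]),
    ((4,6), Cyc [0,1,8,7,6,4]), ((0,7), Cyc [0,1,2,3,4,7]), ((1,7), Cyc [0,1,7,8,9,5]),
    ((2,7), Cyc [0,1,2,7,6,5]), ((3,7), Cyc [0,1,2,3,7,4]), ((5,7), Cyc [0,1,2,6,7,5]),
    ((0,8), Cyc [0,1,2,3,9,8]), ((2,8), Cyc [0,1,2,8,7,4]), ((3,8), Cyc [0,1,8,3,9,5]),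
    ((4,8), Cyc [0,4,8,7,6,5]), ((5,8), Cyc [0,4,3,9,8,5]), ((6,8), Cyc [0,1,8,6,7,4]),
    ((0,9), Cyc [0,1,2,6,5,9]), ((1,9), Cyc [0,1,9,8,7,4]), ((2,9), Cyc [0,1,2,9,3,4]),
    ((4,9), Cyc [0,1,2,3,9,4]), ((6,9), Cyc [0,1,2,6,9,5]), ((7,9), Cyc [0,1,8,7,9,5])]"
  by code_simp

text \<open>The Petersen graph has diameter 2, so \<open>Cl\<close> contains every pair and no
  triple is left to check.\<close>

lemma P0_stars: "star_check 10 P0_long P0_unit []
    [(0,1),(0,2),(1,2),(0,3),(1,3),(2,3),(0,4),(1,4),(2,4),(3,4),(0,5),(1,5),(2,5),(3,5),(4,5),(0,6),(1,6),(2,6),(3,6),(4,6),(5,6),(0,7),(1,7),(2,7),(3,7),(4,7),(5,7),(6,7),(0,8),(1,8),(2,8),(3,8),(4,8),(5,8),(6,8),(7,8),(0,9),(1,9),(2,9),(3,9),(4,9),(5,9),(6,9),(7,9),(8,9)]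
    []
    []"
  by code_simp

lemma P0_extension: "check_ext petersen_V petersen_adj [1,2,3,4,5,6,7,8,9,10]
    (halve 10 (skel P0_long P0_unit) P0_long)"
  by code_simp

lemma H3_cover: "cover_check 6 H3_long H3_unit
    [[3,4,5,0], [0,3,4,5], [2,3,0,1], [4,5,0,3], [5,0,3,4], [1,2,3,0], [4,3,0,1], [2,5,0,3],
    [5,0,3,2]]"
  by code_simp

text \<open>The long edges \<open>(0,3)\<close>, \<open>(3,4)\<close>, \<open>(4,5)\<close> and
  \<open>(0,5)\<close> form a 4-cycle. Only ears between opposite ones survive, with all four halves
  single edges.\<close>

lemma H3_ears: "ear_check 6 H3_long H3_unit [(8, skel H2_long H2_unit)]
    [((0,2), Cyc [0,2,3,4,5]), ((1,3), Cyc [0,3,1,4,5]), ((0,4), Cyc [0,4,1,2,5]),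
    ((2,4), Cyc [0,3,4,2,5]), ((1,5), Cyc [0,3,4,1,5]), ((3,5), Cyc [0,1,2,3,5]),
    ((1,6), Cyc [0,5,4,1,6]), ((2,6), Cyc [1,2,6,3,4]), ((4,6), Cyc [0,5,2,1,4,6]),
    ((5,6), Cyc [1,2,3,6,5,4]), ((1,7), Cyc [0,3,4,1,6]), ((2,7), Cyc [1,2,6,5,4]),
    ((3,7), Cyc [1,2,3,6,5,4]), ((4,7), Cyc [0,3,2,1,4,6]), ((6,7), Cyc [1,2,3,6,7,5,4]),
    ((0,8), Cyc [0,3,4,1,6]), ((3,8), Cyc [0,3,6,2,5]), ((4,8), Cyc [0,1,6,4,3]),
    ((5,8), Cyc [0,3,2,6,5]), ((6,8), Cyc [0,5,4,1,7,6]), ((7,8), Cyc [0,3,4,1,7,6]),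
    ((0,9), Cyc [0,5,2,1,4,6]), ((1,9), Cyc [0,1,6,4,5]), ((2,9), Cyc [0,3,6,2,5]),
    ((5,9), Cyc [0,1,2,3,6,5]), ((6,9), Cyc [0,5,2,1,4,7,6]),
    ((7,9), Branch 3 7 (Branch 7 4 (Branch 0 6 (Branch 6 5 (Iso 0 [0,1,4,5,6,7,3,2]) (Cyc
    [0,3,2,5,4,7,6])) (Cyc [0,1,2,5,6,7,3])) (Cyc [1,2,3,7,6,5,4])) (Cyc [0,3,2,1,4,7,6])),
    ((8,9), Cyc [0,3,7,6,2,5]), ((0,10), Cyc [0,3,2,1,4,6]), ((1,10), Cyc [0,1,6,4,3]),
    ((2,10), Cyc [0,3,2,6,5]), ((3,10), Cyc [0,1,2,3,6,5]),
    ((6,10), Branch 4 7 (Branch 7 5 (Branch 0 6 (Branch 6 3 (Iso 0 [0,1,4,3,6,7,5,2]) (Cyc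
    [0,5,2,3,4,7,6])) (Cyc [0,1,2,3,6,7,5])) (Cyc [0,5,2,1,4,7,6])) (Cyc [1,2,5,7,6,3,4])),
    ((7,10), Cyc [0,3,2,1,4,7,6]), ((8,10), Cyc [0,3,2,6,7,5]), ((9,10), Cyc [0,1,2,3,6,7,5])]"
  by code_simp

lemma H3_stars: "star_check 6 H3_long H3_unit [(8, skel H2_long H2_unit)]
    [(0,1),(2,3),(0,4),(1,4),(2,5),(3,5)]
    [([0,3,4,5], [0,3,4,5,6,7,9,10]), ([0,1,2,3], [0,1,2,3,6,8]), ([1,2,5,4], [1,2,4,5,8,10]),
    ([0,1,4,3,2,5], [0,1,2,3,4,5,7,9]), ([0,1,2,5], [0,1,2,5,7,8]),
    ([1,2,3,4], [1,2,3,4,8,9]), ([0,1,4,5,2,3], [0,1,2,3,4,5,6,10]),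
    ([0,3,2,5], [0,2,3,5,6,7]), ([0,1,4,3], [0,1,3,4,6,9]), ([0,1,4,5], [0,1,4,5,7,10]),
    ([2,3,4,5], [2,3,4,5,9,10])]
    [([1,6,7], Branch 0 7 (Short [0,1,8,7]) (Cyc [0,1,2,5,7,8,6])),
    ([4,6,8], Cyc [0,1,7,8,4,5]), ([5,6,8], Cyc [0,5,2,7,8,6]), ([3,7,8], Cyc [0,3,2,7,8,6]),
    ([4,7,8], Cyc [0,1,7,8,4,3]), ([6,7,8], Cyc [0,6,9,8,2,5,7]),
    ([2,6,9], Branch 3 7 (Short [2,3,7,8]) (Cyc [1,2,3,6,8,7,4])),
    ([0,8,9], Cyc [0,5,4,1,6,8]), ([5,8,9], Cyc [0,3,2,6,8,5]),
    ([6,8,9], Cyc [0,5,4,1,7,9,6]), ([7,8,9], Cyc [0,1,7,2,3,8,9,6]),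
    ([2,7,10], Branch 4 7 (Branch 7 5 (Short [2,5,7,8]) (Cyc [1,2,5,6,8,7,4])) (Branch 7 5
    (Short [2,5,7,8]) (Cyc [1,2,5,6,8,7,4]))),
    ([0,8,10], Cyc [0,3,4,1,6,8]), ([3,8,10], Cyc [0,3,8,6,2,5]),
    ([6,8,10], Cyc [0,1,7,2,5,8,9,6]), ([7,8,10], Cyc [0,3,4,1,7,9,6]),
    ([1,9,10], Branch 4 7 (Short [1,4,7,8]) (Cyc [0,1,4,6,8,7,5])),
    ([8,9,10], Cyc [0,3,7,9,6,2,5])]"
  by code_simp

lemma H3_extension: "check_ext heawood_V heawood_adj [1,2,4,5,7,9,14,10,3,6,8]
    (halve 6 (skel H3_long H3_unit) H3_long)"
  by code_simp

lemma H2_cover: "cover_check 8 H2_long H2_unit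
    [[0,1,7,6], [7,6,0,1], [3,7,1,2], [5,6,0,4], [1,7,6,0], [4,5,6,0], [2,3,7,1], [2,3,4,5],
    [4,5,2,3], [7,1,2,3], [6,0,4,5], [6,0,1,7]]"
  by code_simp

text \<open>The survivors join the insides of \<open>(0,6)\<close> and \<open>(2,3)\<close> or of
  \<open>(1,7)\<close> and \<open>(4,5)\<close>, again with all four halves single edges.\<close>

lemma H2_ears: "ear_check 8 H2_long H2_unit [(10, skel H1_long H1_unit)]
    [((0,2), Cyc [0,2,1,7,6]), ((0,3), Cyc [0,3,2,5,4]), ((1,3), Cyc [0,1,3,2,5,6]),
    ((1,4), Cyc [0,1,4,5,6]), ((2,4), Cyc [0,4,2,3,7,6]), ((0,5), Cyc [0,5,2,3,7,6]),
    ((1,5), Cyc [1,5,2,3,7]), ((3,5), Cyc [0,1,7,3,5,4]), ((1,6), Cyc [0,4,3,2,1,6]),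
    ((2,6), Cyc [0,4,5,2,6]), ((3,6), Cyc [0,1,7,3,6]), ((4,6), Cyc [0,1,2,3,4,6]),
    ((0,7), Cyc [0,6,5,2,3,7]), ((2,7), Cyc [0,1,7,2,5,4]), ((4,7), Cyc [1,2,3,4,7]),
    ((5,7), Cyc [0,1,7,5,6]), ((1,8), Cyc [0,4,5,2,1,8]), ((2,8), Cyc [0,1,7,3,2,8]),
    ((3,8), Cyc [0,4,5,2,3,8]), ((4,8), Cyc [0,1,7,3,4,8]), ((5,8), Cyc [1,2,5,8,6,7]),
    ((7,8), Cyc [1,2,5,6,8,7]), ((0,9), Cyc [0,6,5,2,1,8]), ((2,9), Cyc [0,1,8,2,3,4]),
    ((3,9), Cyc [0,4,3,8,7,6]), ((4,9), Cyc [0,1,8,4,5,6]), ((5,9), Cyc [0,4,5,8,7,6]),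
    ((6,9), Cyc [0,4,3,7,8,6]), ((8,9), Cyc [0,4,5,2,1,9,8]), ((0,10), Cyc [0,6,5,4,3,8]),
    ((1,10), Cyc [0,1,8,2,5,4]), ((4,10), Cyc [0,1,7,3,8,4]), ((5,10), Cyc [0,1,2,8,5,4]),
    ((6,10), Cyc [0,1,7,3,8,6]), ((7,10), Cyc [0,1,7,8,3,4]),
    ((8,10), Branch 2 9 (Branch 9 3 (Branch 0 8 (Branch 8 6 (Iso 0 [1,0,4,3,7,6,8,9,2,5]) (Cyc
    [0,1,7,6,5,2,9,8])) (Cyc [0,1,7,6,8,9,3,4])) (Cyc [0,4,3,7,1,2,9,8])) (Cyc
    [0,1,2,5,4,3,9,8])),
    ((9,10), Cyc [0,1,8,9,2,5,4]), ((0,11), Cyc [0,6,7,3,4,8]), ((1,11), Cyc [0,4,8,1,7,6]),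
    ((2,11), Cyc [0,1,2,8,5,6]), ((3,11), Cyc [0,1,7,3,8,4]), ((6,11), Cyc [0,1,2,5,8,6]),
    ((7,11), Cyc [0,1,7,8,5,6]), ((8,11), Cyc [0,1,7,3,4,9,8]),
    ((9,11), Branch 4 9 (Branch 9 5 (Branch 1 8 (Branch 8 7 (Iso 0 [0,1,2,5,6,7,8,9,4,3]) (Cyc
    [0,1,8,9,4,3,7,6])) (Cyc [0,1,2,3,7,8,9,4])) (Cyc [0,4,9,8,1,2,5,6])) (Cyc
    [0,1,8,9,5,2,3,4])),
    ((10,11), Cyc [0,1,7,3,8,9,4])]"
  by code_simp

lemma H2_stars: "star_check 8 H2_long H2_unit [(10, skel H1_long H1_unit)]
    [(0,1),(0,2),(1,2),(0,3),(0,4),(1,4),(3,4),(1,5),(2,5),(2,6),(3,6),(5,6),(3,7),(4,7),(5,7),(6,7)]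
    [([0,1,7,6,5,4], [0,1,4,5,6,7,9,11]), ([0,1,2,3,7,6], [0,1,2,3,6,7,8,10]),
    ([2,3,4,5], [2,3,4,5,10,11]), ([0,4,5,6], [0,4,5,6,8,11]), ([1,2,3,7], [1,2,3,7,9,10]),
    ([0,1,7,6], [0,1,6,7,8,9]), ([0,4,3,2,5,6], [0,2,3,4,5,6,8,10]),
    ([1,2,5,4,3,7], [1,2,3,4,5,7,9,11])]
    [([2,8,9], Cyc [0,1,9,10,2,3,4]), ([3,8,9], Cyc [0,1,9,7,3,10,8]),
    ([4,8,9], Cyc [0,1,2,3,4,10,8]), ([5,8,9], Cyc [0,1,9,10,5,6,8]),
    ([0,9,10], Cyc [0,6,5,4,3,9,10]), ([4,9,10], Cyc [0,1,8,10,4,5,6]),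
    ([5,9,10], Cyc [0,1,2,9,10,5,4]), ([6,9,10], Cyc [0,4,5,2,9,10,6]),
    ([8,9,10], Cyc [0,1,9,11,10,2,5,4]), ([1,8,11], Cyc [0,1,10,9,5,6,8]),
    ([2,8,11], Cyc [0,1,7,3,2,10,8]), ([3,8,11], Cyc [0,1,7,3,10,9,4]),
    ([7,8,11], Cyc [0,4,9,10,7,6,8]), ([8,9,11], Cyc [0,1,9,11,10,5,6,8]),
    ([0,10,11], Cyc [0,6,7,1,2,8,10]), ([1,10,11], Cyc [0,1,10,8,2,5,6]),
    ([6,10,11], Cyc [0,1,7,3,8,10,6]), ([7,10,11], Cyc [0,1,7,10,8,3,4]),
    ([8,10,11], Cyc [0,1,7,3,9,11,10,4]), ([9,10,11], Cyc [0,1,8,11,9,2,5,6]),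
    ([8,9,10,11], Cyc [0,1,9,12,11,5,6,8])]"
  by code_simp

lemma H2_extension: "check_ext heawood_V heawood_adj [1,2,3,5,14,12,11,6,10,7,4,13]
    (halve 8 (skel H2_long H2_unit) H2_long)"
  by code_simp

lemma H1_cover: "cover_check 10 H1_long H1_unit
    [[4,3,7,8,0], [9,8,0,1,2], [7,8,0,1,6], [1,2,9,8,0], [0,4,3,7,8], [2,9,8,0,1], [6,7,8,0,1],
    [3,4,0,1,2], [3,7,8,0,4], [7,8,0,4,3], [5,9,8,0,4], [5,4,0,1,6], [9,8,0,4,5], [8,0,4,3,7],
    [8,0,4,5,9]]"
  by code_simp

lemma H1_ears: "ear_check 10 H1_long H1_unit [(14, skel H0_long H0_unit)]
    [((0,2), Cyc [0,2,1,6,7,8]), ((0,3), Cyc [0,3,2,9,5,4]), ((1,3), Cyc [0,1,3,2,9,8]),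
    ((1,4), Cyc [0,4,1,2,9,8]), ((2,4), Cyc [0,4,2,3,7,8]), ((0,5), Cyc [0,4,3,2,9,5]),
    ((1,5), Cyc [0,1,5,6,7,8]), ((2,5), Cyc [0,4,5,2,9,8]), ((3,5), Cyc [0,4,3,5,9,8]),
    ((0,6), Cyc [0,6,1,2,9,8]), ((2,6), Cyc [0,1,2,6,7,8]), ((3,6), Cyc [0,4,3,6,7,8]),
    ((4,6), Cyc [0,4,6,5,9,8]), ((0,7), Cyc [0,7,6,5,9,8]), ((1,7), Cyc [0,1,7,6,5,4]),
    ((2,7), Cyc [0,4,3,2,7,8]), ((4,7), Cyc [0,1,2,3,7,4]), ((5,7), Cyc [0,1,6,7,5,4]),
    ((1,8), Cyc [0,4,3,2,1,8]), ((2,8), Cyc [0,4,5,9,2,8]), ((3,8), Cyc [0,1,6,7,3,8]),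
    ((4,8), Cyc [0,1,2,9,8,4]), ((5,8), Cyc [0,1,2,9,5,8]), ((6,8), Cyc [0,4,3,7,6,8]),
    ((0,9), Cyc [0,4,3,7,8,9]), ((1,9), Cyc [0,1,9,2,3,4]), ((3,9), Cyc [0,1,2,9,3,4]),
    ((4,9), Cyc [0,1,6,5,9,4]), ((6,9), Cyc [0,4,5,6,9,8]), ((7,9), Cyc [0,4,3,7,9,8]),
    ((1,10), Cyc [0,8,7,6,1,10]), ((2,10), Cyc [0,1,6,7,3,2,10]),
    ((3,10), Cyc [2,3,10,4,5,9]), ((5,10), Cyc [2,3,4,10,5,9]),
    ((6,10), Cyc [0,1,2,9,5,6,10]), ((7,10), Cyc [0,1,2,9,8,7,10]),
    ((8,10), Cyc [0,1,2,9,8,10]), ((9,10), Cyc [0,1,6,7,8,9,10]),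
    ((0,11), Cyc [0,4,3,7,8,9,10]), ((1,11), Cyc [0,1,10,2,3,4]),
    ((3,11), Cyc [0,1,2,10,3,4]), ((4,11), Cyc [0,4,10,2,3,7,8]),
    ((5,11), Cyc [0,4,5,10,9,8]), ((6,11), Cyc [0,4,5,6,10,9,8]),
    ((7,11), Cyc [0,4,3,2,10,7,8]), ((8,11), Cyc [0,4,5,9,10,8]),
    ((10,11), Cyc [0,1,6,7,3,2,11,10]), ((0,12), Cyc [0,4,3,2,1,6,10]),
    ((1,12), Cyc [0,1,10,6,5,4]), ((2,12), Cyc [0,4,3,2,10,7,8]),
    ((3,12), Cyc [0,4,3,10,7,8]), ((4,12), Cyc [0,4,10,6,5,9,8]),
    ((5,12), Cyc [0,1,6,10,5,4]), ((8,12), Cyc [0,4,3,7,10,8]),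
    ((9,12), Cyc [0,4,3,7,10,9,8]), ((10,12), Cyc [0,1,2,9,5,6,11,10]),
    ((11,12), Cyc [0,4,3,2,10,11,7,8])]"
  by code_simp

text \<open>The only survivor has a neighbour inside each of the three long edges, all halves being
  single edges: it is the missing vertex of the Heawood graph.\<close>

lemma H1_stars: "star_check 10 H1_long H1_unit [(14, skel H0_long H0_unit)]
    [(0,1),(0,2),(1,2),(1,3),(2,3),(2,4),(3,4),(1,5),(3,5),(4,5),(0,6),(1,6),(2,6),(4,6),(5,6),(0,7),(2,7),(3,7),(4,7),(0,8),(1,8),(3,8),(5,8),(7,8),(0,9),(4,9),(5,9),(6,9),(7,9),(8,9)]
    [([0,4,3,2,9,8], [0,2,3,4,8,9,10,11]), ([0,4,5,6,7,8], [0,4,5,6,7,8,10,12]),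
    ([1,2,9,8,7,6], [1,2,6,7,8,9,11,12]), ([0,1,2,9,5,4], [0,1,2,4,5,9,10,11]),
    ([0,1,6,7,3,4], [0,1,3,4,6,7,10,12]), ([2,3,7,6,5,9], [2,3,5,6,7,9,11,12])]
    [([6,10,11], Cyc [0,1,2,11,12,6,7,8]), ([7,10,11], Cyc [0,1,6,7,12,11,9,8]),
    ([2,10,12], Cyc [0,1,2,3,7,11,12,10]), ([9,10,12], Cyc [0,1,2,9,12,11,7,8]),
    ([0,11,12], Cyc [0,4,3,2,1,6,11,12]), ([4,11,12], Cyc [0,4,12,10,2,3,7,8]),
    ([10,11,12], Branch 6 12 (Branch 12 7 (Branch 2 11 (Branch 11 9 (Branch 0 10 (Branch 10 4
    (Iso 0 [0,1,2,3,4,5,6,12,7,8,9,11,13,10]) (Cyc [0,1,2,3,4,5,6,12,13,10])) (Cyc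
    [0,1,2,11,13,10,4,3,7,8])) (Cyc [0,1,2,11,13,12,6,5,9,8])) (Cyc [0,1,2,3,7,12,13,11,9,8]))
    (Cyc [0,1,6,12,13,11,2,3,7,8])) (Cyc [0,1,6,5,9,11,13,12,7,8]))]"
  by code_simp

lemma H1_extension: "check_ext heawood_V heawood_adj [1,2,3,4,5,6,7,9,10,11,14,12,8]
    (halve 10 (skel H1_long H1_unit) H1_long)"
  by code_simp

lemma H0_cover: "cover_check 14 H0_long H0_unit
    [[1,2,3,4,13,0], [0,1,2,3,8,9], [0,1,2,3,4,13], [2,3,4,13,0,1], [6,5,4,13,0,1],
    [3,4,13,0,1,2], [11,10,9,0,1,2], [4,13,0,1,2,3], [8,9,0,1,2,3], [4,13,0,1,6,5],
    [13,0,1,2,3,4], [5,4,13,0,1,6], [10,9,0,1,6,5], [7,8,9,0,1,6], [8,9,0,1,6,7],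
    [12,13,0,1,6,7], [9,0,1,2,3,8], [9,0,1,2,11,10], [10,9,0,1,2,11], [12,13,0,1,2,11],
    [13,0,1,2,11,12]]"
  by code_simp

lemma H0_ears: "ear_check 14 H0_long H0_unit []
    [((0,2), Cyc [0,2,1,6,5,4,13]), ((0,3), Cyc [0,3,2,1,6,5,10,9]),
    ((1,3), Cyc [0,1,3,2,11,10,9]), ((0,4), Cyc [0,4,3,2,11,12,13]),
    ((1,4), Cyc [0,1,4,3,2,11,10,9]), ((2,4), Cyc [0,1,2,4,3,8,9]),
    ((0,5), Cyc [0,5,4,3,2,11,10,9]), ((1,5), Cyc [0,1,5,6,7,8,9]),
    ((2,5), Cyc [0,1,2,5,4,3,8,9]), ((3,5), Cyc [0,1,2,3,5,4,13]),
    ((0,6), Cyc [0,6,1,2,3,4,13]), ((2,6), Cyc [0,1,2,6,5,4,13]),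
    ((3,6), Cyc [0,1,2,3,6,5,10,9]), ((4,6), Cyc [0,1,6,4,5,10,9]),
    ((0,7), Cyc [0,7,6,1,2,3,4,13]), ((1,7), Cyc [0,1,7,6,5,4,13]),
    ((2,7), Cyc [0,1,2,7,6,5,4,13]), ((3,7), Cyc [0,1,2,3,7,8,9]),
    ((4,7), Cyc [0,1,2,3,4,7,8,9]), ((5,7), Cyc [0,1,6,5,7,8,9]),
    ((0,8), Cyc [0,8,3,2,11,10,9]), ((1,8), Cyc [0,1,8,3,2,11,12,13]),
    ((2,8), Cyc [0,1,2,8,3,4,13]), ((4,8), Cyc [0,1,2,3,4,8,9]),
    ((5,8), Cyc [0,1,2,3,4,5,8,9]), ((6,8), Cyc [0,1,6,8,7,12,13]),
    ((1,9), Cyc [0,1,9,8,3,4,13]), ((2,9), Cyc [0,1,2,9,8,7,12,13]),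
    ((3,9), Cyc [0,1,6,7,8,3,9]), ((4,9), Cyc [0,1,2,11,10,5,4,9]),
    ((5,9), Cyc [0,1,2,11,10,5,9]), ((6,9), Cyc [0,1,2,3,4,5,6,9]),
    ((7,9), Cyc [0,1,2,3,8,7,9]), ((0,10), Cyc [0,10,9,8,3,4,13]),
    ((1,10), Cyc [0,1,10,5,4,3,8,9]), ((2,10), Cyc [0,1,2,10,11,12,13]),
    ((3,10), Cyc [0,1,2,3,10,5,4,13]), ((4,10), Cyc [0,1,6,5,4,10,9]),
    ((6,10), Cyc [0,1,6,10,5,4,13]), ((7,10), Cyc [0,1,2,3,8,7,10,9]),
    ((8,10), Cyc [0,1,2,3,8,10,9]), ((0,11), Cyc [0,11,2,1,6,5,4,13]),
    ((1,11), Cyc [0,1,11,2,3,4,13]), ((3,11), Cyc [0,1,2,3,11,10,9]),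
    ((4,11), Cyc [0,1,2,3,4,11,10,9]), ((5,11), Cyc [0,1,2,11,5,10,9]),
    ((6,11), Cyc [0,1,2,11,6,5,4,13]), ((7,11), Cyc [0,1,2,11,7,12,13]),
    ((8,11), Cyc [0,1,2,3,8,11,12,13]), ((9,11), Cyc [0,1,6,5,10,11,9]),
    ((0,12), Cyc [0,12,7,6,5,4,13]), ((1,12), Cyc [0,1,12,7,6,5,10,9]),
    ((2,12), Cyc [0,1,2,12,11,10,9]), ((3,12), Cyc [0,1,2,3,12,7,8,9]),
    ((4,12), Cyc [0,1,2,3,4,12,13]), ((5,12), Cyc [0,1,2,3,4,5,12,13]),
    ((6,12), Cyc [0,1,6,12,7,8,9]), ((8,12), Cyc [0,1,6,7,8,12,13]),
    ((9,12), Cyc [0,1,2,3,4,13,12,9]), ((10,12), Cyc [0,1,2,11,10,12,13]),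
    ((1,13), Cyc [0,1,13,4,3,8,9]), ((2,13), Cyc [0,1,2,13,4,5,10,9]),
    ((3,13), Cyc [0,1,6,5,4,3,13]), ((5,13), Cyc [0,1,2,3,4,5,13]),
    ((6,13), Cyc [0,1,2,3,8,7,6,13]), ((7,13), Cyc [0,1,2,11,12,7,13]),
    ((8,13), Cyc [0,1,2,11,10,9,8,13]), ((9,13), Cyc [0,1,2,3,4,13,9]),
    ((10,13), Cyc [0,1,2,3,4,5,10,13]), ((11,13), Cyc [0,1,6,7,12,11,13])]"
  by code_simp

text \<open>The Heawood graph is bipartite, and two vertices of one class are at distance 2. Among
  any three vertices two are in the same class, so some pair is in \<open>Cl\<close>.\<close>

lemma H0_stars: "star_check 14 H0_long H0_unit []
    [(0,1),(0,2),(1,2),(1,3),(2,3),(0,4),(2,4),(3,4),(1,5),(3,5),(4,5),(0,6),(1,6),(2,6),(4,6),(5,6),(1,7),(3,7),(5,7),(6,7),(0,8),(2,8),(3,8),(4,8),(6,8),(7,8),(0,9),(1,9),(3,9),(5,9),(7,9),(8,9),(0,10),(2,10),(4,10),(5,10),(6,10),(8,10),(9,10),(1,11),(2,11),(3,11),(5,11),(7,11),(9,11),(10,11),(0,12),(2,12),(4,12),(6,12),(7,12),(8,12),(10,12),(11,12),(0,13),(1,13),(3,13),(4,13),(5,13),(7,13),(9,13),(11,13),(12,13)]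
    []
    []"
  by code_simp

lemma H0_extension: "check_ext heawood_V heawood_adj [1,2,3,4,5,6,7,8,9,10,11,12,13,14]
    (halve 14 (skel H0_long H0_unit) H0_long)"
  by code_simp

section \<open>Assembly of the cases\<close>

context tsf_graph
begin

text \<open>The skeletons are treated from the largest ones downwards, so that the targets of each
  table are settled before the table is used.\<close>

lemma K4_case:
  assumes "emb 4 (skel K4_long K4_unit) f I"
  shows "two_extension V adj petersen_V petersen_adj \<or> two_extension V adj heawood_V heawood_adj
    \<or> has_1_cutset V adj \<or> has_proper_2_cutset V adj" (is ?G)
proof -
  have P0: ?G if "emb 10 (skel P0_long P0_unit) f I" for f I
    using skeleton_step[OF that P0_cover P0_ears P0_stars P0_extension] by auto
  have H0: ?G if "emb 14 (skel H0_long H0_unit) f I" for f I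
    using skeleton_step[OF that H0_cover H0_ears H0_stars H0_extension] by auto
  have H1: ?G if "emb 10 (skel H1_long H1_unit) f I" for f I
    using skeleton_step[OF that H1_cover H1_ears H1_stars H1_extension] H0 by auto
  have P1: ?G if "emb 6 (skel P1_long P1_unit) f I" for f I
    using skeleton_step[OF that P1_cover P1_ears P1_stars P1_extension] P0 H1 by auto
  have H2: ?G if "emb 8 (skel H2_long H2_unit) f I" for f I
    using skeleton_step[OF that H2_cover H2_ears H2_stars H2_extension] H1 by auto
  have H3: ?G if "emb 6 (skel H3_long H3_unit) f I" for f I
    using skeleton_step[OF that H3_cover H3_ears H3_stars H3_extension] H2 by auto
  show ?G
    using skeleton_step[OF assms K4_cover K4_ears K4_stars K4_extension] P1 H3 by auto
qed

lemma nonsparse_case: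
  assumes "\<not> sparse V adj"
  shows "two_extension V adj petersen_V petersen_adj \<or> two_extension V adj heawood_V heawood_adj
    \<or> has_1_cutset V adj \<or> has_proper_2_cutset V adj"
proof (cases "has_1_cutset V adj \<or> has_proper_2_cutset V adj")
  case False
  obtain u v where "adj u v" "3 \<le> degree V adj u" "3 \<le> degree V adj v"
    using assms unfolding sparse_def by blast
  then obtain c where "chorded c" using chorded_cycle False by blast
  then obtain x A z B y C z' D where "crossing x A z B y C z' D"
    "A \<noteq> []" "B \<noteq> []" "C \<noteq> []" "D \<noteq> []"
    "\<And>s t. s \<in> set (x # A @ z # B @ y # C @ z' # D) \<Longrightarrow> t \<in> set (x # A @ z # B @ y # C @ z' # D) \<Longrightarrow> adj s t \<Longrightarrow>
      consec ((x # A @ z # B @ y # C @ z' # D) @ [x]) s t \<or> {s, t} = {x, y} \<or> {s, t} = {z, z'}"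
    by (rule chorded_crossing) blast
  then obtain f I where "emb 4 (skel K4_long K4_unit) f I" using crossing_emb by blast
  then show ?thesis by (rule K4_case)
qed auto

end

theorem theorem2:
  fixes V :: "'a set" and adj :: "'a \<Rightarrow> 'a \<Rightarrow> bool"
  assumes "simple_graph V adj"
    and "connected_graph V adj"
    and "unichord_free V adj"
  shows "complete_graph V adj \<or> sparse V adj
    \<or> two_extension V adj petersen_V petersen_adj
    \<or> two_extension V adj heawood_V heawood_adj
    \<or> has_1_cutset V adj \<or> has_proper_2_cutset V adj \<or> has_proper_1_join V adj"
proof -
  interpret G: unichord_free_graph V adj
    by unfold_locales (fact assms)+
  show ?thesis
  proof (cases "\<exists>a b c. adj a b \<and> adj b c \<and> adj c a")
    case True
    then show ?thesis using G.triangle_case by blast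
  next
    case tri: False
    show ?thesis
    proof (cases "\<exists>a b c d. adj a b \<and> adj b c \<and> adj c d \<and> adj d a \<and> a \<noteq> c \<and> b \<noteq> d")
      case True
      then show ?thesis using G.square_case tri by blast
    next
      case False
      interpret H: tsf_graph V adj
        by unfold_locales (use tri False in blast)+
      show ?thesis using H.nonsparse_case by blast
    qed
  qed
qed

end
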